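(* Let $g=(A_1A_2)^2\in G=(\mathbb Z/4)*(\mathbb Z/4)$. Let $s\in\mathbb R_+$ be irrational and let $z\in\mathbb C$ be arbitrary. There is an unbounded sequence $\{p_k\}$ of positive integers such that, for each $k$, a positive density set of points in $\mathbb C$ are periodic with period $p_k$ with respect to $g_{s,z}$.
   Context: For $s>0$ and $z\in\mathbb C$, let $G_{s,z}$ be the infinite grid of squares of side length $s$ in $\mathbb C$, with sides parallel to the coordinate axes, having $z$ as a vertex. Let $R_{s,z}$ be the map, defined on the interiors of the squares of $G_{s,z}$, which rotates each square about its own center clockwise by $\pi/2$. Let $A_1,A_2$ be the standard generators of $G=(\mathbb Z/4)*(\mathbb Z/4)$. For $g\in G$, $g_{s,z}$ is the partially defined map of $\mathbb C$ obtained from the word $g$ by replacing $A_1$ with $R_{1,0}$ and $A_2$ with $R_{s,z}$ and composing. Thus for $g=(A_1A_2)^2$, $g_{s,z}=(R_{1,0}\circ R_{s,z})^2$. A set $E\subset\mathbb C$ has positive density if $\liminf_{r\to\infty}\mathrm{area}(E\cap B_r(0))/(\pi r^2)>0$. *)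

theory Defs
  imports "HOL-Analysis.Analysis" "HOL-Algebra.Group"
begin

section \<open>The group \<open>(\<int>/4) * (\<int>/4)\<close>\<close>

text \<open>
  Since each generator has order 4, every element of the free product is represented by exactly
  one word in the letters \<open>A1\<close>, \<open>A2\<close> (without inverses) in which no letter occurs four times in
  a row. The group is realised on these reduced words; the inverse of a generator is its third power.
\<close>

datatype letter = A1 | A2

definition reduced_word :: "letter list \<Rightarrow> bool" where
  "reduced_word w \<longleftrightarrow> (\<nexists>u a v. w = u @ [a, a, a, a] @ v)"

definition push :: "letter \<Rightarrow> letter list \<Rightarrow> letter list" where
  "push a w = (if take 3 w = [a, a, a] then drop 3 w else a # w)"

definition Z4_free_Z4 :: "letter list monoid" where
  "Z4_free_Z4 = \<lparr>carrier = {w. reduced_word w}, mult = foldr push, one = []\<rparr>"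

lemma reduced_word_Nil [simp]: "reduced_word []"
  by (simp add: reduced_word_def)

lemma reduced_word_Cons: "reduced_word (a # w) \<longleftrightarrow> take 3 w \<noteq> [a, a, a] \<and> reduced_word w"
proof
  assume r: "reduced_word (a # w)"
  have "take 3 w \<noteq> [a, a, a]"
  proof
    assume "take 3 w = [a, a, a]"
    then have "a # w = [] @ [a, a, a, a] @ drop 3 w"
      using append_take_drop_id [of 3 w] by simp
    with r show False unfolding reduced_word_def by blast
  qed
  moreover have "reduced_word w"
    unfolding reduced_word_def
  proof (intro notI, elim exE)
    fix u b v assume "w = u @ [b, b, b, b] @ v"
    then have "a # w = (a # u) @ [b, b, b, b] @ v" by simp
    with r show False unfolding reduced_word_def by blast
  qed
  ultimately show "take 3 w \<noteq> [a, a, a] \<and> reduced_word w" ..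
next
  assume r: "take 3 w \<noteq> [a, a, a] \<and> reduced_word w"
  show "reduced_word (a # w)"
    unfolding reduced_word_def
  proof (intro notI, elim exE)
    fix u b v assume eq: "a # w = u @ [b, b, b, b] @ v"
    show False
    proof (cases u)
      case Nil
      with eq r show False by simp
    next
      case (Cons c u')
      with eq have "w = u' @ [b, b, b, b] @ v" by simp
      with r show False unfolding reduced_word_def by blast
    qed
  qed
qed

lemma reduced_word_push: "reduced_word w \<Longrightarrow> reduced_word (push a w)"
proof (cases "take 3 w = [a, a, a]")
  case True
  assume "reduced_word w"
  moreover have "w = a # a # a # drop 3 w"
    using True append_take_drop_id [of 3 w] by simp
  ultimately show ?thesis
    using True by (metis push_def reduced_word_Cons)
qed (simp add: push_def reduced_word_Cons)

lemma reduced_word_foldr_push: "reduced_word w \<Longrightarrow> reduced_word (foldr push u w)"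
  by (induction u) (auto simp: reduced_word_push)

lemma push_4:
  assumes "reduced_word w" shows "push a (push a (push a (push a w))) = w"
proof -
  consider v where "w = v \<or> w = a # v \<or> w = a # a # v \<or> w = a # a # a # v" "take 1 v \<noteq> [a]"
    | v where "w = a # a # a # a # v"
  proof -
    have split: "take 1 x \<noteq> [a] \<or> (\<exists>y. x = a # y)" for x :: "letter list"
      by (cases x) auto
    show ?thesis
      using that split by metis
  qed
  then show ?thesis
  proof cases
    case 1
    then have "v = [] \<or> (\<exists>c r. v = c # r \<and> c \<noteq> a)"
      by (cases v) auto
    with 1 show ?thesis
      by (auto simp: push_def numeral_3_eq_3)
  next
    case 2
    with assms show ?thesis by (simp add: reduced_word_Cons)
  qed
qed

lemma foldr_push_push:
  assumes "reduced_word w" shows "foldr push (push a v) w = push a (foldr push v w)"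
proof (cases "take 3 v = [a, a, a]")
  case True
  then have "v = a # a # a # drop 3 v"
    using append_take_drop_id [of 3 v] by simp
  then have "foldr push v w = push a (push a (push a (foldr push (drop 3 v) w)))"
    by (metis foldr.simps(2) comp_apply)
  with True show ?thesis
    by (simp add: push_def [of a v] push_4 reduced_word_foldr_push assms)
qed (simp add: push_def [of a v])

lemma foldr_push_assoc:
  assumes "reduced_word w" shows "foldr push (foldr push u v) w = foldr push u (foldr push v w)"
  by (induction u) (auto simp: foldr_push_push assms)

lemma foldr_push_Nil: "reduced_word u \<Longrightarrow> foldr push u [] = u"
  by (induction u) (auto simp: reduced_word_Cons push_def)

lemma ex_left_inverse: "\<exists>v. reduced_word v \<and> foldr push v u = []" if "reduced_word u"
  using that
proof (induction u)
  case Nil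
  then show ?case by (intro exI [of _ "[]"]) simp
next
  case (Cons a u)
  then have u: "reduced_word u" "push a u = a # u"
    by (auto simp: reduced_word_Cons push_def)
  then obtain v where v: "reduced_word v" "foldr push v u = []"
    using Cons by blast
  let ?v = "foldr push v [a, a, a]"
  have "foldr push ?v (a # u) = foldr push v (push a (push a (push a (push a u))))"
    using foldr_push_assoc [OF Cons.prems, of v "[a, a, a]"] u(2) by simp
  also have "\<dots> = []"
    using u v push_4 [OF u(1), of a] by simp
  finally show ?case
    by (intro exI [of _ ?v]) (simp add: reduced_word_foldr_push reduced_word_Cons)
qed

lemma group_Z4_free_Z4: "group Z4_free_Z4"
  by (rule groupI)
     (auto simp: Z4_free_Z4_def reduced_word_foldr_push foldr_push_assoc ex_left_inverse)

lemma letter_in_carrier: "[a] \<in> carrier Z4_free_Z4"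
  by (simp add: Z4_free_Z4_def reduced_word_Cons)

lemma letter_pow_4: "[a] [^]\<^bsub>Z4_free_Z4\<^esub> (4::nat) = \<one>\<^bsub>Z4_free_Z4\<^esub>"
  by (simp add: Z4_free_Z4_def push_def nat_pow_def numeral_eq_Suc)

lemma carrier_generate: "w \<in> carrier Z4_free_Z4 \<Longrightarrow>
    w = foldr (\<lambda>a y. [a] \<otimes>\<^bsub>Z4_free_Z4\<^esub> y) w \<one>\<^bsub>Z4_free_Z4\<^esub>"
  using foldr_push_Nil [of w] by (simp add: Z4_free_Z4_def)

text \<open>The universal property of the free product; the homomorphism is unique because the letters generate.\<close>

lemma Z4_free_Z4_universal:
  assumes H: "group H" and x: "\<And>a. x a \<in> carrier H" "\<And>a. x a [^]\<^bsub>H\<^esub> (4::nat) = \<one>\<^bsub>H\<^esub>"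
  shows "\<exists>h \<in> hom Z4_free_Z4 H. \<forall>a. h [a] = x a"
proof -
  interpret group H by (rule H)
  define h where "h w = foldr (\<lambda>a y. x a \<otimes>\<^bsub>H\<^esub> y) w \<one>\<^bsub>H\<^esub>" for w
  have hc: "h w \<in> carrier H" for w
    by (induction w) (auto simp: h_def x)
  have x4: "x a \<otimes>\<^bsub>H\<^esub> (x a \<otimes>\<^bsub>H\<^esub> (x a \<otimes>\<^bsub>H\<^esub> (x a \<otimes>\<^bsub>H\<^esub> y))) = y" if "y \<in> carrier H" for a y
    using x(2) [of a] that by (simp add: numeral_eq_Suc x(1) m_assoc [symmetric])
  have hp: "h (push a w) = x a \<otimes>\<^bsub>H\<^esub> h w" for a w
  proof (cases "take 3 w = [a, a, a]")
    case True
    then have "w = a # a # a # drop 3 w"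
      using append_take_drop_id [of 3 w] by simp
    then have "h w = x a \<otimes>\<^bsub>H\<^esub> (x a \<otimes>\<^bsub>H\<^esub> (x a \<otimes>\<^bsub>H\<^esub> h (drop 3 w)))"
      unfolding h_def by (metis foldr.simps(2) comp_apply)
    with True show ?thesis by (simp add: push_def x4 hc)
  qed (simp add: push_def h_def)
  have "h (foldr push u v) = h u \<otimes>\<^bsub>H\<^esub> h v" for u v
  proof (induction u)
    case (Cons a u)
    have "h (a # u) = x a \<otimes>\<^bsub>H\<^esub> h u" by (simp add: h_def)
    with Cons show ?case by (simp add: hp m_assoc x(1) hc)
  qed (simp add: h_def hc[unfolded h_def])
  then have "h \<in> hom Z4_free_Z4 H"
    by (auto simp: hom_def Z4_free_Z4_def hc)
  moreover have "h [a] = x a" for a by (simp add: h_def x(1))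
  ultimately show ?thesis by blast
qed


section \<open>Grid rotations\<close>

text \<open>The squares of the grid, indexed by the integer coordinates of their lower left corners.\<close>

definition grid_square :: "real \<Rightarrow> complex \<Rightarrow> int \<times> int \<Rightarrow> complex set" where
  "grid_square s z = (\<lambda>(m, n).
     cbox (z + s *\<^sub>R Complex (of_int m) (of_int n))
          (z + s *\<^sub>R Complex (of_int m + 1) (of_int n + 1)))"

definition grid_center :: "real \<Rightarrow> complex \<Rightarrow> int \<times> int \<Rightarrow> complex" where
  "grid_center s z = (\<lambda>(m, n). z + s *\<^sub>R Complex (of_int m + 1/2) (of_int n + 1/2))"

definition rotate_cw :: "complex \<Rightarrow> complex \<Rightarrow> complex" where
  "rotate_cw c w = c + cis (- (pi / 2)) * (w - c)"

text \<open>For \<open>s > 0\<close> the interiors of distinct squares are disjoint, so \<open>q\<close> below is unique.\<close>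

definition grid_rotation :: "real \<Rightarrow> complex \<Rightarrow> complex \<rightharpoonup> complex" where
  "grid_rotation s z w =
     (if \<exists>q. w \<in> interior (grid_square s z q)
      then Some (rotate_cw (grid_center s z (THE q. w \<in> interior (grid_square s z q))) w)
      else None)"

lemma in_interior_grid_square:
  "w \<in> interior (grid_square s z (m, n)) \<longleftrightarrow>
     Re z + s * m < Re w \<and> Re w < Re z + s * (m + 1) \<and>
     Im z + s * n < Im w \<and> Im w < Im z + s * (n + 1)"
  by (auto simp: grid_square_def in_box_complex_iff)

lemma grid_square_unique:
  assumes "s > 0" "w \<in> interior (grid_square s z q)" "w \<in> interior (grid_square s z q')"
  shows "q = q'"
proof -
  have *: "m = m'" if "a + s * of_int m < x" "x < a + s * (of_int m + 1)"
    "a + s * of_int m' < x" "x < a + s * (of_int m' + 1)" for m m' :: int and a x :: real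
  proof -
    have "s * of_int m < s * (of_int m' + 1)" "s * of_int m' < s * (of_int m + 1)"
      using that by linarith+
    then have "real_of_int m < of_int m' + 1" "real_of_int m' < of_int m + 1"
      using \<open>s > 0\<close> by (auto dest: mult_left_less_imp_less)
    then show ?thesis by linarith
  qed
  obtain m n m' n' where "q = (m, n)" "q' = (m', n')" by (metis surj_pair)
  with assms * show ?thesis
    by (fastforce simp: in_interior_grid_square)
qed

lemma grid_rotation_eq:
  assumes "s > 0" "w \<in> interior (grid_square s z q)"
  shows "grid_rotation s z w = Some (rotate_cw (grid_center s z q) w)"
proof -
  have "(THE q. w \<in> interior (grid_square s z q)) = q"
    using assms grid_square_unique by (intro the_equality) blast+
  with assms(2) show ?thesis by (metis grid_rotation_def)
qed

text \<open>As usual for composition, the rightmost letter of the word acts first.\<close>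

primrec letter_map :: "real \<Rightarrow> complex \<Rightarrow> letter \<Rightarrow> complex \<rightharpoonup> complex" where
  "letter_map s z A1 = grid_rotation 1 0"
| "letter_map s z A2 = grid_rotation s z"

definition word_map :: "real \<Rightarrow> complex \<Rightarrow> letter list \<Rightarrow> complex \<rightharpoonup> complex" where
  "word_map s z w = foldr (\<lambda>a f. letter_map s z a \<circ>\<^sub>m f) w Some"

lemma word_map_A1_A2_square:
  "word_map s z (([A1] \<otimes>\<^bsub>Z4_free_Z4\<^esub> [A2]) [^]\<^bsub>Z4_free_Z4\<^esub> (2::nat)) =
     (grid_rotation 1 0 \<circ>\<^sub>m grid_rotation s z) \<circ>\<^sub>m (grid_rotation 1 0 \<circ>\<^sub>m grid_rotation s z)"
proof -
  have "([A1] \<otimes>\<^bsub>Z4_free_Z4\<^esub> [A2]) [^]\<^bsub>Z4_free_Z4\<^esub> (2::nat) = [A1, A2, A1, A2]"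
    by (simp add: Z4_free_Z4_def push_def numeral_2_eq_2 nat_pow_def)
  then show ?thesis
    by (auto simp: word_map_def map_comp_def fun_eq_iff split: option.splits)
qed


section \<open>Periodic points and density\<close>

primrec partial_iterate :: "('a \<rightharpoonup> 'a) \<Rightarrow> nat \<Rightarrow> 'a \<rightharpoonup> 'a" where
  "partial_iterate f 0 = Some"
| "partial_iterate f (Suc n) = f \<circ>\<^sub>m partial_iterate f n"

text \<open>The period is the least period. The first condition implies that the whole orbit is defined.\<close>

definition periodic_with_period :: "('a \<rightharpoonup> 'a) \<Rightarrow> nat \<Rightarrow> 'a \<Rightarrow> bool" where
  "periodic_with_period f p w \<longleftrightarrow>
     p > 0 \<and> partial_iterate f p w = Some w \<and> (\<forall>j. 0 < j \<and> j < p \<longrightarrow> partial_iterate f j w \<noteq> Some w)"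

definition positive_density :: "complex set \<Rightarrow> bool" where
  "positive_density E \<longleftrightarrow>
     E \<in> sets lebesgue \<and>
     Liminf at_top (\<lambda>r::real. ereal (measure lebesgue (E \<inter> ball 0 r) / (pi * r\<^sup>2))) > 0"

end

(*
  Measured from the centres of its cells in the two grids, a point of the plane becomes a point of the
  4-torus C/Z[i] x C/sZ[i], and R_{1,0} o R_{s,z} becomes a piecewise isometry f of the torus which commutes
  with multiplication by i.  For irrational s the plane is equidistributed in the torus, and the points
  near a periodic point share its period, so one periodic point of f^2 off the discontinuities gives
  a positive density set of points of the plane with that period.  Up to powers of i, f preserves
  certain surfaces, on which it is the map
    x' = x - 2y mod 1,   y' = y + x' mod t        (centred remainders)
  or its inverse, with t = s or t = 1/s respectively, so that t > 1 can be arranged.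

  Write t = k + c or t = k - c with k an integer and 0 < c < 1/2.  The map with parameter c, respectively
  its inverse, is up to sign induced by the map with parameter t, and orbits that are not too short gain
  points when they are lifted to parameter t.  Exchanging the coordinates turns the parameter c into
  1/(2c) > 1.  Iterating both operations from short explicit periodic orbits produces arbitrarily long
  ones for every irrational t > 1.
*)

theory Submission
  imports Defs
begin

text \<open>The linear part (x, y) \<mapsto> (x - 2y, x - y) of the planar maps has square -1. Once
  the seam of the torus is moved to y = 0 (\<open>pet_shift\<close>), a branch is this rotation
  about a centre such as (0, c/2) instead of the origin, so two steps give (x, y) \<mapsto> -(x, y -
  c): up to sign, a translation by the period of the smaller torus. In this way parameter t imitates
  wrapping around modulo c, and for this reason orbits are counted up to sign.

  The obstacle is that a lifted orbit need not be strictly longer. Above an integer every orbit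
  wraps around somewhere and gains a point there. Below an integer two kinds of orbits may fail to
  gain: those in the central strip, with at most 4 points, and those circling the centre (-d, 0),
  with at most 8. Hence the induction starts with orbits of 9 points, obtained from eight-point
  cycles that do gain.\<close>

subsection \<open>Orbits up to sign\<close>

text \<open>The renormalizations below are return maps only after identifying \<open>p\<close> with \<open>- p\<close>.\<close>

definition orb :: "(real \<times> real \<Rightarrow> real \<times> real) \<Rightarrow> real \<times> real \<Rightarrow> (real \<times> real) set" where
  "orb T p = {q. \<exists>n. q = (T ^^ n) p \<or> q = - (T ^^ n) p}"

definition odd_map :: "(real \<times> real \<Rightarrow> real \<times> real) \<Rightarrow> (real \<times> real) set \<Rightarrow> bool" where
  "odd_map T X \<longleftrightarrow> (\<forall>p\<in>X. - p \<in> X \<and> T p \<in> X \<and> T (- p) = - T p)"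

definition long_orbit :: "(real \<times> real \<Rightarrow> real \<times> real) \<Rightarrow> (real \<times> real) set \<Rightarrow> nat \<Rightarrow> bool" where
  "long_orbit T X N \<longleftrightarrow> (\<exists>p\<in>X. finite (orb T p) \<and> N \<le> card (orb T p))"

lemma long_orbit_mono: "long_orbit T X N \<Longrightarrow> M \<le> N \<Longrightarrow> long_orbit T X M"
  by (auto simp: long_orbit_def)

lemma odd_mapD:
  assumes "odd_map T X" "p \<in> X"
  shows "- p \<in> X" "T p \<in> X" "T (- p) = - T p"
  using assms by (auto simp: odd_map_def)

lemma odd_map_funpow:
  assumes "odd_map T X" "p \<in> X"
  shows "(T ^^ n) p \<in> X \<and> (T ^^ n) (- p) = - (T ^^ n) p"
  by (induction n) (use assms in \<open>auto simp: odd_map_def\<close>)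

lemma orb_funpow: "(T ^^ n) p \<in> orb T p" "- (T ^^ n) p \<in> orb T p"
  by (auto simp: orb_def)

lemma orb_self: "p \<in> orb T p"
  using orb_funpow [where n = 0] by simp

lemma orb_subset_domain:
  assumes "odd_map T X" "p \<in> X" shows "orb T p \<subseteq> X"
  using assms by (auto simp: orb_def odd_map_funpow odd_mapD)

lemma orb_uminus: "q \<in> orb T p \<Longrightarrow> - q \<in> orb T p"
  by (force simp: orb_def)

lemma orb_trans:
  assumes "odd_map T X" "p \<in> X" "q \<in> orb T p"
  shows "orb T q \<subseteq> orb T p"
proof
  fix r assume "r \<in> orb T q"
  then obtain n where n: "r = (T ^^ n) q \<or> r = - (T ^^ n) q" by (auto simp: orb_def)
  obtain m where m: "q = (T ^^ m) p \<or> q = - (T ^^ m) p"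
    using assms(3) by (auto simp: orb_def)
  have "(T ^^ n) q = (T ^^ (n + m)) p \<or> (T ^^ n) q = - (T ^^ (n + m)) p"
    using m odd_map_funpow [OF assms(1), of "(T ^^ m) p" n] odd_map_funpow [OF assms(1,2), of m]
    by (metis comp_apply funpow_add)
  with n show "r \<in> orb T p"
    by (metis minus_minus orb_funpow)
qed

lemma orb_eventually_periodic:
  assumes T: "odd_map T X" "p \<in> X" and "i < j" and eq: "(T ^^ j) p = (T ^^ i) p \<or> (T ^^ j) p = - (T ^^ i) p"
  shows "orb T p = (\<lambda>n. (T ^^ n) p) ` {..<j} \<union> (\<lambda>n. - (T ^^ n) p) ` {..<j}" (is "_ = ?R")
proof -
  have neg: "q \<in> ?R \<Longrightarrow> - q \<in> ?R" for q by auto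
  have "(T ^^ n) p \<in> ?R" for n
  proof (induction n rule: less_induct)
    case (less n)
    show ?case
    proof (cases "n < j")
      case False
      \<comment> \<open>Oddness of \<open>T\<close> lets the sign of the coincidence pass through
        the remaining n - j iterates, so time n reduces to the earlier time k up to sign.\<close>
      define k where "k = n - j + i"
      have k: "k < n" "n = (n - j) + j" using False \<open>i < j\<close> by (auto simp: k_def)
      have "(T ^^ n) p = (T ^^ (n - j)) ((T ^^ j) p)"
        using k(2) by (metis comp_apply funpow_add)
      also have "\<dots> = (T ^^ k) p \<or> \<dots> = - (T ^^ k) p"
        using eq odd_map_funpow [OF T(1), of "(T ^^ i) p" "n - j"] odd_map_funpow [OF T, of i]
        unfolding k_def by (metis comp_apply funpow_add)
      finally show ?thesis using less [OF k(1)] neg by auto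
    qed auto
  qed
  then have "orb T p \<subseteq> ?R" using neg unfolding orb_def by blast
  moreover have "?R \<subseteq> orb T p" using orb_funpow by blast
  ultimately show ?thesis by blast
qed

lemma orb_finite_card:
  assumes "odd_map T X" "p \<in> X" "i < j" "(T ^^ j) p = (T ^^ i) p \<or> (T ^^ j) p = - (T ^^ i) p"
  shows "finite (orb T p)" "card (orb T p) \<le> 2 * j"
proof -
  note eq = orb_eventually_periodic [OF assms]
  show "finite (orb T p)" unfolding eq by auto
  have "card (orb T p) \<le> card ((\<lambda>n. (T ^^ n) p) ` {..<j}) + card ((\<lambda>n. - (T ^^ n) p) ` {..<j})"
    unfolding eq by (rule card_Un_le)
  also have "\<dots> \<le> j + j"
    by (intro add_mono order.trans [OF card_image_le]) auto
  finally show "card (orb T p) \<le> 2 * j" by simp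
qed

lemma orb_finite_repeat:
  assumes "finite (orb T p)"
  obtains i j where "i < j" "(T ^^ j) p = (T ^^ i) p"
proof -
  have "finite (range (\<lambda>n. (T ^^ n) p))"
    by (rule finite_subset [OF _ assms]) (auto simp: orb_funpow)
  then have "\<not> inj (\<lambda>n. (T ^^ n) p)"
    using finite_imageD infinite_UNIV_nat by blast
  then obtain i j where "i \<noteq> j" "(T ^^ j) p = (T ^^ i) p"
    by (auto simp: inj_on_def)
  then show ?thesis using that by (metis linorder_neqE_nat)
qed

section \<open>Maps induced by another map, up to sign\<close>

definition induced_by ::
  "(real \<times> real \<Rightarrow> real \<times> real) \<Rightarrow> (real \<times> real) set \<Rightarrow> (real \<times> real \<Rightarrow> real \<times> real) \<Rightarrow> (real \<times> real \<Rightarrow> real \<times> real) \<Rightarrow> bool"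
  where "induced_by T D S \<phi> \<longleftrightarrow>
    (\<forall>p\<in>D. \<exists>n>0. (S ^^ n) (\<phi> p) = \<phi> (T p) \<or> (S ^^ n) (\<phi> p) = - \<phi> (T p))"

lemma induced_orbit:
  assumes T: "odd_map T D" and S: "odd_map S Y" and \<phi>: "\<phi> ` D \<subseteq> Y" "\<And>p. p \<in> D \<Longrightarrow> \<phi> (- p) = - \<phi> p"
    and ind: "induced_by T D S \<phi>" and p: "p \<in> D"
  shows "\<phi> ` orb T p \<subseteq> orb S (\<phi> p)" "finite (orb T p) \<Longrightarrow> finite (orb S (\<phi> p))"
proof -
  define pm where "pm a b \<longleftrightarrow> a = b \<or> a = - b" for a b :: "real \<times> real"
  have step: "\<exists>m>0. pm ((S ^^ m) (\<phi> q)) (\<phi> (T q))" if "q \<in> D" for q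
    using ind that by (auto simp: induced_by_def pm_def)
  have S_pm: "pm ((S ^^ m) a) ((S ^^ m) b)" if "pm a b" "b \<in> Y" for a b m
    using that odd_map_funpow [OF S, of b m] unfolding pm_def by metis
  have pm_trans: "pm a c" if "pm a b" "pm b c" for a b c
    using that by (auto simp: pm_def)
  have it: "(T ^^ n) p \<in> D" for n using odd_map_funpow [OF T p] by simp
  \<comment> \<open>A step of \<open>T\<close> costs at least one step of \<open>S\<close>. The
    bound m \<ge> k records this, so that a repetition in the \<open>T\<close>-orbit becomes a
    repetition of the \<open>S\<close>-orbit at two different times.\<close>
  have iter: "\<exists>m\<ge>k. pm ((S ^^ m) (\<phi> ((T ^^ i) p))) (\<phi> ((T ^^ (k + i)) p))" for k i
  proof (induction k)
    case 0 then show ?case by (intro exI [of _ 0]) (simp add: pm_def)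
  next
    case (Suc k)
    then obtain m where m: "m \<ge> k" "pm ((S ^^ m) (\<phi> ((T ^^ i) p))) (\<phi> ((T ^^ (k + i)) p))" by blast
    obtain l where l: "l > 0" "pm ((S ^^ l) (\<phi> ((T ^^ (k + i)) p))) (\<phi> (T ((T ^^ (k + i)) p)))"
      using step [OF it [of "k + i"]] by blast
    have "pm ((S ^^ l) ((S ^^ m) (\<phi> ((T ^^ i) p)))) (\<phi> (T ((T ^^ (k + i)) p)))"
      using pm_trans [OF S_pm [OF m(2)] l(2)] \<phi>(1) it by blast
    with l(1) m(1) show ?case
      by (intro exI [of _ "l + m"]) (auto simp: funpow_add)
  qed
  have in_orb: "\<phi> ((T ^^ n) p) \<in> orb S (\<phi> p)" for n
    using iter [of n 0] orb_funpow [where T = S and p = "\<phi> p"] unfolding pm_def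
    by (metis add.right_neutral funpow_0 minus_minus)
  show "\<phi> ` orb T p \<subseteq> orb S (\<phi> p)"
  proof (rule image_subsetI)
    fix q assume "q \<in> orb T p"
    then obtain n where "q = (T ^^ n) p \<or> q = - (T ^^ n) p" unfolding orb_def by blast
    then show "\<phi> q \<in> orb S (\<phi> p)"
      using in_orb [of n] orb_uminus [OF in_orb [of n]] \<phi>(2) [OF it [of n]] by metis
  qed
  assume "finite (orb T p)"
  then obtain i j where ij: "i < j" "(T ^^ j) p = (T ^^ i) p" by (rule orb_finite_repeat)
  obtain m where m: "pm ((S ^^ m) (\<phi> p)) (\<phi> ((T ^^ i) p))" using iter [of i 0] by auto
  obtain l where l: "l \<ge> j - i" "pm ((S ^^ l) (\<phi> ((T ^^ i) p))) (\<phi> ((T ^^ i) p))"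
    using iter [where k = "j - i" and i = i] ij(2) by (metis ij(1) le_add_diff_inverse2 less_imp_le)
  have "pm ((S ^^ (l + m)) (\<phi> p)) (\<phi> ((T ^^ i) p))"
    using pm_trans [OF S_pm [OF m] l(2)] \<phi>(1) it [of i] by (metis comp_apply funpow_add image_subset_iff)
  then have "pm ((S ^^ (l + m)) (\<phi> p)) ((S ^^ m) (\<phi> p))"
    using m unfolding pm_def by (metis minus_minus)
  moreover have "\<phi> p \<in> Y" using \<phi>(1) p by blast
  ultimately show "finite (orb S (\<phi> p))"
    using orb_finite_card(1) [OF S, of "\<phi> p" m "l + m"] l(1) ij(1) unfolding pm_def by linarith
qed

lemma long_orbit_induced:
  assumes "odd_map T D" "odd_map S Y" "\<phi> ` D \<subseteq> Y" "\<And>p. p \<in> D \<Longrightarrow> \<phi> (- p) = - \<phi> p"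
    and "induced_by T D S \<phi>" "inj_on \<phi> D" "long_orbit T D N"
  shows "long_orbit S Y N"
proof -
  obtain p where p: "p \<in> D" "finite (orb T p)" "N \<le> card (orb T p)"
    using assms(7) by (auto simp: long_orbit_def)
  note o = induced_orbit [OF assms(1-5) p(1)]
  have "card (orb T p) = card (\<phi> ` orb T p)"
    using inj_on_subset [OF assms(6) orb_subset_domain [OF assms(1) p(1)]] by (simp add: card_image)
  also have "\<dots> \<le> card (orb S (\<phi> p))"
    using o p(2) by (intro card_mono) auto
  finally show ?thesis
    using p o(2) assms(3) unfolding long_orbit_def by (meson image_subset_iff order.trans)
qed

lemma long_orbit_induced_strict:
  assumes "odd_map T D" "odd_map S Y" "\<phi> ` D \<subseteq> Y" "\<And>p. p \<in> D \<Longrightarrow> \<phi> (- p) = - \<phi> p"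
    and "induced_by T D S \<phi>" "inj_on \<phi> D"
    and p: "p \<in> D" "finite (orb T p)" "N \<le> card (orb T p)"
    and q: "q \<in> orb T p" "(S ^^ n) (\<phi> q) \<notin> \<phi> ` D"
  shows "long_orbit S Y (Suc N)"
proof -
  note o = induced_orbit [OF assms(1-5) p(1)]
  have "\<phi> p \<in> Y" using p assms(3) by auto
  have "(S ^^ n) (\<phi> q) \<in> orb S (\<phi> p)"
    using orb_trans [OF assms(2) \<open>\<phi> p \<in> Y\<close>, of "\<phi> q"] q(1) o(1) orb_funpow(1) by blast
  then have "insert ((S ^^ n) (\<phi> q)) (\<phi> ` orb T p) \<subseteq> orb S (\<phi> p)"
    using o(1) by auto
  then have "card (insert ((S ^^ n) (\<phi> q)) (\<phi> ` orb T p)) \<le> card (orb S (\<phi> p))"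
    using o(2) p(2) by (intro card_mono) auto
  moreover have "(S ^^ n) (\<phi> q) \<notin> \<phi> ` orb T p"
    using q(2) orb_subset_domain [OF assms(1) p(1)] by auto
  moreover have "card (\<phi> ` orb T p) = card (orb T p)"
    using inj_on_subset [OF assms(6) orb_subset_domain [OF assms(1) p(1)]] by (simp add: card_image)
  ultimately show ?thesis
    unfolding long_orbit_def using p o(2) \<open>\<phi> p \<in> Y\<close> by (intro bexI [of _ "\<phi> p"]) auto
qed

lemma long_orbit_conj:
  assumes T: "odd_map T X" "odd_map S Y" and L: "long_orbit T X N"
    and \<phi>: "\<And>p. p \<in> X \<Longrightarrow> \<phi> p \<in> Y \<and> \<phi> (- p) = - \<phi> p \<and> S (\<phi> p) = \<phi> (T p) \<and> \<rho> (\<phi> p) = p"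
  shows "long_orbit S Y N"
proof (rule long_orbit_induced [OF T _ _ _ _ L])
  show "induced_by T X S \<phi>"
    unfolding induced_by_def using \<phi> by (intro ballI exI [of _ 1]) auto
  show "inj_on \<phi> X" using \<phi> by (metis inj_onI)
qed (use \<phi> in auto)

subsection \<open>Centred remainders and generic points\<close>

definition centred_mod :: "real \<Rightarrow> real \<Rightarrow> real" where
  "centred_mod m x = x - m * of_int (round (x / m))"

lemma centred_mod_ex: "\<exists>k. centred_mod m x = x - m * of_int k"
  by (auto simp: centred_mod_def)

lemma centred_mod_abs_le:
  assumes "m > 0" shows "\<bar>centred_mod m x\<bar> \<le> m / 2"
proof -
  have "\<bar>x / m - of_int (round (x / m))\<bar> \<le> 1 / 2"
    using of_int_round_abs_le [of "x / m"] by (simp add: abs_minus_commute)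
  then have "m * \<bar>x / m - of_int (round (x / m))\<bar> \<le> m * (1 / 2)"
    using assms by (intro mult_left_mono) auto
  moreover have "m * \<bar>x / m - of_int (round (x / m))\<bar> = \<bar>centred_mod m x\<bar>"
    using assms by (simp add: centred_mod_def abs_mult_pos' right_diff_distrib)
  ultimately show ?thesis by simp
qed

lemma centred_mod_eqI:
  assumes "\<bar>y\<bar> < m / 2" "x = y + m * of_int k"
  shows "centred_mod m x = y"
proof -
  have m: "m > 0" using assms(1) by linarith
  have "x / m = y / m + of_int k" "\<bar>y / m\<bar> < 1 / 2"
    using assms m by (simp_all add: field_simps)
  then have "round (x / m) = k"
    by (intro round_unique) linarith+
  then show ?thesis using assms(2) by (simp add: centred_mod_def)
qed

text \<open>
  All discontinuities below lie on integral linear equations between \<open>1, s, x, y\<close>, and the maps are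
  integral affine, so generic points never meet them.
\<close>

definition generic :: "real \<Rightarrow> real \<Rightarrow> real \<Rightarrow> bool" where
  "generic s x y \<longleftrightarrow> (\<forall>a b e f :: int.
     of_int a + of_int b * s + of_int e * x + of_int f * y = 0 \<longrightarrow> a = 0 \<and> b = 0 \<and> e = 0 \<and> f = 0)"

lemma genericD:
  assumes "generic s x y" "e \<noteq> 0 \<or> f \<noteq> 0"
  shows "of_int a + of_int b * s + of_int e * x + of_int f * y \<noteq> 0"
  using assms by (auto simp: generic_def)

lemma generic_affine:
  assumes "generic s x y" "x' = x + of_int a + of_int b * s + of_int c * y"
  shows "generic s x' y"
  unfolding generic_def
proof (intro allI impI)
  fix i j k l :: int
  assume "of_int i + of_int j * s + of_int k * x' + of_int l * y = 0"
  then have "of_int (i + k * a) + of_int (j + k * b) * s + of_int k * x + of_int (l + k * c) * y = 0"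
    by (simp add: assms(2) algebra_simps)
  then have "i + k * a = 0 \<and> j + k * b = 0 \<and> k = 0 \<and> l + k * c = 0"
    using assms(1) unfolding generic_def by blast
  then show "i = 0 \<and> j = 0 \<and> k = 0 \<and> l = 0" by auto
qed

lemma generic_swap: "generic s x y \<longleftrightarrow> generic s y x"
proof -
  have "generic s y x" if "generic s x y" for x y
    unfolding generic_def
  proof (intro allI impI)
    fix a b e f :: int
    assume "of_int a + of_int b * s + of_int e * y + of_int f * x = 0"
    then have "of_int a + of_int b * s + of_int f * x + of_int e * y = 0" by simp
    then show "a = 0 \<and> b = 0 \<and> e = 0 \<and> f = 0"
      using that unfolding generic_def by blast
  qed
  then show ?thesis by blast
qed

lemma generic_affine':
  assumes "generic s x y" "y' = y + of_int a + of_int b * s + of_int c * x"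
  shows "generic s x y'"
  using generic_affine [of s y x y' a b c] assms generic_swap by blast

lemma generic_uminus_left:
  assumes "generic s x y" shows "generic s (- x) y"
  unfolding generic_def
proof (intro allI impI)
  fix a b e f :: int
  assume "of_int a + of_int b * s + of_int e * (- x) + of_int f * y = 0"
  then have "of_int a + of_int b * s + of_int (- e) * x + of_int f * y = 0" by simp
  then have "a = 0 \<and> b = 0 \<and> - e = 0 \<and> f = 0"
    using assms unfolding generic_def by blast
  then show "a = 0 \<and> b = 0 \<and> e = 0 \<and> f = 0" by simp
qed

lemma generic_uminus: "generic s (- x) (- y) \<longleftrightarrow> generic s x y"
  using generic_uminus_left [of s x y] generic_uminus_left [of s y "- x"]
    generic_uminus_left [of s "- x" "- y"] generic_uminus_left [of s "- y" x] generic_swap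
  by (metis minus_minus)

text \<open>This is the coordinate change of the duality. Factoring s out of a relation between 1,
  s, 2sZ, sX leaves an integral relation between 1, 1/(2s), X, Z.\<close>

lemma generic_unscale:
  assumes "generic (1 / (2 * s)) X Z" "s \<noteq> 0"
  shows "generic s (2 * s * Z) (s * X)"
  unfolding generic_def
proof (intro allI impI)
  fix a b e f :: int
  assume "of_int a + of_int b * s + of_int e * (2 * s * Z) + of_int f * (s * X) = 0"
  then have "s * (of_int b + of_int (2 * a) * (1 / (2 * s)) + of_int f * X + of_int (2 * e) * Z) = 0"
    using assms(2) by (simp add: field_simps)
  then have "of_int b + of_int (2 * a) * (1 / (2 * s)) + of_int f * X + of_int (2 * e) * Z = 0"
    using assms(2) by simp
  then have "b = 0 \<and> 2 * a = 0 \<and> f = 0 \<and> 2 * e = 0"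
    using assms(1) unfolding generic_def by blast
  then show "a = 0 \<and> b = 0 \<and> e = 0 \<and> f = 0" by simp
qed

text \<open>Doubling a relation clears the halves. The lemma serves \<open>half_turn\<close> and
  \<open>shear\<close>, which move y by half a period.\<close>

lemma generic_half_shift:
  assumes "generic s x y" "y' = y + of_int a / 2 + of_int b * s / 2"
  shows "generic s x y'"
  unfolding generic_def
proof (intro allI impI)
  fix i j k l :: int
  assume "of_int i + of_int j * s + of_int k * x + of_int l * y' = 0"
  then have "of_int (2 * i + l * a) + of_int (2 * j + l * b) * s + of_int (2 * k) * x + of_int (2 * l) * y = 0"
    by (simp add: assms(2) algebra_simps)
  then have "2 * i + l * a = 0 \<and> 2 * j + l * b = 0 \<and> 2 * k = 0 \<and> 2 * l = 0"
    using assms(1) unfolding generic_def by blast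
  then show "i = 0 \<and> j = 0 \<and> k = 0 \<and> l = 0" by auto
qed

lemma generic_parameter:
  assumes "generic s x y" "s' = of_int a + s \<or> s' = of_int a - s"
  shows "generic s' x y"
  using assms(2)
proof
  assume s': "s' = of_int a + s"
  show ?thesis unfolding generic_def
  proof (intro allI impI)
    fix i j k l :: int
    assume "of_int i + of_int j * s' + of_int k * x + of_int l * y = 0"
    then have "of_int (i + j * a) + of_int j * s + of_int k * x + of_int l * y = 0"
      by (simp add: s' algebra_simps)
    then have "i + j * a = 0 \<and> j = 0 \<and> k = 0 \<and> l = 0"
      using assms(1) unfolding generic_def by blast
    then show "i = 0 \<and> j = 0 \<and> k = 0 \<and> l = 0" by auto
  qed
next
  assume s': "s' = of_int a - s"
  show ?thesis unfolding generic_def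
  proof (intro allI impI)
    fix i j k l :: int
    assume "of_int i + of_int j * s' + of_int k * x + of_int l * y = 0"
    then have "of_int (i + j * a) + of_int (- j) * s + of_int k * x + of_int l * y = 0"
      by (simp add: s' algebra_simps)
    then have "i + j * a = 0 \<and> - j = 0 \<and> k = 0 \<and> l = 0"
      using assms(1) unfolding generic_def by blast
    then show "i = 0 \<and> j = 0 \<and> k = 0 \<and> l = 0" by auto
  qed
qed

lemma generic_ex:
  assumes s: "s \<notin> \<rat>" and "a < b" "c < d"
  obtains x y where "a < x" "x < b" "c < y" "y < d" "generic s x y"
proof -
  define Q where "Q = (\<lambda>(i, j, k :: int). - (of_int i + of_int j * s) / of_int k) ` UNIV"
  have "countable Q" unfolding Q_def by (intro countable_image) simp
  then have "uncountable ({a<..<b} - Q)"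
    using \<open>a < b\<close> by (intro uncountable_minus_countable) (simp_all add: uncountable_open_interval)
  then obtain x where x: "a < x" "x < b" "x \<notin> Q"
    by (metis DiffE all_not_in_conv countable_empty greaterThanLessThan_iff)
  define R where "R = (\<lambda>(i, j, k, l :: int). - (of_int i + of_int j * s + of_int k * x) / of_int l) ` UNIV"
  have "countable R" unfolding R_def by (intro countable_image) simp
  then have "uncountable ({c<..<d} - R)"
    using \<open>c < d\<close> by (intro uncountable_minus_countable) (simp_all add: uncountable_open_interval)
  then obtain y where y: "c < y" "y < d" "y \<notin> R"
    by (metis DiffE all_not_in_conv countable_empty greaterThanLessThan_iff)
  have "generic s x y"
    unfolding generic_def
  proof (intro allI impI)
    fix i j k l :: int
    assume eq: "of_int i + of_int j * s + of_int k * x + of_int l * y = 0"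
    have l: "l = 0"
    proof (rule ccontr)
      assume "l \<noteq> 0"
      moreover have "y * of_int l = - (of_int i + of_int j * s + of_int k * x)"
        using eq by (simp add: algebra_simps)
      ultimately have "y = - (of_int i + of_int j * s + of_int k * x) / of_int l"
        by (simp add: nonzero_eq_divide_eq)
      then have "y \<in> R" unfolding R_def by (intro image_eqI [of _ _ "(i, j, k, l)"]) simp_all
      then show False using y(3) by contradiction
    qed
    have k: "k = 0"
    proof (rule ccontr)
      assume "k \<noteq> 0"
      moreover have "x * of_int k = - (of_int i + of_int j * s)"
        using eq l by (simp add: algebra_simps)
      ultimately have "x = - (of_int i + of_int j * s) / of_int k"
        by (simp add: nonzero_eq_divide_eq)
      then have "x \<in> Q" unfolding Q_def by (intro image_eqI [of _ _ "(i, j, k)"]) simp_all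
      then show False using x(3) by contradiction
    qed
    have j: "j = 0"
    proof (rule ccontr)
      assume "j \<noteq> 0"
      moreover have "s * of_int j = - of_int i"
        using eq l k by (simp add: algebra_simps)
      ultimately have "s = - of_int i / of_int j"
        by (metis nonzero_eq_divide_eq of_int_eq_0_iff)
      then show False using s by (metis Rats_divide Rats_minus_iff Rats_of_int)
    qed
    show "i = 0 \<and> j = 0 \<and> k = 0 \<and> l = 0" using eq l k j by simp
  qed
  then show ?thesis using that x y by blast
qed

text \<open>At an endpoint twice the remainder would be an integer, and doubling would give a
  relation that genericity forbids.\<close>

lemma centred_mod_1_abs_less:
  assumes "generic s x y" "e \<noteq> 0 \<or> f \<noteq> 0" "v = of_int a + of_int b * s + of_int e * x + of_int f * y"
  shows "\<bar>centred_mod 1 v\<bar> < 1 / 2"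
proof -
  obtain k where k: "v = centred_mod 1 v + of_int k" using centred_mod_ex [of 1 v] by force
  have *: "centred_mod 1 v \<noteq> of_int i / 2" for i
  proof
    assume "centred_mod 1 v = of_int i / 2"
    then have "of_int (2 * a - 2 * k - i) + of_int (2 * b) * s + of_int (2 * e) * x + of_int (2 * f) * y = 0"
      using k assms(3) by simp
    moreover have "2 * e \<noteq> 0 \<or> 2 * f \<noteq> 0" using assms(2) by simp
    ultimately show False using genericD [OF assms(1)] by blast
  qed
  have "centred_mod 1 v \<noteq> 1 / 2" "centred_mod 1 v \<noteq> - 1 / 2" using * [of 1] * [of "-1"] by auto
  then show ?thesis using centred_mod_abs_le [of 1 v] by linarith
qed

lemma centred_mod_abs_less:
  assumes "generic s x y" "s > 0" "e \<noteq> 0 \<or> f \<noteq> 0" "v = of_int a + of_int b * s + of_int e * x + of_int f * y"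
  shows "\<bar>centred_mod s v\<bar> < s / 2"
proof -
  obtain k where k: "v = centred_mod s v + s * of_int k" using centred_mod_ex [of s v] by force
  have *: "centred_mod s v \<noteq> of_int i * s / 2" for i
  proof
    assume "centred_mod s v = of_int i * s / 2"
    then have "of_int (2 * a) + of_int (2 * b - 2 * k - i) * s + of_int (2 * e) * x + of_int (2 * f) * y = 0"
      using k assms(4) by (simp add: algebra_simps)
    moreover have "2 * e \<noteq> 0 \<or> 2 * f \<noteq> 0" using assms(3) by simp
    ultimately show False using genericD [OF assms(1)] by blast
  qed
  have "centred_mod s v \<noteq> s / 2" "centred_mod s v \<noteq> - s / 2" using * [of 1] * [of "-1"] by auto
  then show ?thesis using centred_mod_abs_le [OF assms(2), of v] by linarith
qed

subsection \<open>The piecewise isometries\<close>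

definition generic_cell :: "real \<Rightarrow> (real \<times> real) set" where
  "generic_cell s = {(x, y). \<bar>x\<bar> < 1/2 \<and> \<bar>y\<bar> < s/2 \<and> generic s x y}"

definition pet :: "real \<Rightarrow> real \<times> real \<Rightarrow> real \<times> real" where
  "pet s = (\<lambda>(x, y). let x' = centred_mod 1 (x - 2 * y) in (x', centred_mod s (y + x')))"

definition pet_inv :: "real \<Rightarrow> real \<times> real \<Rightarrow> real \<times> real" where
  "pet_inv s = (\<lambda>(x, y). let y' = centred_mod s (y - x) in (centred_mod 1 (x + 2 * y'), y'))"

text \<open>The conjugate of \<open>pet s\<close> by the translation \<open>y \<mapsto> y + s/2\<close> of the torus; the seam is at \<open>y = 0\<close>.\<close>

definition pet_shift :: "real \<Rightarrow> real \<times> real \<Rightarrow> real \<times> real" where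
  "pet_shift s = (\<lambda>(x, y). let x' = centred_mod 1 (x - 2 * y + s * sgn y) in (x', centred_mod s (y + x')))"

lemma generic_cell_iff: "(x, y) \<in> generic_cell s \<longleftrightarrow> \<bar>x\<bar> < 1/2 \<and> \<bar>y\<bar> < s/2 \<and> generic s x y"
  by (simp add: generic_cell_def)

lemma generic_cell_uminus: "p \<in> generic_cell s \<Longrightarrow> - p \<in> generic_cell s"
  by (cases p) (simp add: generic_cell_iff generic_uminus)

lemma pet_eqI:
  assumes "x' = x - 2 * y - of_int k" "y' = y + x' - s * of_int n" "\<bar>x'\<bar> < 1/2" "\<bar>y'\<bar> < s/2"
  shows "pet s (x, y) = (x', y')"
proof -
  have "centred_mod 1 (x - 2 * y) = x'" using assms by (intro centred_mod_eqI [where k = k]) auto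
  moreover have "centred_mod s (y + x') = y'" using assms by (intro centred_mod_eqI [where k = n]) auto
  ultimately show ?thesis by (simp add: pet_def)
qed

lemma pet_inv_eqI:
  assumes "y' = y - x - s * of_int n" "x' = x + 2 * y' - of_int k" "\<bar>x'\<bar> < 1/2" "\<bar>y'\<bar> < s/2"
  shows "pet_inv s (x, y) = (x', y')"
proof -
  have "centred_mod s (y - x) = y'" using assms by (intro centred_mod_eqI [where k = n]) auto
  moreover have "centred_mod 1 (x + 2 * y') = x'" using assms by (intro centred_mod_eqI [where k = k]) auto
  ultimately show ?thesis by (simp add: pet_inv_def)
qed

lemma pet_shift_eqI:
  assumes "x' = x - 2 * y + s * sgn y - of_int k" "y' = y + x' - s * of_int n" "\<bar>x'\<bar> < 1/2" "\<bar>y'\<bar> < s/2"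
  shows "pet_shift s (x, y) = (x', y')"
proof -
  have "centred_mod 1 (x - 2 * y + s * sgn y) = x'" using assms by (intro centred_mod_eqI [where k = k]) auto
  moreover have "centred_mod s (y + x') = y'" using assms by (intro centred_mod_eqI [where k = n]) auto
  ultimately show ?thesis by (simp add: pet_shift_def)
qed

text \<open>The integer b is the multiple of s in the first update: 0 for \<open>pet\<close>, the
  sign of y for \<open>pet_shift\<close>.\<close>

lemma generic_cell_step:
  assumes p: "(x, y) \<in> generic_cell s" and s: "s > 0" and b: "b = 0 \<or> b = 1 \<or> b = (-1 :: int)"
  obtains x' y' k n where "x' = x - 2 * y + s * of_int b - of_int k" "y' = y + x' - s * of_int n"
    "\<bar>x'\<bar> < 1/2" "\<bar>y'\<bar> < s/2" "generic s x' y'"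
proof -
  have g: "generic s x y" using p by (simp add: generic_cell_iff)
  define v where "v = x - 2 * y + s * of_int b"
  obtain k where k: "centred_mod 1 v = v - of_int k" using centred_mod_ex [of 1 v] by auto
  define x' where "x' = v - of_int k"
  have x': "\<bar>x'\<bar> < 1/2"
    using centred_mod_1_abs_less [OF g, of 1 "-2" v 0 b] unfolding x'_def k [symmetric] by (simp add: v_def)
  have g1: "generic s x' y"
    using generic_affine [OF g, of x' "- k" b "-2"] by (simp add: v_def x'_def algebra_simps)
  obtain n where n: "centred_mod s (y + x') = y + x' - s * of_int n" using centred_mod_ex [of s "y + x'"] by auto
  define y' where "y' = y + x' - s * of_int n"
  have y': "\<bar>y'\<bar> < s/2"
    using centred_mod_abs_less [OF g1 s, of 1 1 "y + x'" 0 0] unfolding y'_def n [symmetric] by simp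
  have "generic s x' y'"
    using generic_affine' [OF g1, of y' 0 "- n" 1] by (simp add: y'_def algebra_simps)
  with x' y' show ?thesis
    by (intro that [of x' k y' n]) (auto simp: x'_def v_def y'_def)
qed

lemma pet_cases:
  assumes "(x, y) \<in> generic_cell s" "s > 0"
  obtains x' y' k n where "pet s (x, y) = (x', y')" "x' = x - 2 * y - of_int k" "y' = y + x' - s * of_int n"
    "(x', y') \<in> generic_cell s"
proof -
  have b0: "0 = 0 \<or> 0 = 1 \<or> 0 = (-1 :: int)" by simp
  obtain x' y' k n where *: "x' = x - 2 * y + s * of_int 0 - of_int k" "y' = y + x' - s * of_int n"
    "\<bar>x'\<bar> < 1/2" "\<bar>y'\<bar> < s/2" "generic s x' y'"
    by (rule generic_cell_step [OF assms b0])
  from *(1) have x': "x' = x - 2 * y - of_int k" by simp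
  show ?thesis
    by (rule that [OF pet_eqI [OF x' *(2-4)] x' *(2)]) (use *(3-5) in \<open>simp only: generic_cell_iff simp_thms\<close>)
qed

lemma generic_nonzero: "generic s x y \<Longrightarrow> x \<noteq> 0 \<and> y \<noteq> 0"
  using genericD [of s x y 1 0 0 0] genericD [of s x y 0 1 0 0] by auto

lemma pet_shift_cases:
  assumes "(x, y) \<in> generic_cell s" "s > 0"
  obtains x' y' k n where "pet_shift s (x, y) = (x', y')" "x' = x - 2 * y + s * sgn y - of_int k"
    "y' = y + x' - s * of_int n" "(x', y') \<in> generic_cell s"
proof -
  have "y \<noteq> 0" using assms generic_nonzero by (auto simp: generic_cell_iff)
  define b :: int where "b = (if y > 0 then 1 else -1)"
  have b: "of_int b = sgn y" "b = 0 \<or> b = 1 \<or> b = -1" using \<open>y \<noteq> 0\<close> by (auto simp: b_def)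
  obtain x' y' k n where *: "x' = x - 2 * y + s * of_int b - of_int k" "y' = y + x' - s * of_int n"
    "\<bar>x'\<bar> < 1/2" "\<bar>y'\<bar> < s/2" "generic s x' y'"
    by (rule generic_cell_step [OF assms b(2)])
  from *(1) have x': "x' = x - 2 * y + s * sgn y - of_int k" unfolding b(1) .
  show ?thesis
    by (rule that [OF pet_shift_eqI [OF x' *(2-4)] x' *(2)]) (use *(3-5) in \<open>simp only: generic_cell_iff simp_thms\<close>)
qed

lemma pet_inv_cases:
  assumes "(x, y) \<in> generic_cell s" "s > 0"
  obtains x' y' k n where "pet_inv s (x, y) = (x', y')" "y' = y - x - s * of_int n" "x' = x + 2 * y' - of_int k"
    "(x', y') \<in> generic_cell s"
proof -
  have g: "generic s x y" using assms by (simp add: generic_cell_iff)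
  obtain n where n: "centred_mod s (y - x) = y - x - s * of_int n" using centred_mod_ex [of s "y - x"] by auto
  define y' where "y' = y - x - s * of_int n"
  have y': "\<bar>y'\<bar> < s/2"
    using centred_mod_abs_less [OF g assms(2), of "-1" 1 "y - x" 0 0] unfolding y'_def n [symmetric] by simp
  have g1: "generic s x y'"
    using generic_affine' [OF g, of y' 0 "- n" "-1"] by (simp add: y'_def algebra_simps)
  obtain k where k: "centred_mod 1 (x + 2 * y') = x + 2 * y' - of_int k" using centred_mod_ex [of 1 "x + 2 * y'"] by auto
  define x' where "x' = x + 2 * y' - of_int k"
  have x': "\<bar>x'\<bar> < 1/2"
    using centred_mod_1_abs_less [OF g1, of 1 2 "x + 2 * y'" 0 0] unfolding x'_def k [symmetric] by simp
  have "generic s x' y'"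
    using generic_affine [OF g1, of x' "- k" 0 2] by (simp add: x'_def algebra_simps)
  with x' y' show ?thesis
    by (intro that [of x' y' n k] pet_inv_eqI [of y' y x s n x' k]) (auto simp: x'_def y'_def generic_cell_iff)
qed

lemma odd_map_pet:
  assumes "s > 0" shows "odd_map (pet s) (generic_cell s)"
  unfolding odd_map_def
proof safe
  fix x y assume p: "(x, y) \<in> generic_cell s"
  show "- (x, y) \<in> generic_cell s" by (rule generic_cell_uminus) fact
  obtain x' y' k n where *: "pet s (x, y) = (x', y')" "x' = x - 2 * y - of_int k" "y' = y + x' - s * of_int n"
    "(x', y') \<in> generic_cell s"
    using pet_cases [OF p assms] by metis
  then show "pet s (x, y) \<in> generic_cell s" by simp
  have "\<bar>x'\<bar> < 1/2" "\<bar>y'\<bar> < s/2" "s * of_int (- n) = - (s * of_int n)"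
    "s * sgn (- y) = - (s * sgn y)"
    using *(4) by (simp_all only: generic_cell_iff) (simp_all add: sgn_minus)
  then have "pet s (- x, - y) = (- x', - y')"
    using *(2,3) by (intro pet_eqI [where k = "- k" and n = "- n"]) linarith+
  with * show "pet s (- (x, y)) = - pet s (x, y)" by simp
qed

lemma odd_map_pet_inv:
  assumes "s > 0" shows "odd_map (pet_inv s) (generic_cell s)"
  unfolding odd_map_def
proof safe
  fix x y assume p: "(x, y) \<in> generic_cell s"
  show "- (x, y) \<in> generic_cell s" by (rule generic_cell_uminus) fact
  obtain x' y' k n where *: "pet_inv s (x, y) = (x', y')" "y' = y - x - s * of_int n" "x' = x + 2 * y' - of_int k"
    "(x', y') \<in> generic_cell s"
    using pet_inv_cases [OF p assms] by metis
  then show "pet_inv s (x, y) \<in> generic_cell s" by simp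
  have "\<bar>x'\<bar> < 1/2" "\<bar>y'\<bar> < s/2" "s * of_int (- n) = - (s * of_int n)"
    "s * sgn (- y) = - (s * sgn y)"
    using *(4) by (simp_all only: generic_cell_iff) (simp_all add: sgn_minus)
  then have "pet_inv s (- x, - y) = (- x', - y')"
    using *(2,3) by (intro pet_inv_eqI [where k = "- k" and n = "- n"]) linarith+
  with * show "pet_inv s (- (x, y)) = - pet_inv s (x, y)" by simp
qed

lemma odd_map_pet_shift:
  assumes "s > 0" shows "odd_map (pet_shift s) (generic_cell s)"
  unfolding odd_map_def
proof safe
  fix x y assume p: "(x, y) \<in> generic_cell s"
  show "- (x, y) \<in> generic_cell s" by (rule generic_cell_uminus) fact
  obtain x' y' k n where *: "pet_shift s (x, y) = (x', y')" "x' = x - 2 * y + s * sgn y - of_int k"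
    "y' = y + x' - s * of_int n" "(x', y') \<in> generic_cell s"
    using pet_shift_cases [OF p assms] by metis
  then show "pet_shift s (x, y) \<in> generic_cell s" by simp
  have "\<bar>x'\<bar> < 1/2" "\<bar>y'\<bar> < s/2" "s * of_int (- n) = - (s * of_int n)"
    "s * sgn (- y) = - (s * sgn y)"
    using *(4) by (simp_all only: generic_cell_iff) (simp_all add: sgn_minus)
  then have "pet_shift s (- x, - y) = (- x', - y')"
    using *(2,3) by (intro pet_shift_eqI [where k = "- k" and n = "- n"]) linarith+
  with * show "pet_shift s (- (x, y)) = - pet_shift s (x, y)" by simp
qed

lemma pet_inv_pet:
  assumes "p \<in> generic_cell s" "s > 0" shows "pet_inv s (pet s p) = p"
proof (cases p)
  case (Pair x y)
  obtain x' y' k n where *: "pet s (x, y) = (x', y')" "x' = x - 2 * y - of_int k" "y' = y + x' - s * of_int n"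
    "(x', y') \<in> generic_cell s"
    using pet_cases assms Pair by metis
  then show ?thesis
    using assms Pair * by (auto simp: generic_cell_iff intro!: pet_inv_eqI [where n = "- n" and k = "- k"])
qed

lemma pet_pet_inv:
  assumes "p \<in> generic_cell s" "s > 0" shows "pet s (pet_inv s p) = p"
proof (cases p)
  case (Pair x y)
  obtain x' y' k n where *: "pet_inv s (x, y) = (x', y')" "y' = y - x - s * of_int n" "x' = x + 2 * y' - of_int k"
    "(x', y') \<in> generic_cell s"
    using pet_inv_cases assms Pair by metis
  then show ?thesis
    using assms Pair * by (auto simp: generic_cell_iff intro!: pet_eqI [where n = "- n" and k = "- k"])
qed

section \<open>Conjugacies: time reversal, duality, half turn\<close>

text \<open>\<open>pet s\<close> is a product of two involutions, hence conjugate to its inverse \<open>pet_inv s\<close>.\<close>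

lemma long_orbit_pet_inv_if_pet:
  assumes s: "s > 0" and L: "long_orbit (pet s) (generic_cell s) N"
  shows "long_orbit (pet_inv s) (generic_cell s) N"
proof (rule long_orbit_conj [OF odd_map_pet [OF s] odd_map_pet_inv [OF s] L])
  fix p :: "real \<times> real" assume p: "p \<in> generic_cell s"
  obtain x y where Pair: "p = (x, y)" by fastforce
  obtain x' y' k n where 1: "pet s (x, y) = (x', y')" "x' = x - 2 * y - of_int k" "y' = y + x' - s * of_int n"
    "(x', y') \<in> generic_cell s"
    using pet_cases p s Pair by metis
  obtain x'' y'' k' n' where 2: "pet s (x', y') = (x'', y'')" "x'' = x' - 2 * y' - of_int k'"
    "y'' = y' + x'' - s * of_int n'" "(x'', y'') \<in> generic_cell s"
    using pet_cases [OF 1(4) s] by metis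
  have g: "generic s x y" using p Pair by (simp add: generic_cell_iff)
  have b: "\<bar>x\<bar> < 1/2" "\<bar>x''\<bar> < 1/2" "\<bar>y'\<bar> < s/2"
    using p Pair 1(4) 2(4) by (simp_all only: generic_cell_iff)
  have "generic s x' y" using generic_affine [OF g, of x' "- k" 0 "-2"] 1(2) by simp
  then have "(- x', y) \<in> generic_cell s" using 1(4) p generic_uminus_left unfolding generic_cell_iff Pair by simp
  moreover have "pet s (- p) = - pet s p" using odd_mapD(3) [OF odd_map_pet [OF s] p] .
  moreover have "pet_inv s (- x', y) = (- x'', y')"
    using 1(2,3) 2(2) b by (intro pet_inv_eqI [where n = n and k = "- k'"]) linarith+
  moreover have "centred_mod 1 (2 * y + x') = x"
    using 1(2) b by (intro centred_mod_eqI [where k = "- k"]) linarith+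
  \<comment> \<open>The conjugacy is the reflection (x, y) \<mapsto> (2y - x, y) modulo 1, whose
    first coordinate is the negative of that of \<open>pet s p\<close>. It is its own inverse,
    whence the last line.\<close>
  ultimately show "(- fst (pet s p), snd p) \<in> generic_cell s \<and> (- fst (pet s (- p)), snd (- p)) = - (- fst (pet s p), snd p) \<and>
      pet_inv s (- fst (pet s p), snd p) = (- fst (pet s (pet s p)), snd (pet s p)) \<and>
      (\<lambda>(x, y). (centred_mod 1 (2 * y - x), y)) (- fst (pet s p), snd p) = p"
    using 1(1) 2(1) Pair by simp
qed

text \<open>Duality: exchanging the coordinates and rescaling swaps the two torus periods \<open>1\<close> and \<open>s\<close>.\<close>

lemma long_orbit_dual:
  assumes s: "s > 0" and L: "long_orbit (pet_inv (1 / (2 * s))) (generic_cell (1 / (2 * s))) N"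
  shows "long_orbit (pet s) (generic_cell s) N"
proof (rule long_orbit_conj [OF odd_map_pet_inv odd_map_pet [OF s] L])
  fix p :: "real \<times> real" assume p: "p \<in> generic_cell (1 / (2 * s))"
  have t: "1 / (2 * s) > 0" using s by simp
  obtain x y where Pair: "p = (x, y)" by fastforce
  obtain x' y' k n where 1: "pet_inv (1 / (2 * s)) (x, y) = (x', y')" "y' = y - x - 1 / (2 * s) * of_int n"
    "x' = x + 2 * y' - of_int k" "(x', y') \<in> generic_cell (1 / (2 * s))"
    using pet_inv_cases p t Pair by metis
  have sc: "\<bar>2 * s * v\<bar> < 1/2 \<longleftrightarrow> \<bar>v\<bar> < 1 / (2 * s) / 2" "\<bar>s * v\<bar> < s/2 \<longleftrightarrow> \<bar>v\<bar> < 1/2" for v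
    using s by (auto simp: abs_mult field_simps)
  have generic_cell: "(2 * s * v, s * u) \<in> generic_cell s" if "(u, v) \<in> generic_cell (1 / (2 * s))" for u v
    using that s generic_unscale [of s u v] unfolding generic_cell_iff sc by simp
  \<comment> \<open>\<open>pet_inv\<close> updates y before x, \<open>pet\<close> updates x before
    y; the exchange of the coordinates therefore turns one into the other.\<close>
  have "pet s (2 * s * y, s * x) = (2 * s * y', s * x')"
  proof (rule pet_eqI)
    show "2 * s * y' = 2 * s * y - 2 * (s * x) - of_int n" using 1(2) s by (simp add: field_simps)
    show "s * x' = s * x + 2 * s * y' - s * of_int k" unfolding 1(3) by (simp add: algebra_simps)
  qed (use 1(4) in \<open>simp_all only: generic_cell_iff sc\<close>)
  then show "(\<lambda>(x, y). (2 * s * y, s * x)) p \<in> generic_cell s \<and>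
      (\<lambda>(x, y). (2 * s * y, s * x)) (- p) = - (\<lambda>(x, y). (2 * s * y, s * x)) p \<and>
      pet s ((\<lambda>(x, y). (2 * s * y, s * x)) p) = (\<lambda>(x, y). (2 * s * y, s * x)) (pet_inv (1 / (2 * s)) p) \<and>
      (\<lambda>(x, y). (y / s, x / (2 * s))) ((\<lambda>(x, y). (2 * s * y, s * x)) p) = p"
    using generic_cell p Pair 1(1,4) s by simp
qed (use s in simp)

text \<open>Away from y = 0 this is the translation by s/2 on the circle of length s, in centred
  representatives. Half a period is its own inverse, so the map conjugates in both
  directions.\<close>

definition half_turn :: "real \<Rightarrow> real \<times> real \<Rightarrow> real \<times> real" where
  "half_turn s = (\<lambda>(x, y). (x, y - s / 2 * sgn y))"

lemma half_turn_generic_cell: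
  assumes "p \<in> generic_cell s"
  shows "half_turn s p \<in> generic_cell s \<and> half_turn s (- p) = - half_turn s p \<and> half_turn s (half_turn s p) = p"
proof -
  obtain x y where Pair: "p = (x, y)" by fastforce
  have g: "generic s x y" "\<bar>y\<bar> < s/2" "y \<noteq> 0"
    using assms generic_nonzero by (auto simp: Pair generic_cell_iff)
  have "generic s x (y - s / 2 * sgn y)"
    using generic_half_shift [OF g(1), of "y - s/2" 0 "-1"] generic_half_shift [OF g(1), of "y + s/2" 0 1] g(3)
    by (auto simp: sgn_if)
  with g assms show ?thesis
    by (auto simp: half_turn_def Pair generic_cell_iff sgn_if)
qed

text \<open>The half turn flips the sign of y, so the term s sgn y of \<open>pet_shift\<close>
  cancels the change of -2y.\<close>

lemma pet_shift_half_turn: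
  assumes p: "p \<in> generic_cell s" and s: "s > 0"
  shows "pet_shift s (half_turn s p) = half_turn s (pet s p)"
proof -
  obtain x y where Pair: "p = (x, y)" by fastforce
  obtain x' y' k n where 1: "pet s (x, y) = (x', y')" "x' = x - 2 * y - of_int k" "y' = y + x' - s * of_int n"
    "(x', y') \<in> generic_cell s"
    using pet_cases p s Pair by metis
  have y: "y \<noteq> 0" "\<bar>y\<bar> < s/2" "y' \<noteq> 0" "\<bar>y'\<bar> < s/2" "\<bar>x'\<bar> < 1/2"
    using p 1(4) generic_nonzero by (auto simp: Pair generic_cell_iff)
  have "pet_shift s (x, y - s / 2 * sgn y) = (x', y' - s / 2 * sgn y')"
  proof (rule pet_shift_eqI)
    show "x' = x - 2 * (y - s / 2 * sgn y) + s * sgn (y - s / 2 * sgn y) - of_int k"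
      using 1(2) y by (auto simp: sgn_if)
    \<comment> \<open>The correction of n is (sgn y' - sgn y)/2, the difference of the two half
      turns measured in periods.\<close>
    show "y' - s / 2 * sgn y' = y - s / 2 * sgn y + x' -
        s * of_int (n + (if y > 0 \<and> y' < 0 then -1 else if y < 0 \<and> y' > 0 then 1 else 0))"
      using 1(3) y by (auto simp: sgn_if algebra_simps)
  qed (use y in \<open>auto simp: sgn_if\<close>)
  then show ?thesis using 1 by (simp add: half_turn_def Pair)
qed

lemma long_orbit_pet_iff_pet_shift:
  assumes s: "s > 0"
  shows "long_orbit (pet s) (generic_cell s) N \<longleftrightarrow> long_orbit (pet_shift s) (generic_cell s) N"
proof
  assume "long_orbit (pet s) (generic_cell s) N"
  then show "long_orbit (pet_shift s) (generic_cell s) N"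
    by (rule long_orbit_conj [OF odd_map_pet [OF s] odd_map_pet_shift [OF s], where \<phi> = "half_turn s" and \<rho> = "half_turn s"])
       (use half_turn_generic_cell pet_shift_half_turn s in blast)
next
  have *: "pet s (half_turn s p) = half_turn s (pet_shift s p)" if "p \<in> generic_cell s" for p
    using pet_shift_half_turn [of "half_turn s p" s] half_turn_generic_cell [OF that] s
      half_turn_generic_cell [OF odd_mapD(2) [OF odd_map_pet [OF s]], of "half_turn s p"] by metis
  assume "long_orbit (pet_shift s) (generic_cell s) N"
  then show "long_orbit (pet s) (generic_cell s) N"
    by (rule long_orbit_conj [OF odd_map_pet_shift [OF s] odd_map_pet [OF s], where \<phi> = "half_turn s" and \<rho> = "half_turn s"])
       (use half_turn_generic_cell * s in blast)
qed

subsection \<open>Renormalization: parameters just above an integer\<close>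

text \<open>Since t = k + c and k vanishes modulo 1, the first update sees only c on the upper
  half.\<close>

lemma pet_shift_pos:
  assumes "t = of_int k + c" "y > 0" "\<bar>x - 2 * y + c\<bar> < 1/2" "\<bar>x - y + c\<bar> < t/2"
  shows "pet_shift t (x, y) = (x - 2 * y + c, x - y + c)"
  using assms by (intro pet_shift_eqI [where k = k and n = 0]) auto

text \<open>The upper branch is a rotation of order four about (0, c/2); its square is the point
  reflection (x, v) \<mapsto> (-x, c - v). The two bounds by c/2 keep both steps in that
  branch.\<close>

lemma pet_shift_twice_descend:
  assumes t: "t = of_int k + c" "1 \<le> k" "0 < c"
    and "\<bar>x\<bar> < 1/2" "c/2 < v" "v - x < c/2" "v < t/2"
  shows "(pet_shift t ^^ 2) (x, v) = - (x, v - c)"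
proof -
  have k: "of_int k \<ge> (1::real)" using t by linarith
  have 1: "pet_shift t (x, v) = (x - 2 * v + c, x - v + c)"
    by (rule pet_shift_pos [OF t(1)]) (use assms k in linarith)+
  define x1 y1 where "x1 = x - 2 * v + c" and "y1 = x - v + c"
  have e: "x1 - 2 * y1 + c = - x" "x1 - y1 + c = c - v" by (simp_all add: x1_def y1_def)
  have "y1 > 0" "\<bar>x1 - 2 * y1 + c\<bar> < 1/2" "\<bar>x1 - y1 + c\<bar> < t/2"
    unfolding e using assms k by (simp add: y1_def, simp, linarith)
  then have "pet_shift t (x1, y1) = (x1 - 2 * y1 + c, x1 - y1 + c)"
    by (rule pet_shift_pos [OF t(1)])
  then have 2: "pet_shift t (x - 2 * v + c, x - v + c) = (- x, c - v)" by (simp add: x1_def y1_def)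
  show ?thesis using 1 2 by (simp add: numeral_2_eq_2)
qed

lemma generic_cell_shift_parameter:
  assumes "(x, y) \<in> generic_cell c" "t = of_int k + c \<or> t = of_int k - c" "y' = y + of_int a * c / 2" "\<bar>y'\<bar> < t/2"
  shows "(x, y') \<in> generic_cell t"
proof -
  have "generic c x y'"
    using generic_half_shift [of c x y y' 0 a] assms by (simp add: generic_cell_iff)
  then have "generic t x y'" using generic_parameter assms(2) by blast
  with assms show ?thesis by (simp add: generic_cell_iff)
qed

text \<open>Each pair of steps lowers v by c up to sign, which preserves v - x < c/2. The bound v -
  n c > -c/2 says that v exceeds c/2 before each of the n pairs.\<close>

lemma pet_shift_descend_iterate:
  assumes t: "t = of_int k + c" "1 \<le> k" "0 < c"
    and p: "(x, v) \<in> generic_cell t" "v - x < c/2" "v - of_nat n * c > - c/2" "generic c x v"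
  shows "(pet_shift t ^^ (2 * n)) (x, v) = (x, v - of_nat n * c) \<or> (pet_shift t ^^ (2 * n)) (x, v) = - (x, v - of_nat n * c)"
  using p
proof (induction n arbitrary: v)
  case (Suc n)
  have k: "of_int k \<ge> (1::real)" using t by linarith
  have x: "\<bar>x\<bar> < 1/2" "v < t/2" "- t/2 < v" using Suc.prems(1) by (auto simp: generic_cell_iff)
  have v: "v > c/2 + of_nat n * c" using Suc.prems(3) by (simp add: algebra_simps)
  have "of_nat n * c \<ge> 0" using t by simp
  then have "c/2 < v" using v by linarith
  then have two: "(pet_shift t ^^ 2) (x, v) = - (x, v - c)"
    using pet_shift_twice_descend [OF t] x Suc.prems by blast
  have g: "generic c x (v - c)"
    using generic_affine' [OF Suc.prems(4), of "v - c" 0 "-1" 0] by simp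
  have "\<bar>v - c\<bar> < t/2" using t k x \<open>c/2 < v\<close> by linarith
  then have generic_cell: "(x, v - c) \<in> generic_cell t"
    using generic_parameter [OF g, of t k] t(1) x(1) by (simp add: generic_cell_iff)
  have IH: "(pet_shift t ^^ (2 * n)) (x, v - c) = (x, v - c - of_nat n * c) \<or>
     (pet_shift t ^^ (2 * n)) (x, v - c) = - (x, v - c - of_nat n * c)"
    using Suc.prems g generic_cell t by (intro Suc.IH) (auto simp: algebra_simps)
  have "t > 0" using t k by linarith
  have "(pet_shift t ^^ (2 * Suc n)) (x, v) = (pet_shift t ^^ (2 * n)) ((pet_shift t ^^ 2) (x, v))"
    by (simp add: numeral_2_eq_2 funpow_swap1)
  also have "\<dots> = - (pet_shift t ^^ (2 * n)) (x, v - c)"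
    unfolding two using odd_map_funpow [OF odd_map_pet_shift [OF \<open>t > 0\<close>] generic_cell] by simp
  finally show ?case using IH by (auto simp: algebra_simps)
qed simp

text \<open>The larger cell has room for the unreduced value y + x'. The reduction by n c, which
  parameter c makes at once, then takes n pairs of steps. The assumption \<open>up\<close> makes n
  nonnegative; the opposite case is left to oddness.\<close>

lemma pet_shift_first_return:
  assumes t: "t = of_int k + c" "1 \<le> k" "0 < c" and p: "(x, y) \<in> generic_cell c"
    and g: "pet_shift c (x, y) = (x', y')" and up: "y + x' > - c/2"
  shows "(x', y + x') \<in> generic_cell t \<and> pet_shift t (x, y) = (x', y + x') \<and>
    (\<exists>n>0. (pet_shift t ^^ n) (x, y) = (x', y') \<or> (pet_shift t ^^ n) (x, y) = - (x', y'))"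
proof -
  have k: "of_int k \<ge> (1::real)" using t by linarith
  obtain K n where K: "x' = x - 2 * y + c * sgn y - of_int K" "y' = y + x' - c * of_int n"
    "(x', y') \<in> generic_cell c"
    using pet_shift_cases [OF p t(3)] g by (metis prod.inject)
  have b: "\<bar>x'\<bar> < 1/2" "\<bar>y'\<bar> < c/2" "\<bar>y\<bar> < c/2" using K(3) p by (auto simp: generic_cell_iff)
  have y: "y \<noteq> 0" using p generic_nonzero by (auto simp: generic_cell_iff)
  have gen: "generic c x' (y + x')"
    using generic_affine' [of c x' y' "y + x'" 0 n 0] K by (simp add: generic_cell_iff)
  have "\<bar>y + x'\<bar> < t/2" using t k b by linarith
  then have generic_cell: "(x', y + x') \<in> generic_cell t"
    using generic_parameter [OF gen, of t k] t(1) b(1) by (simp add: generic_cell_iff)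
  have pet_shift: "pet_shift t (x, y) = (x', y + x')"
  proof (rule pet_shift_eqI)
    show "x' = x - 2 * y + t * sgn y - of_int (K + (if y > 0 then k else - k))"
      using K(1) t y by (auto simp: sgn_if)
    show "y + x' = y + x' - t * of_int 0" by simp
  qed (use generic_cell in \<open>auto simp: generic_cell_iff\<close>)
  have "c * of_int n > c * (-1)" using K(2) up b(2) by linarith
  then have "n \<ge> 0" using t(3) by (simp only: mult_less_cancel_left_pos)
  then have n: "of_nat (nat n) = (of_int n :: real)" by simp
  have "(pet_shift t ^^ (2 * nat n)) (x', y + x') = (x', y') \<or> (pet_shift t ^^ (2 * nat n)) (x', y + x') = - (x', y')"
  proof -
    have e: "y + x' - of_nat (nat n) * c = y'" using K(2) unfolding n by (simp add: mult.commute)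
    have "y + x' - x' < c/2" "y' > - c/2" using b by linarith+
    then show ?thesis using pet_shift_descend_iterate [OF t generic_cell, of "nat n"] gen unfolding e by simp
  qed
  then have "(pet_shift t ^^ Suc (2 * nat n)) (x, y) = (x', y') \<or> (pet_shift t ^^ Suc (2 * nat n)) (x, y) = - (x', y')"
    using pet_shift by (simp add: funpow_swap1)
  with generic_cell pet_shift show ?thesis by (metis zero_less_Suc)
qed

lemma generic_cell_subset:
  assumes "t = of_int k + c" "1 \<le> k" "0 < c" shows "generic_cell c \<subseteq> generic_cell t"
proof
  fix p assume p: "p \<in> generic_cell c"
  obtain x y where Pair: "p = (x, y)" by fastforce
  have "\<bar>y\<bar> < c/2" "c < t" using assms p by (simp_all add: Pair generic_cell_iff)
  then have "\<bar>y\<bar> < t/2" by linarith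
  then show "p \<in> generic_cell t"
    using generic_cell_shift_parameter [of x y c t k y 0] assms(1) p Pair by simp
qed

lemma pet_shift_induced:
  assumes t: "t = of_int k + c" "1 \<le> k" "0 < c"
  shows "induced_by (pet_shift c) (generic_cell c) (pet_shift t) id"
  unfolding induced_by_def
proof
  fix p assume p: "p \<in> generic_cell c"
  obtain x y where Pair: "p = (x, y)" by fastforce
  obtain x' y' where g: "pet_shift c (x, y) = (x', y')" by fastforce
  have "t > 0" using t by linarith
  note odd = odd_mapD [OF odd_map_pet_shift [OF t(3)] p] odd_map_funpow [OF odd_map_pet_shift [OF \<open>t > 0\<close>], of p]
  have pt: "p \<in> generic_cell t" using p generic_cell_subset [OF t] by blast
  show "\<exists>n>0. (pet_shift t ^^ n) (id p) = id (pet_shift c p) \<or> (pet_shift t ^^ n) (id p) = - id (pet_shift c p)"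
  proof (cases "y + x' > - c/2")
    case True
    then show ?thesis using pet_shift_first_return [OF t] p g Pair by auto
  next
    case False
    have "\<exists>n>0. (pet_shift t ^^ n) (- x, - y) = (- x', - y') \<or> (pet_shift t ^^ n) (- x, - y) = - (- x', - y')"
      using pet_shift_first_return [OF t, of "- x" "- y" "- x'" "- y'"] odd(1,3) g Pair False t by auto
    then obtain n where "n > 0" "(pet_shift t ^^ n) (- p) = - (x', y') \<or> (pet_shift t ^^ n) (- p) = (x', y')"
      using Pair by auto
    then show ?thesis using odd(4) pt g Pair by (intro exI [of _ n]) (metis id_apply minus_minus)
  qed
qed

text \<open>
  An orbit of \<open>pet_shift c\<close> on which the second coordinate never wraps around cannot exist:
  it would have \<open>\<bar>x\<bar> < c\<close> throughout, which fails after a few steps.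
\<close>

lemma no_wrap_contradiction_aux:
  fixes c x h x' h' x'' h'' :: real and k :: int
  assumes "0 < c" "c < 1/2" "\<bar>x\<bar> < c" "0 < h" "h < c/2" "x' = x - 2 * h + c - 1" "\<bar>x'\<bar> < c" "h' = h + x'"
    "x'' = x' - 2 * h' - c - of_int k" "\<bar>x''\<bar> < c" "h'' = h' + x''" "\<bar>h''\<bar> < c/2"
  shows False
proof -
  have "real_of_int k < 1" "- 1 < real_of_int k" using assms by linarith+
  then have "k = 0" by linarith
  with assms show False by simp
qed

text \<open>As a difference of successive y, each later x is below c in absolute value, which leaves
  two values for \<open>k 0\<close>. If \<open>k 0\<close> = 0 and y stays positive, two steps send
  y to c - y > c/2; if \<open>k 0\<close> = 1, they send it to -(y + c). The remaining branch
  violates |x| < c or, after one step and a change of sign, becomes the case of a jump by 1.\<close>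

lemma no_wrap_contradiction_pos:
  fixes c x h :: real and k :: "nat \<Rightarrow> int" and X Y :: "nat \<Rightarrow> real"
  assumes c: "0 < c" "c < 1/2"
    and X: "\<And>i. X (Suc i) = X i - 2 * Y i + c * sgn (Y i) - of_int (k i)"
    and Y: "\<And>i. Y (Suc i) = Y i + X (Suc i)" "\<And>i. \<bar>Y i\<bar> < c/2" "\<And>i. Y i \<noteq> 0" "\<bar>X 0\<bar> < c" and pos: "Y 0 > 0"
  shows False
proof -
  have x: "\<bar>X i\<bar> < c" for i
  proof (cases i)
    case (Suc j)
    then show ?thesis using Y(1) [of j] Y(2) [of j] Y(2) [of "Suc j"] unfolding Suc by linarith
  qed (use Y(4) in simp)
  have eq: "X 1 = X 0 - 2 * Y 0 + c - of_int (k 0)" "X 2 = X 1 - 2 * Y 1 + c * sgn (Y 1) - of_int (k 1)"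
    "X 3 = X 2 - 2 * Y 2 + c * sgn (Y 2) - of_int (k 2)" "Y 1 = Y 0 + X 1" "Y 2 = Y 1 + X 2" "Y 3 = Y 2 + X 3"
    using X [of 0] X [of 1] X [of 2] Y(1) [of 0] Y(1) [of 1] Y(1) [of 2] pos
    by (simp_all add: numeral_2_eq_2 numeral_3_eq_3)
  have xy: "X i < c" "- c < X i" "Y i < c/2" "- (c/2) < Y i" for i
    using x [of i] Y(2) [of i] by linarith+
  note bd = xy [of 0] xy [of 1] xy [of 2] xy [of 3]
  have "real_of_int (k 0) > -1" "real_of_int (k 0) < 2" using eq(1) bd pos c by linarith+
  then consider "k 0 = 0" | "k 0 = 1" by linarith
  then show False
  proof cases
    case 2
    then have e1: "X 1 = X 0 - 2 * Y 0 + c - 1" using eq(1) by simp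
    then have "Y 1 < 0" using eq(4) bd pos c by linarith
    then have e2: "X 2 = X 1 - 2 * Y 1 - c - of_int (k 1)" using eq(2) by simp
    show False
      by (rule no_wrap_contradiction_aux [OF c _ pos _ e1 _ eq(4) e2 _ eq(5)]) (use bd in linarith)+
  next
    case 1
    then have e1: "X 1 = X 0 - 2 * Y 0 + c" using eq(1) by simp
    consider "Y 1 > 0" | "Y 1 < 0" using Y(3) [of 1] by linarith
    then show False
    proof cases
      case 1
      then have e2: "X 2 = - X 0 - of_int (k 1)" using eq(2,4) e1 by simp
      then have "\<bar>real_of_int (k 1)\<bar> < 1" using bd c by linarith
      then have "k 1 = 0" by linarith
      then have "real_of_int (k 1) = 0" by simp
      then show False using e1 e2 eq(4,5) bd pos by linarith
    next
      case 2
      then have e2: "X 2 = X 1 - 2 * Y 1 - c - of_int (k 1)" using eq(2) by simp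
      then have "real_of_int (k 1) > -2" "real_of_int (k 1) < 1" using e1 eq(4) bd c pos 2 by linarith+
      then consider "k 1 = 0" | "k 1 = -1" by linarith
      then show False
      proof cases
        case 1 then show False using e1 e2 eq(4) bd 2 by simp
      next
        case _: 2
        then have e2': "X 2 = X 1 - 2 * Y 1 - c + 1" using e2 by simp
        then have "Y 2 > 0" using eq(5) bd c 2 by linarith
        then have e3: "X 3 = X 2 - 2 * Y 2 + c - of_int (k 2)" using eq(3) by simp
        have neg: "- X 2 = - X 1 - 2 * (- Y 1) + c - 1" "- Y 2 = - Y 1 + - X 2"
          "- X 3 = - X 2 - 2 * (- Y 2) - c - of_int (- k 2)" "- Y 3 = - Y 2 + - X 3"
          using e2' e3 eq(5,6) by simp_all
        show False
          by (rule no_wrap_contradiction_aux [OF c _ _ _ neg(1) _ neg(2) neg(3) _ neg(4)])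
             (use bd 2 in linarith)+
      qed
    qed
  qed
qed

lemma pet_shift_wraps:
  assumes c: "0 < c" "c < 1/2" and p: "p \<in> generic_cell c"
  shows "\<exists>q\<in>orb (pet_shift c) p. c/2 \<le> \<bar>snd q + fst (pet_shift c q)\<bar>"
proof (rule ccontr)
  assume "\<not> ?thesis"
  then have no: "\<bar>snd q + fst (pet_shift c q)\<bar> < c/2" if "q \<in> orb (pet_shift c) p" for q
    using that by force
  note odd = odd_map_pet_shift [OF c(1)]
  have step: "snd (pet_shift c q) = snd q + fst (pet_shift c q) \<and>
      (\<exists>k :: int. fst (pet_shift c q) = fst q - 2 * snd q + c * sgn (snd q) - of_int k) \<and> \<bar>snd q\<bar> < c/2 \<and> snd q \<noteq> 0"
    if q: "q \<in> orb (pet_shift c) p" for q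
  proof -
    obtain x y where Pair: "q = (x, y)" by fastforce
    have qgp: "(x, y) \<in> generic_cell c" using orb_subset_domain [OF odd p] q Pair by auto
    obtain x' y' k n where *: "pet_shift c (x, y) = (x', y')" "x' = x - 2 * y + c * sgn y - of_int k"
      "y' = y + x' - c * of_int n" "(x', y') \<in> generic_cell c"
      by (rule pet_shift_cases [OF qgp c(1)])
    have "\<bar>y + x'\<bar> < c/2" "\<bar>y'\<bar> < c/2" using no [OF q] * Pair by (simp_all add: generic_cell_iff)
    then have "\<bar>c * of_int n\<bar> < c * 1" using *(3) by linarith
    then have "\<bar>real_of_int n\<bar> < 1" using c by (simp add: abs_mult)
    then have "n = 0" by linarith
    with * Pair qgp generic_nonzero show ?thesis by (auto simp: generic_cell_iff)
  qed
  \<comment> \<open>The argument starts at the image of p: its first coordinate is a difference of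
    two second coordinates and hence below c, while that of p is only bounded by 1/2.\<close>
  have p1: "pet_shift c p \<in> orb (pet_shift c) p" using orb_funpow(1) [of 1] by simp
  define q where "q = (if snd (pet_shift c p) > 0 then pet_shift c p else - pet_shift c p)"
  have q: "q \<in> orb (pet_shift c) p" using p1 orb_uminus by (auto simp: q_def)
  have it: "(pet_shift c ^^ i) q \<in> orb (pet_shift c) p" for i
    using orb_trans [OF odd p q] orb_funpow(1) by blast
  obtain k where k: "\<And>i. fst (pet_shift c ((pet_shift c ^^ i) q)) =
      fst ((pet_shift c ^^ i) q) - 2 * snd ((pet_shift c ^^ i) q) + c * sgn (snd ((pet_shift c ^^ i) q)) - of_int (k i)"
    using step [OF it] by metis
  have "\<bar>fst (pet_shift c p)\<bar> < c" using step [OF orb_self] step [OF p1] by linarith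
  then have 0: "\<bar>fst q\<bar> < c" "snd q > 0"
    using step [OF p1] by (auto simp: q_def)
  show False
    by (rule no_wrap_contradiction_pos
          [OF c, of "\<lambda>i. fst ((pet_shift c ^^ i) q)" "\<lambda>i. snd ((pet_shift c ^^ i) q)" k])
       (use k step [OF it] 0 in auto)
qed

text \<open>Where the orbit for c wraps, the orbit for t passes through the unreduced value y + x',
  of size at least c/2. That point lies outside the smaller cell and is the one gained.\<close>

theorem long_orbit_above_integer:
  assumes c: "0 < c" "c < 1/2" and t: "t = of_int k + c" "1 \<le> k"
    and L: "long_orbit (pet_shift c) (generic_cell c) N"
  shows "long_orbit (pet_shift t) (generic_cell t) (Suc N)"
proof -
  have "t > 0" using c t by linarith
  obtain p where p: "p \<in> generic_cell c" "finite (orb (pet_shift c) p)" "N \<le> card (orb (pet_shift c) p)"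
    using L by (auto simp: long_orbit_def)
  note odd = odd_map_pet_shift [OF c(1)]
  obtain q where q: "q \<in> orb (pet_shift c) p" "c/2 \<le> \<bar>snd q + fst (pet_shift c q)\<bar>"
    using pet_shift_wraps [OF c p(1)] by blast
  have "q \<in> generic_cell c" using orb_subset_domain [OF odd p(1)] q(1) by blast
  then have "pet_shift c (- q) = - pet_shift c q" using odd_mapD(3) [OF odd] by blast
  then obtain r where r: "r \<in> orb (pet_shift c) p" "c/2 \<le> snd r + fst (pet_shift c r)"
  proof (cases "0 \<le> snd q + fst (pet_shift c q)")
    case True
    then show ?thesis using that [of q] q by simp
  next
    case False
    then show ?thesis using that [of "- q"] q orb_uminus [OF q(1)] \<open>pet_shift c (- q) = - pet_shift c q\<close> by simp
  qed
  obtain x y where Pair: "r = (x, y)" by fastforce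
  have "(x, y) \<in> generic_cell c" using orb_subset_domain [OF odd p(1)] r(1) Pair by blast
  then have "pet_shift t r = (fst (pet_shift c r), snd r + fst (pet_shift c r))"
    using pet_shift_first_return [OF t c(1), of x y "fst (pet_shift c r)" "snd (pet_shift c r)"] r c Pair by simp
  moreover have "\<not> \<bar>snd r + fst (pet_shift c r)\<bar> < c/2" using r(2) by linarith
  ultimately have notin: "(pet_shift t ^^ 1) (id r) \<notin> id ` generic_cell c" by (auto simp: generic_cell_iff)
  show ?thesis
    by (rule long_orbit_induced_strict [OF odd odd_map_pet_shift [OF \<open>t > 0\<close>] _ _ pet_shift_induced [OF t c(1)] _ p r(1) notin])
       (use generic_cell_subset [OF t c(1)] in auto)
qed

subsection \<open>Renormalization: parameters just below an integer\<close>

text \<open>For t = k - d it is the lower half on which -t reduces to d modulo 1. The centre (0,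
  d/2) of this formula (with m = 0) lies outside the half plane where it is valid, so iteration
  drives points away from it.\<close>

lemma pet_shift_low:
  assumes "t = of_int k - d" "y < 0" "x' = x - 2 * y + d - of_int m" "y' = y + x'" "\<bar>x'\<bar> < 1/2" "\<bar>y'\<bar> < t/2"
  shows "pet_shift t (x, y) = (x', y')"
  using assms by (intro pet_shift_eqI [where k = "m - k" and n = 0]) auto

text \<open>On the omitted strip around the diagonal, \<open>pet_inv d\<close> does not wrap and its
  square is -1. What remains consists of two halves, exchanged by p \<mapsto> -p.\<close>

definition off_diag :: "real \<Rightarrow> (real \<times> real) set" where
  "off_diag d = {(x, y). (x, y) \<in> generic_cell d \<and> d/2 < \<bar>y - x\<bar>}"

text \<open>The half above the strip is lowered by d/2, hence into y < 0, the branch in which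
  \<open>pet_shift t\<close> translates by d; the other half is treated symmetrically.\<close>

definition shear :: "real \<Rightarrow> real \<times> real \<Rightarrow> real \<times> real" where
  "shear d = (\<lambda>(x, y). (x, y - d/2 * sgn (y - x)))"

lemma off_diag_iff: "(x, y) \<in> off_diag d \<longleftrightarrow> (x, y) \<in> generic_cell d \<and> d/2 < \<bar>y - x\<bar>"
  by (simp add: off_diag_def)

lemma off_diag_uminus: "p \<in> off_diag d \<Longrightarrow> - p \<in> off_diag d"
  using generic_cell_uminus [of p d] by (cases p) (simp add: off_diag_iff abs_minus_commute)

lemma shear_uminus: "shear d (- p) = - shear d p"
  using sgn_minus [of "snd p - fst p"] by (cases p) (simp add: shear_def algebra_simps)

lemma shear_generic_cell:
  assumes d: "0 < d" "d < 1/2" and t: "t = of_int k - d" "2 \<le> k" and p: "p \<in> off_diag d"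
  shows "shear d p \<in> generic_cell t \<and> \<bar>snd (shear d p)\<bar> < d"
proof -
  obtain x y where Pair: "p = (x, y)" by fastforce
  have y: "\<bar>y\<bar> < d/2" and generic_cell: "(x, y) \<in> generic_cell d" and yx: "y - x \<noteq> 0"
    using p d by (auto simp: Pair off_diag_iff generic_cell_iff)
  have "real_of_int k \<ge> 2" using t by linarith
  then have dt: "d < t/2" using t d by linarith
  have e: "shear d p = (x, snd (shear d p))" by (simp add: shear_def Pair)
  have "sgn (y - x) = 1 \<or> sgn (y - x) = -1" using yx by (simp add: sgn_if)
  then consider "sgn (y - x) = 1" | "sgn (y - x) = -1" by blast
  then show ?thesis
  proof cases
    case 1
    then have *: "snd (shear d p) = y + of_int (-1) * d / 2" by (simp add: shear_def Pair)
    then have "\<bar>snd (shear d p)\<bar> < d" using y by linarith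
    moreover from this have "\<bar>snd (shear d p)\<bar> < t/2" using dt by linarith
    ultimately show ?thesis using generic_cell_shift_parameter [OF generic_cell _ *, of t k] t(1) e by metis
  next
    case 2
    then have *: "snd (shear d p) = y + of_int 1 * d / 2" by (simp add: shear_def Pair)
    then have "\<bar>snd (shear d p)\<bar> < d" using y by linarith
    moreover from this have "\<bar>snd (shear d p)\<bar> < t/2" using dt by linarith
    ultimately show ?thesis using generic_cell_shift_parameter [OF generic_cell _ *, of t k] t(1) e by metis
  qed
qed

text \<open>Two points moved in opposite directions to the same place would differ by d in y, more
  than the cell allows.\<close>

lemma shear_inj:
  assumes d: "0 < d" "d < 1/2" shows "inj_on (shear d) (off_diag d)"
proof (rule inj_onI)
  fix p q assume p: "p \<in> off_diag d" and q: "q \<in> off_diag d" and eq: "shear d p = shear d q"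
  obtain x y where P: "p = (x, y)" by fastforce
  obtain x' y' where Q: "q = (x', y')" by fastforce
  have b: "\<bar>y\<bar> < d/2" "\<bar>y'\<bar> < d/2" "y - x \<noteq> 0" "y' - x' \<noteq> 0"
    using p q d by (auto simp: P Q off_diag_iff generic_cell_iff)
  have e: "x = x'" "y - d/2 * sgn (y - x) = y' - d/2 * sgn (y' - x')"
    using eq by (auto simp: P Q shear_def)
  then have "y = y'" using b by (auto simp: sgn_if split: if_splits)
  then show "p = q" using e P Q by simp
qed

text \<open>Here n is the quotient of y - x by d, which \<open>pet_shift t\<close> will work off in
  pairs of steps, and K tells whether x wraps. The image misses the strip in either case: it lies
  above it for K = 0 and below it for K = -1.\<close>

lemma pet_inv_upper:
  assumes d: "0 < d" "d < 1/2" and p: "(x, y) \<in> generic_cell d" "y - x > d/2"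
  obtains x0 y0 n K where "pet_inv d (x, y) = (x0, y0)" "(x0, y0) \<in> generic_cell d" "1 \<le> n" "y0 = y - x - of_nat n * d"
    "x0 = x + 2 * y0 - of_int K" "K = 0 \<and> d/2 < y0 - x0 \<or> K = -1 \<and> d/2 < x0 - y0 \<and> y0 < 0"
proof -
  obtain x0 y0 m K where *: "pet_inv d (x, y) = (x0, y0)" "y0 = y - x - d * of_int m" "x0 = x + 2 * y0 - of_int K"
    "(x0, y0) \<in> generic_cell d"
    by (rule pet_inv_cases [OF p(1) d(1)])
  have b: "\<bar>x\<bar> < 1/2" "\<bar>y\<bar> < d/2" "\<bar>x0\<bar> < 1/2" "\<bar>y0\<bar> < d/2" using p *(4) by (auto simp: generic_cell_iff)
  have "d * 0 < d * of_int m" using *(2) p(2) b by linarith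
  then have m: "0 < m" using d by (simp only: mult_less_cancel_left_pos of_int_0_less_iff)
  define n where "n = nat m"
  have n: "1 \<le> n" "of_int m = (of_nat n :: real)" using m by (auto simp: n_def)
  have "real n \<ge> 1" using n by simp
  then have nd: "d * of_nat n \<ge> d * 1" using d by (intro mult_left_mono) auto
  have "real_of_int K < 1" "real_of_int K > -2" using *(2,3) b nd d unfolding n(2) by linarith+
  then consider "K = 0" | "K = -1" by linarith
  then have "K = 0 \<and> d/2 < y0 - x0 \<or> K = -1 \<and> d/2 < x0 - y0 \<and> y0 < 0"
  proof cases
    case 1
    then have "y0 - x0 = d * of_nat n - y" using *(2,3) n(2) by simp
    then show ?thesis using nd b 1 by simp
  next
    case 2
    then show ?thesis using *(2,3) b d by simp
  qed
  with * n show ?thesis by (intro that [of x0 y0 n K]) (auto simp: mult.commute)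
qed

text \<open>Two steps of the lower branch reflect in (0, d/2), that is, lower y by d up to sign. The
  second of them needs x - v + d < 0, which holds for the first n - 1 pairs only; the last reduction
  by d is part of the final return.\<close>

lemma pet_shift_low_iterate:
  assumes d: "0 < d" "d < 1/2" and t: "t = of_int k - d" "2 \<le> k" and p: "(x, y) \<in> generic_cell d"
    and y0: "y0 = y - x - of_nat n * d" "\<bar>y0\<bar> < d/2" "i < n"
  shows "(x, y - d/2 - of_nat i * d) \<in> generic_cell t \<and>
    ((pet_shift t ^^ (2 * i)) (x, y - d/2) = (x, y - d/2 - of_nat i * d) \<or>
     (pet_shift t ^^ (2 * i)) (x, y - d/2) = - (x, y - d/2 - of_nat i * d))"
  using y0(3)
proof (induction i)
  have k: "real_of_int k \<ge> 2" using t by linarith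
  have "\<bar>x\<bar> < 1/2" "\<bar>y\<bar> < d/2" using p by (auto simp: generic_cell_iff)
  then have b: "x < 1/2" "- 1/2 < x" "y < d/2" "- (d/2) < y" "y0 < d/2" "- (d/2) < y0" using y0(2) by linarith+
  {
    case 0
    have "\<bar>y - d/2\<bar> < t/2" using t k b d by linarith
    then have "(x, y - d/2) \<in> generic_cell t"
      using generic_cell_shift_parameter [OF p, of t k "y - d/2" "-1"] t by simp
    then show ?case by simp
  next
    case (Suc i)
    define D where "D = of_nat i * d"
    define v where "v = y - d/2 - D"
    have IH: "(x, v) \<in> generic_cell t" "(pet_shift t ^^ (2 * i)) (x, y - d/2) = (x, v) \<or> (pet_shift t ^^ (2 * i)) (x, y - d/2) = - (x, v)"
      using Suc by (auto simp: v_def D_def)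
    have "of_nat (i + 2) * d \<le> of_nat n * d" using Suc.prems d by (intro mult_right_mono) auto
    then have "D + 2 * d \<le> y - x - y0" using y0(1) by (simp add: D_def algebra_simps)
    moreover have "D \<ge> 0" using d by (simp add: D_def)
    ultimately have D: "D + 2 * d \<le> y - x - y0" "D \<ge> 0" by blast+
    have tk: "t \<ge> 2 - d" using t k by linarith
    define x1 y1 where "x1 = x - 2 * v + d" and "y1 = v + x1"
    have c: "v < 0" "\<bar>x1\<bar> < 1/2" "y1 < 0" "\<bar>y1\<bar> < t/2" "\<bar>- x\<bar> < 1/2" "\<bar>d - v\<bar> < t/2"
      using D b d tk y1_def x1_def v_def by linarith+
    have "pet_shift t (x, v) = (x1, y1)"
      by (rule pet_shift_low [OF t(1) c(1) _ y1_def c(2,4), where m = 0]) (simp add: x1_def)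
    moreover have "pet_shift t (x1, y1) = (- x, d - v)"
      by (rule pet_shift_low [OF t(1) c(3) _ _ c(5,6), where m = 0]) (simp_all add: y1_def x1_def)
    ultimately have two: "(pet_shift t ^^ 2) (x, v) = - (x, v - d)" by (simp add: numeral_2_eq_2)
    have "t > 0" using t k d by linarith
    note odd = odd_map_pet_shift [OF this]
    have "- (x, v - d) \<in> generic_cell t" using odd_map_funpow [OF odd IH(1), of 2] two by metis
    then have generic_cell: "(x, v - d) \<in> generic_cell t" using generic_cell_uminus by fastforce
    have "(pet_shift t ^^ (2 * Suc i)) (x, y - d/2) = (pet_shift t ^^ 2) ((pet_shift t ^^ (2 * i)) (x, y - d/2))"
      by (simp add: numeral_2_eq_2)
    then have "(pet_shift t ^^ (2 * Suc i)) (x, y - d/2) = (x, v - d) \<or> (pet_shift t ^^ (2 * Suc i)) (x, y - d/2) = - (x, v - d)"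
      using IH(2) two odd_map_funpow [OF odd IH(1), of 2] by auto
    moreover have "v - d = y - d/2 - of_nat (Suc i) * d" by (simp add: v_def D_def algebra_simps)
    ultimately show ?case using generic_cell by metis
  }
qed

text \<open>After n - 1 pairs the return is completed by one step if K = 0 and by three if K = -1.
  Sheared points satisfy |y| < d, and this bound is broken on the way if n > 1 (after one pair, at y
  - 3d/2) or if K = -1 (after the first of the three steps). Only n = 1, K = 0 is left, and this is
  the affine map in the last conclusion.\<close>

lemma pet_shift_low_return:
  assumes d: "0 < d" "d < 1/2" and t: "t = of_int k - d" "2 \<le> k" and p: "(x, y) \<in> generic_cell d" "y - x > d/2"
  shows "pet_inv d (x, y) \<in> off_diag d \<and>
    (\<exists>m>0. (pet_shift t ^^ m) (shear d (x, y)) = shear d (pet_inv d (x, y)) \<or>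
           (pet_shift t ^^ m) (shear d (x, y)) = - shear d (pet_inv d (x, y))) \<and>
    (pet_inv d (x, y) \<noteq> (2 * y - x - 2 * d, y - x - d) \<longrightarrow> (\<exists>m. d \<le> \<bar>snd ((pet_shift t ^^ m) (shear d (x, y)))\<bar>))"
proof -
  obtain x0 y0 n K where *: "pet_inv d (x, y) = (x0, y0)" "(x0, y0) \<in> generic_cell d" "1 \<le> n" "y0 = y - x - of_nat n * d"
    "x0 = x + 2 * y0 - of_int K" and K: "K = 0 \<and> d/2 < y0 - x0 \<or> K = -1 \<and> d/2 < x0 - y0 \<and> y0 < 0"
    using pet_inv_upper [OF d p] by metis
  have b: "\<bar>x\<bar> < 1/2" "\<bar>y\<bar> < d/2" "\<bar>x0\<bar> < 1/2" "\<bar>y0\<bar> < d/2" using p *(2) by (auto simp: generic_cell_iff)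
  have tk: "t \<ge> 2 - d" using t by linarith
  then have "t > 0" using d by linarith
  note odd = odd_map_pet_shift [OF this]
  have sh: "shear d (x, y) = (x, y - d/2)" using p(2) d by (simp add: shear_def)
  have "d/2 < \<bar>y0 - x0\<bar>" using K by (elim disjE conjE; linarith)
  then have off: "pet_inv d (x, y) \<in> off_diag d" using *(1,2) by (simp add: off_diag_iff)
  define v where "v = x + y0 + d/2"
  have v: "y - d/2 - of_nat (n - 1) * d = v"
    using *(3,4) by (simp add: v_def of_nat_diff algebra_simps)
  have it: "(x, v) \<in> generic_cell t" "(pet_shift t ^^ (2 * (n - 1))) (x, y - d/2) = (x, v) \<or> (pet_shift t ^^ (2 * (n - 1))) (x, y - d/2) = - (x, v)"
    using pet_shift_low_iterate [OF d t p(1) *(4) b(4), of "n - 1"] *(3) unfolding v by auto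
  have "of_nat n * d \<ge> 1 * d" using *(3) d by (intro mult_right_mono) auto
  then have nd: "y - x - y0 \<ge> d" using *(4) by linarith
  have v0: "v < 0" using nd b by (simp add: v_def)
  have iter: "(pet_shift t ^^ (m + 2 * (n - 1))) (shear d (x, y)) = (pet_shift t ^^ m) (x, v) \<or>
      (pet_shift t ^^ (m + 2 * (n - 1))) (shear d (x, y)) = - (pet_shift t ^^ m) (x, v)" for m
    using it odd_map_funpow [OF odd it(1), of m] unfolding sh funpow_add by auto
  have ret: "\<exists>m>0. (pet_shift t ^^ m) (x, v) = shear d (x0, y0) \<or> (pet_shift t ^^ m) (x, v) = - shear d (x0, y0)"
    and big: "K = -1 \<Longrightarrow> \<exists>m. d \<le> \<bar>snd ((pet_shift t ^^ m) (x, v))\<bar>"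
  proof -
    consider "K = 0" "d/2 < y0 - x0" | "K = -1" "d/2 < x0 - y0" "y0 < 0" using K by blast
    then have "(\<exists>m>0. (pet_shift t ^^ m) (x, v) = shear d (x0, y0) \<or> (pet_shift t ^^ m) (x, v) = - shear d (x0, y0)) \<and>
       (K = -1 \<longrightarrow> (\<exists>m. d \<le> \<bar>snd ((pet_shift t ^^ m) (x, v))\<bar>))"
    proof cases
      case 1
      have c: "\<bar>- x0\<bar> < 1/2" "\<bar>d/2 - y0\<bar> < t/2" using b tk d by linarith+
      have "pet_shift t (x, v) = (- x0, d/2 - y0)"
        by (rule pet_shift_low [OF t(1) v0 _ _ c, where m = 0]) (use 1 *(5) in \<open>simp_all add: v_def\<close>)
      moreover have "shear d (x0, y0) = (x0, y0 - d/2)" using 1 d by (simp add: shear_def)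
      ultimately show ?thesis using 1 by (intro conjI exI [of _ 1]) auto
    next
      case 2
      then have x0: "x0 = x + 2 * y0 + 1" using *(5) by simp
      define y1 y2 where "y1 = d/2 - y0 - 1" and "y2 = d/2 - y0 - 1 - x"
      have c: "\<bar>- x0\<bar> < 1/2" "\<bar>- x\<bar> < 1/2" "y1 < 0" "\<bar>y1\<bar> < t/2" "y2 < 0" "\<bar>y2\<bar> < t/2" "\<bar>y0 + d/2\<bar> < t/2"
        using b tk d 2 x0 unfolding y1_def y2_def by linarith+
      have s1: "pet_shift t (x, v) = (- x0, y1)"
        by (rule pet_shift_low [OF t(1) v0 _ _ c(1,4), where m = 1]) (use x0 in \<open>simp_all add: v_def y1_def\<close>)
      have s2: "pet_shift t (- x0, y1) = (- x, y2)"
        by (rule pet_shift_low [OF t(1) c(3) _ _ c(2,6), where m = 1]) (use x0 in \<open>simp_all add: y1_def y2_def\<close>)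
      have s3: "pet_shift t (- x, y2) = (x0, y0 + d/2)"
        by (rule pet_shift_low [OF t(1) c(5) _ _ b(3) c(7), where m = 1]) (use x0 in \<open>simp_all add: y2_def\<close>)
      have "shear d (x0, y0) = (x0, y0 + d/2)" using 2 d by (simp add: shear_def)
      then have "(pet_shift t ^^ 3) (x, v) = shear d (x0, y0)" using s1 s2 s3 by (simp add: numeral_3_eq_3)
      moreover have "d \<le> \<bar>snd ((pet_shift t ^^ 1) (x, v))\<bar>" using s1 b 2 d by (simp add: y1_def)
      ultimately show ?thesis by (metis zero_less_numeral)
    qed
    then show "\<exists>m>0. (pet_shift t ^^ m) (x, v) = shear d (x0, y0) \<or> (pet_shift t ^^ m) (x, v) = - shear d (x0, y0)"
      and "K = -1 \<Longrightarrow> \<exists>m. d \<le> \<bar>snd ((pet_shift t ^^ m) (x, v))\<bar>" by blast+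
  qed
  obtain m where m: "m > 0" "(pet_shift t ^^ m) (x, v) = shear d (x0, y0) \<or> (pet_shift t ^^ m) (x, v) = - shear d (x0, y0)"
    using ret by blast
  have "(pet_shift t ^^ (m + 2 * (n - 1))) (shear d (x, y)) = shear d (pet_inv d (x, y)) \<or>
     (pet_shift t ^^ (m + 2 * (n - 1))) (shear d (x, y)) = - shear d (pet_inv d (x, y))"
    using iter [of m] m(2) *(1) by auto
  moreover have "m + 2 * (n - 1) > 0" using m(1) by simp
  moreover have "\<exists>m. d \<le> \<bar>snd ((pet_shift t ^^ m) (shear d (x, y)))\<bar>" if "pet_inv d (x, y) \<noteq> (2 * y - x - 2 * d, y - x - d)"
  proof (cases "n = 1")
    case True
    then have "K \<noteq> 0" using that *(1,4,5) by auto
    then obtain m where "d \<le> \<bar>snd ((pet_shift t ^^ m) (x, v))\<bar>" using big K by blast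
    then have "d \<le> \<bar>snd ((pet_shift t ^^ (m + 2 * (n - 1))) (shear d (x, y)))\<bar>" using iter [of m] by auto
    then show ?thesis by blast
  next
    case False
    then have "1 < n" using *(3) by simp
    then have "(pet_shift t ^^ (2 * 1)) (x, y - d/2) = (x, y - d/2 - of_nat 1 * d) \<or>
     (pet_shift t ^^ (2 * 1)) (x, y - d/2) = - (x, y - d/2 - of_nat 1 * d)"
      using pet_shift_low_iterate [OF d t p(1) *(4) b(4), of 1] by blast
    then have "d \<le> \<bar>snd ((pet_shift t ^^ (2 * 1)) (shear d (x, y)))\<bar>" unfolding sh using b d by auto
    then show ?thesis by blast
  qed
  ultimately show ?thesis using off by blast
qed

lemma off_diag_cases:
  assumes "p \<in> off_diag d"
  obtains x y where "p = (x, y) \<or> p = - (x, y)" "(x, y) \<in> generic_cell d" "y - x > d/2"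
proof -
  obtain a b where p: "p = (a, b)" by fastforce
  show ?thesis
  proof (cases "b - a > d/2")
    case True then show ?thesis using that [of a b] assms p by (simp add: off_diag_iff)
  next
    case False
    have "- p \<in> off_diag d" by (rule off_diag_uminus) fact
    moreover have "d/2 < - b - (- a)" using assms False unfolding p off_diag_iff by linarith
    ultimately show ?thesis using that [of "- a" "- b"] p by (simp add: off_diag_iff)
  qed
qed

lemma odd_map_pet_inv_off_diag:
  assumes "0 < d" "d < 1/2" shows "odd_map (pet_inv d) (off_diag d)"
  unfolding odd_map_def
proof (intro ballI conjI)
  fix p assume p: "p \<in> off_diag d"
  then have generic_cell: "p \<in> generic_cell d" by (cases p) (simp add: off_diag_iff)
  show "- p \<in> off_diag d" using p by (rule off_diag_uminus)
  show odd: "pet_inv d (- p) = - pet_inv d p" using odd_mapD(3) [OF odd_map_pet_inv generic_cell] assms by simp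
  obtain x y where xy: "p = (x, y) \<or> p = - (x, y)" "(x, y) \<in> generic_cell d" "y - x > d/2"
    using off_diag_cases [OF p] by blast
  \<comment> \<open>Invariance of the domain does not involve t, so any admissible value will do; 2
    - d is the least one.\<close>
  have "pet_inv d (x, y) \<in> off_diag d"
    using pet_shift_low_return [OF assms _ _ xy(2,3), of "2 - d" 2] by simp
  then show "pet_inv d p \<in> off_diag d"
    using xy(1) off_diag_uminus odd by (metis minus_minus)
qed

lemma pet_inv_induced:
  assumes d: "0 < d" "d < 1/2" and t: "t = of_int k - d" "2 \<le> k"
  shows "induced_by (pet_inv d) (off_diag d) (pet_shift t) (shear d)"
  unfolding induced_by_def
proof
  fix p assume p: "p \<in> off_diag d"
  have "t > 0" using t d by linarith
  obtain x y where xy: "p = (x, y) \<or> p = - (x, y)" "(x, y) \<in> generic_cell d" "y - x > d/2"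
    using off_diag_cases [OF p] by blast
  then have "d/2 < \<bar>y - x\<bar>" by linarith
  with xy(2) have q: "(x, y) \<in> off_diag d" by (simp add: off_diag_iff)
  note odd = odd_map_funpow [OF odd_map_pet_shift [OF \<open>t > 0\<close>], of "shear d (x, y)"]
    odd_mapD(3) [OF odd_map_pet_inv_off_diag [OF d] q]
  obtain m where "m > 0" "(pet_shift t ^^ m) (shear d (x, y)) = shear d (pet_inv d (x, y)) \<or>
           (pet_shift t ^^ m) (shear d (x, y)) = - shear d (pet_inv d (x, y))"
    using pet_shift_low_return [OF d t xy(2,3)] by blast
  then show "\<exists>n>0. (pet_shift t ^^ n) (shear d p) = shear d (pet_inv d p) \<or> (pet_shift t ^^ n) (shear d p) = - shear d (pet_inv d p)"
    using xy(1) odd shear_generic_cell [OF d t q] shear_uminus by (intro exI [of _ m]) (metis minus_minus)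
qed

theorem long_orbit_below_integer_strict:
  assumes d: "0 < d" "d < 1/2" and t: "t = of_int k - d" "2 \<le> k"
    and p: "p \<in> off_diag d" "finite (orb (pet_inv d) p)" "N \<le> card (orb (pet_inv d) p)"
    and q: "(x, y) \<in> orb (pet_inv d) p" "y - x > d/2" "pet_inv d (x, y) \<noteq> (2 * y - x - 2 * d, y - x - d)"
  shows "long_orbit (pet_shift t) (generic_cell t) (Suc N)"
proof -
  have "t > 0" using t d by linarith
  note odd = odd_map_pet_inv_off_diag [OF d]
  have "(x, y) \<in> generic_cell d" using orb_subset_domain [OF odd p(1)] q(1) by (auto simp: off_diag_iff)
  then obtain m where "d \<le> \<bar>snd ((pet_shift t ^^ m) (shear d (x, y)))\<bar>"
    using pet_shift_low_return [OF d t _ q(2)] q(3) by blast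
  then have notin: "(pet_shift t ^^ m) (shear d (x, y)) \<notin> shear d ` off_diag d"
    using shear_generic_cell [OF d t] by force
  show ?thesis
    by (rule long_orbit_induced_strict [OF odd odd_map_pet_shift [OF \<open>t > 0\<close>] _ _ pet_inv_induced [OF d t] shear_inj [OF d] p q(1) notin])
       (use shear_generic_cell [OF d t] shear_uminus in auto)
qed

text \<open>
  If the return orbit gained no point, then \<open>pet_inv d\<close> would act on the given orbit by affine maps whose
  fourth iterate is the identity, and the orbit would have at most 8 points.
\<close>

theorem long_orbit_below_integer:
  assumes d: "0 < d" "d < 1/2" and t: "t = of_int k - d" "2 \<le> k"
    and L: "long_orbit (pet_inv d) (generic_cell d) N" and N: "8 < N"
  shows "long_orbit (pet_shift t) (generic_cell t) (Suc N)"
proof -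
  obtain p where p: "p \<in> generic_cell d" "finite (orb (pet_inv d) p)" "N \<le> card (orb (pet_inv d) p)"
    using L by (auto simp: long_orbit_def)
  note odd = odd_map_pet_inv [OF d(1)]
  \<comment> \<open>An orbit meeting the central strip closes up to sign after two steps and has at
    most 4 points.\<close>
  have off: "p \<in> off_diag d"
  proof (rule ccontr)
    assume "p \<notin> off_diag d"
    obtain x y where Pair: "p = (x, y)" by fastforce
    have b: "\<bar>x\<bar> < 1/2" "\<bar>y\<bar> < d/2" "generic d x y" using p(1) by (auto simp: Pair generic_cell_iff)
    have "2 * y - 2 * x \<noteq> d" "2 * y - 2 * x \<noteq> - d"
      using genericD [OF b(3), of "-2" 2 0 "-1"] genericD [OF b(3), of "-2" 2 0 1] by auto
    moreover have "\<not> d/2 < \<bar>y - x\<bar>" using \<open>p \<notin> off_diag d\<close> p(1) by (simp add: Pair off_diag_iff)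
    ultimately have "y - x \<le> d/2" "- (d/2) \<le> y - x" "y - x \<noteq> d/2" "y - x \<noteq> - (d/2)" by linarith+
    then have yx: "\<bar>y - x\<bar> < d/2" by linarith
    have 1: "pet_inv d (x, y) = (2 * y - x, y - x)"
      by (rule pet_inv_eqI [where n = 0 and k = 0, OF _ _ _ yx]) (simp, simp, use b yx d in linarith)
    have 2: "pet_inv d (2 * y - x, y - x) = (- x, - y)"
      by (rule pet_inv_eqI [where n = 0 and k = 0]) (use b in simp_all)
    have "(pet_inv d ^^ 2) p = - (pet_inv d ^^ 0) p" using 1 2 by (simp add: Pair numeral_2_eq_2)
    then have "card (orb (pet_inv d) p) \<le> 2 * 2" using orb_finite_card(2) [OF odd p(1), of 0 2] by simp
    then show False using p(3) N by simp
  qed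
  note odd' = odd_map_pet_inv_off_diag [OF d]
  show ?thesis
  proof (rule ccontr)
    assume neg: "\<not> ?thesis"
    have pet_inv: "pet_inv d (x, y) = (2 * y - x - 2 * d, y - x - d)" if "(x, y) \<in> orb (pet_inv d) p" "y - x > d/2" for x y
      using long_orbit_below_integer_strict [OF d t off p(2,3) that] neg by blast
    obtain x y where xy: "p = (x, y) \<or> p = - (x, y)" "(x, y) \<in> generic_cell d" "y - x > d/2"
      using off_diag_cases [OF off] by blast
    have po: "(x, y) \<in> orb (pet_inv d) p" using xy(1) orb_self orb_uminus by (metis minus_minus)
    have orb: "orb (pet_inv d) (x, y) \<subseteq> orb (pet_inv d) p" "orb (pet_inv d) p \<subseteq> orb (pet_inv d) (x, y)"
      using orb_trans [OF odd p(1) po] orb_trans [OF odd xy(2), of p] xy(1) orb_self orb_uminus by metis+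
    have Hin: "pet_inv d q \<in> orb (pet_inv d) p" if "q \<in> orb (pet_inv d) p" for q
      using orb_trans [OF odd p(1) that] orb_funpow(1) [of 1 "pet_inv d" q] by auto
    have gpb: "\<bar>snd q\<bar> < d/2" if "q \<in> orb (pet_inv d) p" for q
      using orb_subset_domain [OF odd p(1)] that by (cases q) (auto simp: generic_cell_iff)
    \<comment> \<open>The affine map is a rotation of order four about (-d, 0). The bounds on y and
      y - x - d keep all four images in the half y - x > d/2, where the formula applies
      again.\<close>
    have 1: "pet_inv d (x, y) = (2 * y - x - 2 * d, y - x - d)" using pet_inv po xy(3) by blast
    have in1: "(2 * y - x - 2 * d, y - x - d) \<in> orb (pet_inv d) p" using Hin [OF po] 1 by simp
    have "\<bar>y\<bar> < d/2" "\<bar>y - x - d\<bar> < d/2" using gpb [OF po] gpb [OF in1] by simp_all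
    then have b: "y < d/2" "- (d/2) < y" "y - x - d < d/2" "- (d/2) < y - x - d" by linarith+
    have "pet_inv d (2 * y - x - 2 * d, y - x - d) = (- x - 2 * d, - y)"
      using pet_inv [OF in1] b by simp
    note 2 = this
    have in2: "(- x - 2 * d, - y) \<in> orb (pet_inv d) p" using Hin [OF in1] 2 by simp
    have 3: "pet_inv d (- x - 2 * d, - y) = (x - 2 * y, x - y + d)" using pet_inv [OF in2] b by simp
    have in3: "(x - 2 * y, x - y + d) \<in> orb (pet_inv d) p" using Hin [OF in2] 3 by simp
    have 4: "pet_inv d (x - 2 * y, x - y + d) = (x, y)" using pet_inv [OF in3] b by simp
    have "(pet_inv d ^^ 4) (x, y) = (pet_inv d ^^ 0) (x, y)" using 1 2 3 4 by (simp add: numeral_eq_Suc)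
    then have "card (orb (pet_inv d) (x, y)) \<le> 2 * 4" using orb_finite_card(2) [OF odd xy(2), of 0 4] by simp
    moreover have "orb (pet_inv d) (x, y) = orb (pet_inv d) p" using orb by blast
    ultimately show False using p(3) N by simp
  qed
qed

subsection \<open>Unbounded orbits\<close>

text \<open>Negative first coordinates separate the four points from their opposites, so a cycle of
  length four up to sign accounts for eight points.\<close>

lemma orb_four_cycle:
  assumes T: "odd_map T X" "p0 \<in> X"
    and step: "T p0 = p1 \<or> T p0 = - p1" "T p1 = p2 \<or> T p1 = - p2" "T p2 = p3 \<or> T p2 = - p3" "T p3 = p0 \<or> T p3 = - p0"
    and neg: "fst p0 < 0" "fst p1 < 0" "fst p2 < 0" "fst p3 < 0"
    and dist: "distinct [p0, p1, p2, p3]"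
  shows "finite (orb T p0) \<and> 8 \<le> card (orb T p0)"
proof -
  have o: "T q \<in> orb T p0" if "q \<in> orb T p0" for q
    using orb_trans [OF T that] orb_funpow(1) [of 1 T q] by auto
  have u: "q \<in> orb T p0" if "T r = q \<or> T r = - q" "r \<in> orb T p0" for q r
    using o [OF that(2)] that(1) orb_uminus by (metis minus_minus)
  have X: "q \<in> X" if "q \<in> orb T p0" for q using orb_subset_domain [OF T] that by blast
  have s: "p0 \<in> orb T p0" by (rule orb_self)
  have p: "p1 \<in> orb T p0" "p2 \<in> orb T p0" "p3 \<in> orb T p0"
    using u [OF step(1) s] u [OF step(2)] u [OF step(3)] by blast+
  have T2: "(T ^^ 2) p0 = p2 \<or> (T ^^ 2) p0 = - p2"
    using step(1,2) odd_mapD(3) [OF T(1) X [OF p(1)]] by (auto simp: numeral_2_eq_2)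
  have "(T ^^ 2) p2 = p0 \<or> (T ^^ 2) p2 = - p0"
    using step(3,4) odd_mapD(3) [OF T(1) X [OF p(3)]] by (auto simp: numeral_2_eq_2)
  then have "(T ^^ (2 + 2)) p0 = p0 \<or> (T ^^ (2 + 2)) p0 = - p0"
    using T2 odd_map_funpow [OF T(1) X [OF p(2)], of 2] unfolding funpow_add by auto
  then have fin: "finite (orb T p0)"
    using orb_finite_card(1) [OF T, of 0 "2 + 2"] by simp
  let ?A = "{p0, p1, p2, p3}"
  have A: "card ?A = 4" using dist by (simp add: card_insert_if)
  have "card (uminus ` ?A) = 4" using A by (subst card_image) (auto simp: inj_on_def)
  moreover have "?A \<inter> uminus ` ?A = {}"
  proof -
    have "fst q < 0" if "q \<in> ?A" for q using neg that by blast
    moreover have "fst q > 0" if "q \<in> uminus ` ?A" for q using neg that by auto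
    ultimately show ?thesis by (meson disjoint_iff order_less_asym)
  qed
  ultimately have "card (?A \<union> uminus ` ?A) = 8"
    using A by (subst card_Un_disjoint) auto
  moreover have "?A \<union> uminus ` ?A \<subseteq> orb T p0" using s p orb_uminus by auto
  ultimately show ?thesis using fin card_mono by metis
qed

text \<open>
  Near the centre \<open>(cx, cy)\<close> of a tile the map is, up to sign, the linear map
  \<open>(a, b) \<mapsto> (a - 2 b, a - b)\<close> of order 4 or its inverse, recentred.
\<close>

lemma tile_orbit:
  assumes T: "odd_map T (generic_cell s)" and s: "s \<notin> \<rat>" and \<sigma>: "\<sigma> = 1 \<or> \<sigma> = (-1 :: real)"
    and \<delta>: "0 < \<delta>" "cx + 2 * \<delta> < 0" "- 1/2 < cx" "\<bar>cy\<bar> + \<delta> < s/2"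
    and step: "\<And>a b. \<bar>a\<bar> < 2 * \<delta> \<Longrightarrow> \<bar>b\<bar> < \<delta> \<Longrightarrow>
      T (cx + a, cy + b) = (cx + \<sigma> * (a - 2 * b), cy + \<sigma> * (a - b)) \<or>
      T (cx + a, cy + b) = - (cx + \<sigma> * (a - 2 * b), cy + \<sigma> * (a - b))"
  obtains u v where "0 < u" "u < \<delta>" "0 < v" "v < \<delta>" "(cx + u, cy + v) \<in> generic_cell s"
    "finite (orb T (cx + u, cy + v))" "8 \<le> card (orb T (cx + u, cy + v))"
proof -
  obtain x y where xy: "cx < x" "x < cx + \<delta>" "cy < y" "y < cy + \<delta>" "generic s x y"
    using generic_ex [OF s, of cx "cx + \<delta>" cy "cy + \<delta>"] \<delta>(1) by auto
  define u v where "u = x - cx" and "v = y - cy"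
  have u: "0 < u" "u < \<delta>" "0 < v" "v < \<delta>" and P: "(cx + u, cy + v) = (x, y)"
    using xy by (simp_all add: u_def v_def)
  have "\<bar>x\<bar> < 1/2" "\<bar>y\<bar> < s/2" using xy \<delta> by linarith+
  then have p: "(cx + u, cy + v) \<in> generic_cell s" using xy(5) by (simp only: P generic_cell_iff simp_thms)
  \<comment> \<open>With u and v both in (0, \<delta>), the differences u - 2v and u - v stay in the
    box, so \<open>step\<close> applies to all four points even though the box is not
    invariant.\<close>
  have b: "\<bar>u\<bar> < 2 * \<delta>" "\<bar>v\<bar> < \<delta>" "\<bar>- u\<bar> < 2 * \<delta>" "\<bar>- v\<bar> < \<delta>" "\<bar>u - 2 * v\<bar> < 2 * \<delta>" "\<bar>u - v\<bar> < \<delta>"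
    "\<bar>2 * v - u\<bar> < 2 * \<delta>" "\<bar>v - u\<bar> < \<delta>"
    using u by linarith+
  note steps = step [OF b(1,2)] step [OF b(3,4)] step [OF b(5,6)] step [OF b(7,8)]
  from \<sigma> have "finite (orb T (cx + u, cy + v)) \<and> 8 \<le> card (orb T (cx + u, cy + v))"
  proof
    assume \<sigma>: "\<sigma> = 1"
    show ?thesis
    proof (rule orb_four_cycle [OF T p, of "(cx + (u - 2 * v), cy + (u - v))" "(cx + - u, cy + - v)"
          "(cx + (2 * v - u), cy + (v - u))"])
      show "fst (cx + u, cy + v) < 0" "fst (cx + (u - 2 * v), cy + (u - v)) < 0" "fst (cx + - u, cy + - v) < 0"
        "fst (cx + (2 * v - u), cy + (v - u)) < 0"
        using u \<delta> by simp_all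
    qed (use steps u \<sigma> in simp_all)
  next
    assume \<sigma>: "\<sigma> = - 1"
    show ?thesis
    proof (rule orb_four_cycle [OF T p, of "(cx + (2 * v - u), cy + (v - u))" "(cx + - u, cy + - v)"
          "(cx + (u - 2 * v), cy + (u - v))"])
      show "fst (cx + u, cy + v) < 0" "fst (cx + (u - 2 * v), cy + (u - v)) < 0" "fst (cx + - u, cy + - v) < 0"
        "fst (cx + (2 * v - u), cy + (v - u)) < 0"
        using u \<delta> by simp_all
    qed (use steps u \<sigma> in simp_all)
  qed
  with u p show ?thesis by (intro that) auto
qed

text \<open>The centre (-c, 0) is fixed by the branch in which y wraps once and x does not; c < 1/2
  keeps it inside the cell.\<close>

lemma long_orbit_pet_8:
  assumes c: "0 < c" "c < 1/2" "c \<notin> \<rat>"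
  shows "long_orbit (pet c) (generic_cell c) 8"
proof -
  define \<delta> where "\<delta> = min (c / 8) ((1/2 - c) / 8)"
  have "0 < \<delta>" using c by (simp add: \<delta>_def)
  moreover have "\<delta> \<le> c / 8" "\<delta> \<le> (1/2 - c) / 8" unfolding \<delta>_def by (rule min.cobounded1, rule min.cobounded2)
  ultimately have \<delta>: "0 < \<delta>" "8 * \<delta> \<le> c" "8 * \<delta> \<le> 1/2 - c" by simp_all
  show ?thesis
  proof (rule tile_orbit [OF odd_map_pet [OF c(1)] c(3), of 1 \<delta> "- c" 0])
    fix a b assume "\<bar>a\<bar> < 2 * \<delta>" "\<bar>b\<bar> < \<delta>"
    then have bd: "\<bar>- c + (a - 2 * b)\<bar> < 1/2" "\<bar>a - b\<bar> < c/2" using \<delta> by linarith+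
    have "pet c (- c + a, b) = (- c + (a - 2 * b), a - b)"
      by (rule pet_eqI [where k = 0 and n = "-1", OF _ _ bd]) simp_all
    then show "pet c (- c + a, 0 + b) = (- c + 1 * (a - 2 * b), 0 + 1 * (a - b)) \<or>
      pet c (- c + a, 0 + b) = - (- c + 1 * (a - 2 * b), 0 + 1 * (a - b))" by simp
  qed (use \<delta> c in \<open>auto simp: long_orbit_def\<close>)
qed

text \<open>At the centre (-2e, 0) the coordinate y wraps twice, and e < 1/4 keeps this centre
  inside the cell. Two wraps distinguish the branch from the exceptional affine map, which has one,
  so the lift adds a ninth point.\<close>

lemma long_orbit_pet_shift_9_small:
  assumes e: "0 < e" "e < 1/4" "e \<notin> \<rat>" and t: "t = of_int k - e" "2 \<le> k"
  shows "long_orbit (pet_shift t) (generic_cell t) 9"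
proof -
  define \<delta> where "\<delta> = min (e / 8) ((1/4 - e) / 8)"
  have "0 < \<delta>" using e by (simp add: \<delta>_def)
  moreover have "\<delta> \<le> e / 8" "\<delta> \<le> (1/4 - e) / 8" unfolding \<delta>_def by (rule min.cobounded1, rule min.cobounded2)
  ultimately have \<delta>: "0 < \<delta>" "8 * \<delta> \<le> e" "8 * \<delta> \<le> 1/4 - e" by simp_all
  have e': "e < 1/2" using e by simp
  have pet_inv: "pet_inv e (- 2 * e + a, b) = (- 2 * e + (2 * b - a), b - a)" if "\<bar>a\<bar> < 2 * \<delta>" "\<bar>b\<bar> < \<delta>" for a b
  proof -
    have bd: "\<bar>- 2 * e + (2 * b - a)\<bar> < 1/2" "\<bar>b - a\<bar> < e/2" using that \<delta> by linarith+
    show ?thesis by (rule pet_inv_eqI [where k = 0 and n = 2, OF _ _ bd]) simp_all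
  qed
  obtain u v where u: "0 < u" "u < \<delta>" "0 < v" "v < \<delta>" "(- 2 * e + u, 0 + v) \<in> generic_cell e"
    "finite (orb (pet_inv e) (- 2 * e + u, 0 + v))" "8 \<le> card (orb (pet_inv e) (- 2 * e + u, 0 + v))"
  proof (rule tile_orbit [OF odd_map_pet_inv [OF e(1)] e(3), of "-1" \<delta> "- 2 * e" 0])
    fix a b assume "\<bar>a\<bar> < 2 * \<delta>" "\<bar>b\<bar> < \<delta>"
    then show "pet_inv e (- 2 * e + a, 0 + b) = (- 2 * e + - 1 * (a - 2 * b), 0 + - 1 * (a - b)) \<or>
      pet_inv e (- 2 * e + a, 0 + b) = - (- 2 * e + - 1 * (a - 2 * b), 0 + - 1 * (a - b))"
      using pet_inv [of a b] by simp
  qed (use \<delta> e in auto)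
  have "\<bar>u\<bar> < 2 * \<delta>" "\<bar>v\<bar> < \<delta>" using u by linarith+
  then have ne: "pet_inv e (- 2 * e + u, 0 + v) \<noteq> (2 * (0 + v) - (- 2 * e + u) - 2 * e, 0 + v - (- 2 * e + u) - e)"
    using pet_inv [of u v] e by simp
  have diff: "0 + v - (- 2 * e + u) > e/2" using u \<delta> by linarith
  then have "e/2 < \<bar>0 + v - (- 2 * e + u)\<bar>" by linarith
  with u(5) have off: "(- 2 * e + u, 0 + v) \<in> off_diag e" by (simp only: off_diag_iff simp_thms)
  show ?thesis
    using long_orbit_below_integer_strict [OF e(1) e' t off u(6,7) orb_self diff ne] by simp
qed

text \<open>The centre (2e - 1, 2e - 1/2) is sent to its negative by the branch with two wraps of y
  and one of x. It lies in the cell because e > 1/4 (first coordinate) and e < 1/3 (second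
  coordinate).\<close>

lemma long_orbit_pet_shift_9_medium:
  assumes e: "1/4 < e" "e < 1/3" "e \<notin> \<rat>" and t: "t = of_int k - e" "2 \<le> k"
  shows "long_orbit (pet_shift t) (generic_cell t) 9"
proof -
  define \<delta> where "\<delta> = min ((1/3 - e) / 8) ((e - 1/4) / 8)"
  have "0 < \<delta>" using e by (simp add: \<delta>_def)
  moreover have "\<delta> \<le> (1/3 - e) / 8" "\<delta> \<le> (e - 1/4) / 8" unfolding \<delta>_def by (rule min.cobounded1, rule min.cobounded2)
  ultimately have \<delta>: "0 < \<delta>" "8 * \<delta> \<le> 1/3 - e" "8 * \<delta> \<le> e - 1/4" by simp_all
  have e': "0 < e" "e < 1/2" using e by simp_all
  define cx cy where "cx = 2 * e - 1" and "cy = 2 * e - 1/2"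
  have pet_inv: "pet_inv e (cx + a, cy + b) = - (cx + (a - 2 * b), cy + (a - b))" if "\<bar>a\<bar> < 2 * \<delta>" "\<bar>b\<bar> < \<delta>" for a b
  proof -
    have bd: "\<bar>1 - 2 * e - (a - 2 * b)\<bar> < 1/2" "\<bar>1/2 - 2 * e - (a - b)\<bar> < e/2" using that \<delta> by linarith+
    have "pet_inv e (cx + a, cy + b) = (1 - 2 * e - (a - 2 * b), 1/2 - 2 * e - (a - b))"
      by (rule pet_inv_eqI [where k = "-1" and n = 2, OF _ _ bd]) (simp_all add: cx_def cy_def)
    then show ?thesis by (simp add: cx_def cy_def)
  qed
  obtain u v where u: "0 < u" "u < \<delta>" "0 < v" "v < \<delta>" "(cx + u, cy + v) \<in> generic_cell e"
    "finite (orb (pet_inv e) (cx + u, cy + v))" "8 \<le> card (orb (pet_inv e) (cx + u, cy + v))"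
  proof (rule tile_orbit [OF odd_map_pet_inv [OF e'(1)] e(3), of 1 \<delta> cx cy])
    fix a b assume "\<bar>a\<bar> < 2 * \<delta>" "\<bar>b\<bar> < \<delta>"
    then show "pet_inv e (cx + a, cy + b) = (cx + 1 * (a - 2 * b), cy + 1 * (a - b)) \<or>
      pet_inv e (cx + a, cy + b) = - (cx + 1 * (a - 2 * b), cy + 1 * (a - b))"
      using pet_inv [of a b] by simp
  next
    show "\<bar>cy\<bar> + \<delta> < e/2" using \<delta> e cy_def by linarith
    show "cx + 2 * \<delta> < 0" "- 1/2 < cx" using \<delta> e cx_def by linarith+
  qed (use \<delta> in auto)
  have "\<bar>u\<bar> < 2 * \<delta>" "\<bar>v\<bar> < \<delta>" using u by linarith+
  then have ne: "pet_inv e (cx + u, cy + v) \<noteq> (2 * (cy + v) - (cx + u) - 2 * e, cy + v - (cx + u) - e)"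
    using pet_inv [of u v] e by (simp add: cx_def cy_def)
  have diff: "cy + v - (cx + u) > e/2" using u \<delta> e cx_def cy_def by linarith
  then have "e/2 < \<bar>cy + v - (cx + u)\<bar>" by linarith
  with u(5) have off: "(cx + u, cy + v) \<in> off_diag e" by (simp only: off_diag_iff simp_thms)
  show ?thesis
    using long_orbit_below_integer_strict [OF e' t off u(6,7) orb_self diff ne] by simp
qed

section \<open>Induction on the length of the orbits\<close>

lemma nearest_integer_cases:
  fixes t :: real
  assumes "t > 1" "t \<notin> \<rat>"
  obtains (above) k c where "t = of_int k + c" "1 \<le> k" "0 < c" "c < 1/2" "c \<notin> \<rat>"
    | (below) k e where "t = of_int k - e" "2 \<le> k" "0 < e" "e < 1/2" "e \<notin> \<rat>"
proof -
  define k where "k = round t"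
  define c where "c = t - of_int k"
  have c: "\<bar>c\<bar> \<le> 1/2" using of_int_round_abs_le [of t] by (simp add: c_def k_def abs_minus_commute)
  have irr: "c \<notin> \<rat>" "- c \<notin> \<rat>"
    using assms(2) Rats_add [of c "of_int k"] Rats_minus_iff [of c] by (auto simp: c_def)
  moreover have "(1/2 :: real) \<in> \<rat>" "(0 :: real) \<in> \<rat>" by simp_all
  ultimately have "c \<noteq> 0" "c \<noteq> 1/2" "- c \<noteq> 1/2" by metis+
  with c consider "0 < c" "c < 1/2" | "0 < - c" "- c < 1/2" by linarith
  then show ?thesis
  proof cases
    case 1
    then have "of_int k > (0 :: real)" using assms(1) by (simp add: c_def)
    then show ?thesis using above [of k c] 1 irr by (simp add: c_def)
  next
    case 2
    then have "of_int k > (1 :: real)" using assms(1) by (simp add: c_def)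
    then show ?thesis using below [of k "- c"] 2 irr by (simp add: c_def)
  qed
qed

lemma long_orbit_pet_if_pet_shift_dual:
  assumes "0 < d" "long_orbit (pet_shift (1 / (2 * d))) (generic_cell (1 / (2 * d))) N"
  shows "long_orbit (pet d) (generic_cell d) N"
proof (rule long_orbit_dual [OF assms(1) long_orbit_pet_inv_if_pet])
  show t: "1 / (2 * d) > 0" using assms(1) by simp
  show "long_orbit (pet (1 / (2 * d))) (generic_cell (1 / (2 * d))) N"
    using assms(2) long_orbit_pet_iff_pet_shift [OF t] by blast
qed

lemma dual_parameter:
  fixes d :: real
  assumes "0 < d" "d < 1/2" "d \<notin> \<rat>"
  shows "1 / (2 * d) > 1" "1 / (2 * d) \<notin> \<rat>"
proof -
  show "1 / (2 * d) > 1" using assms by (simp add: field_simps)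
  show "1 / (2 * d) \<notin> \<rat>"
  proof
    assume "1 / (2 * d) \<in> \<rat>"
    from Rats_divide [OF Rats_divide [OF Rats_1 this] Rats_number_of [of "num.Bit0 num.One"]]
    show False using assms by simp
  qed
qed

lemma long_orbit_pet_shift_9_above:
  assumes "t = of_int k + c" "1 \<le> k" "0 < c" "c < 1/2" "c \<notin> \<rat>"
  shows "long_orbit (pet_shift t) (generic_cell t) 9"
proof -
  have "long_orbit (pet_shift c) (generic_cell c) 8"
    using long_orbit_pet_8 [OF assms(3-5)] long_orbit_pet_iff_pet_shift [OF assms(3)] by blast
  from long_orbit_above_integer [OF assms(3,4,1,2) this] show ?thesis by simp
qed

lemma long_orbit_pet_shift_9:
  assumes "t > 1" "t \<notin> \<rat>"
  shows "long_orbit (pet_shift t) (generic_cell t) 9"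
  using assms
proof (cases rule: nearest_integer_cases)
  case (above k c)
  then show ?thesis by (rule long_orbit_pet_shift_9_above)
next
  case (below k e)
  have "(1/4 :: real) \<in> \<rat>" "(1/3 :: real) \<in> \<rat>" by simp_all
  then have "e \<noteq> 1/4" "e \<noteq> 1/3" using below(5) by metis+
  then consider "e < 1/4" | "1/4 < e" "e < 1/3" | "1/3 < e" by linarith
  then show ?thesis
  proof cases
    case 1
    then show ?thesis using long_orbit_pet_shift_9_small below by blast
  next
    case 2
    then show ?thesis using long_orbit_pet_shift_9_medium below by blast
  next
    case 3
    \<comment> \<open>For 1/3 < e < 1/2 the dual parameter lies between 1 and 3/2, that is, just
      above an integer.\<close>
    define c where "c = 1 / (2 * e) - 1"
    note dual = dual_parameter [OF below(3-5)]
    have "0 < c" "c < 1/2" using dual(1) 3 below(3) by (simp_all add: c_def field_simps)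
    moreover have "c \<notin> \<rat>" using dual(2) Rats_add [of c 1] by (auto simp: c_def)
    ultimately have "long_orbit (pet e) (generic_cell e) 9"
      by (intro long_orbit_pet_if_pet_shift_dual [OF below(3)] long_orbit_pet_shift_9_above [of _ 1 c]) (simp_all add: c_def)
    then have "long_orbit (pet_inv e) (generic_cell e) 9" using below(3) by (rule long_orbit_pet_inv_if_pet [rotated])
    then show ?thesis
      using long_orbit_below_integer [OF below(3,4,1,2), of 9] long_orbit_mono by force
  qed
qed

text \<open>The induction counts gained points and runs over all parameters at once: the dual 1/(2d)
  is again irrational and above 1, so the hypothesis yields an orbit for d, and renormalization adds
  a point. Starting at 9 meets the threshold of \<open>long_orbit_below_integer\<close>.\<close>

theorem long_orbit_pet_shift_unbounded:
  assumes "t > 1" "t \<notin> \<rat>"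
  shows "long_orbit (pet_shift t) (generic_cell t) (9 + N)"
  using assms
proof (induction N arbitrary: t)
  case 0
  then show ?case using long_orbit_pet_shift_9 by simp
next
  case (Suc N)
  have pet: "long_orbit (pet d) (generic_cell d) (9 + N)" if "0 < d" "d < 1/2" "d \<notin> \<rat>" for d
    using Suc.IH [OF dual_parameter [OF that]] that by (intro long_orbit_pet_if_pet_shift_dual)
  from Suc.prems show ?case
  proof (cases rule: nearest_integer_cases)
    case (above k c)
    then show ?thesis
      using long_orbit_above_integer [OF above(3,4,1,2), of "9 + N"] pet [of c] by (simp add: long_orbit_pet_iff_pet_shift)
  next
    case (below k e)
    then show ?thesis
      using long_orbit_below_integer [OF below(3,4,1,2), of "9 + N"] pet [of e] by (simp add: long_orbit_pet_inv_if_pet)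
  qed
qed

subsection \<open>Density\<close>

text \<open>Every window of length M contains an interval of length \<epsilon> of each factor, so
  each window square in the first quadrant contributes a square of area \<epsilon>^2, and these
  squares are disjoint. This quadrant alone suffices for a lower bound.\<close>

lemma positive_density_product:
  assumes X: "open X" "\<And>r. \<exists>u\<ge>r. u + \<epsilon> \<le> r + M \<and> {u..u + \<epsilon>} \<subseteq> X"
    and Y: "open Y" "\<And>r. \<exists>u\<ge>r. u + \<epsilon> \<le> r + M \<and> {u..u + \<epsilon>} \<subseteq> Y"
    and pos: "M > 0" "\<epsilon> > (0 :: real)"
  shows "positive_density {w. Re w \<in> X \<and> Im w \<in> Y}" (is "positive_density ?E")
proof -
  have "?E = Re -` X \<inter> Im -` Y" by auto
  then have "open ?E"
    using X(1) Y(1) by (auto intro!: open_Int open_vimage continuous_intros)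
  then have E: "?E \<in> sets lebesgue" by (simp add: borel_open sets_completionI_sets)
  obtain f where f: "\<And>r. f r \<ge> r" "\<And>r. f r + \<epsilon> \<le> r + M" "\<And>r. {f r..f r + \<epsilon>} \<subseteq> X"
    using X(2) by metis
  obtain g where g: "\<And>r. g r \<ge> r" "\<And>r. g r + \<epsilon> \<le> r + M" "\<And>r. {g r..g r + \<epsilon>} \<subseteq> Y"
    using Y(2) by metis
  define B where "B = (\<lambda>(i :: nat, j :: nat). box (Complex (f (i * M)) (g (j * M))) (Complex (f (i * M) + \<epsilon>) (g (j * M) + \<epsilon>)))"
  have B: "w \<in> B (i, j) \<longleftrightarrow> f (i * M) < Re w \<and> Re w < f (i * M) + \<epsilon> \<and> g (j * M) < Im w \<and> Im w < g (j * M) + \<epsilon>" for w i j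
    by (simp add: B_def in_box_complex_iff)
  have mB: "measure lebesgue (B p) = \<epsilon>\<^sup>2" "emeasure lebesgue (B p) \<noteq> \<infinity>" "B p \<in> sets lebesgue" for p
  proof -
    obtain i j where p: "p = (i, j)" by fastforce
    show "measure lebesgue (B p) = \<epsilon>\<^sup>2"
      using pos by (simp add: p B_def measure_lborel_box_eq Basis_complex_def inner_complex_def power2_eq_square)
    show "emeasure lebesgue (B p) \<noteq> \<infinity>"
      by (simp add: p B_def emeasure_lborel_box_eq)
    show "B p \<in> sets lebesgue" by (simp add: p B_def)
  qed
  have same: "i = i'" if "x \<in> {h (i * M)<..<h (i * M) + \<epsilon>}" "x \<in> {h (i' * M)<..<h (i' * M) + \<epsilon>}"
    "\<And>r. h r \<ge> r" "\<And>r. h r + \<epsilon> \<le> r + M" for x h and i i' :: nat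
  proof -
    have "i * M < i' * M + M" "i' * M < i * M + M"
      using that(1,2) that(3) [of "i * M"] that(3) [of "i' * M"] that(4) [of "i * M"] that(4) [of "i' * M"] by auto
    then have "(real i - real i') * M < 1 * M" "(real i' - real i) * M < 1 * M" by (auto simp: algebra_simps)
    then have "real i - real i' < 1" "real i' - real i < 1" using pos by (simp_all only: mult_less_cancel_right_pos)
    then show ?thesis by linarith
  qed
  have disj: "disjoint_family_on B S" for S
  proof (unfold disjoint_family_on_def, intro ballI impI)
    fix p q :: "nat \<times> nat" assume "p \<noteq> q"
    obtain i j where p: "p = (i, j)" by fastforce
    obtain i' j' where q: "q = (i', j')" by fastforce
    show "B p \<inter> B q = {}"
    proof (rule ccontr)
      assume "B p \<inter> B q \<noteq> {}"
      then obtain w where w: "w \<in> B (i, j)" "w \<in> B (i', j')" using p q by auto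
      have "i = i'" using same [of "Re w" f i i'] w f unfolding B by auto
      moreover have "j = j'" using same [of "Im w" g j j'] w g unfolding B by auto
      ultimately show False using \<open>p \<noteq> q\<close> p q by simp
    qed
  qed
  have lower: "\<epsilon>\<^sup>2 / (16 * M\<^sup>2 * pi) \<le> measure lebesgue (?E \<inter> ball 0 r) / (pi * r\<^sup>2)" if r: "r \<ge> 4 * M" for r
  proof -
    \<comment> \<open>The N by N windows fill at most [0, r/2]^2, which lies in the ball. For r
      \<ge> 4M rounding costs at most half, so N \<ge> r/(4M), and this gives the factor 16.\<close>
    define N where "N = nat \<lfloor>r / (2 * M)\<rfloor>"
    have "r > 0" using r pos by linarith
    then have fl: "\<lfloor>r / (2 * M)\<rfloor> \<ge> 0" using pos by simp
    have N1: "real N \<le> r / (2 * M)" "real N > r / (2 * M) - 1"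
      unfolding N_def using fl by (simp_all add: of_nat_nat)
    have N2: "real N * M \<le> r / 2" using N1(1) pos by (simp add: field_simps)
    have "r / (4 * M) \<ge> 1" using r pos by (simp add: field_simps)
    moreover have "r / (2 * M) = 2 * (r / (4 * M))" by simp
    ultimately have N3: "real N \<ge> r / (4 * M)" using N1(2) by linarith
    have sub: "(\<Union>p\<in>{..<N} \<times> {..<N}. B p) \<subseteq> ?E \<inter> ball 0 r"
    proof
      fix w assume "w \<in> (\<Union>p\<in>{..<N} \<times> {..<N}. B p)"
      then obtain i j where ij: "i < N" "j < N" "w \<in> B (i, j)" by auto
      have le: "real i * M + M \<le> real N * M" if "i < N" for i
      proof -
        have "(real i + 1) * M \<le> real N * M" using that pos by (intro mult_right_mono) auto
        then show ?thesis by (simp add: algebra_simps)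
      qed
      have "0 \<le> real i * M" "0 \<le> real j * M" using pos by simp_all
      then have "0 < Re w" "Re w < r / 2" "0 < Im w" "Im w < r / 2"
        using ij(3) f(1) [of "i * M"] f(2) [of "i * M"] g(1) [of "j * M"] g(2) [of "j * M"] le [OF ij(1)] le [OF ij(2)] N2
        unfolding B by linarith+
      then have "norm w < r" using cmod_le [of w] by linarith
      moreover have "w \<in> ?E" using ij(3) f(3) [of "i * M"] g(3) [of "j * M"] unfolding B by force
      ultimately show "w \<in> ?E \<inter> ball 0 r" by simp
    qed
    have "(r / (4 * M))\<^sup>2 * \<epsilon>\<^sup>2 \<le> (real N)\<^sup>2 * \<epsilon>\<^sup>2"
      using N3 \<open>r > 0\<close> pos by (intro mult_right_mono power_mono) auto
    also have "\<dots> = (\<Sum>p\<in>{..<N} \<times> {..<N}. measure lebesgue (B p))"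
      by (simp add: mB power2_eq_square)
    also have "\<dots> = measure lebesgue (\<Union>p\<in>{..<N} \<times> {..<N}. B p)"
      by (rule measure_finite_Union [symmetric]) (use mB disj in auto)
    also have "\<dots> \<le> measure lebesgue (?E \<inter> ball 0 r)"
    proof (rule measure_mono_fmeasurable [OF sub])
      show "(\<Union>p\<in>{..<N} \<times> {..<N}. B p) \<in> sets lebesgue" using mB by auto
      show "?E \<inter> ball 0 r \<in> lmeasurable"
        using E by (intro bounded_set_imp_lmeasurable bounded_Int) auto
    qed
    finally have "(r / (4 * M))\<^sup>2 * \<epsilon>\<^sup>2 / (pi * r\<^sup>2) \<le> measure lebesgue (?E \<inter> ball 0 r) / (pi * r\<^sup>2)"
      by (intro divide_right_mono) auto
    moreover have "(r / (4 * M))\<^sup>2 * \<epsilon>\<^sup>2 / (pi * r\<^sup>2) = \<epsilon>\<^sup>2 / (16 * M\<^sup>2 * pi)"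
      using \<open>r > 0\<close> pos by (simp add: field_simps power2_eq_square)
    ultimately show ?thesis by simp
  qed
  have "ereal (\<epsilon>\<^sup>2 / (16 * M\<^sup>2 * pi)) \<le> Liminf at_top (\<lambda>r::real. ereal (measure lebesgue (?E \<inter> ball 0 r) / (pi * r\<^sup>2)))"
    by (intro Liminf_bounded eventually_at_top_linorderI [of "4 * M"]) (simp add: lower)
  moreover have "0 < ereal (\<epsilon>\<^sup>2 / (16 * M\<^sup>2 * pi))" using pos by simp
  ultimately show ?thesis using E unfolding positive_density_def by (meson less_le_trans)
qed

text \<open>Both square lattices split into real and imaginary parts, so closeness to a point of the
  torus is one such condition on Re and one on Im.\<close>

definition near_both :: "real \<Rightarrow> real \<Rightarrow> real \<Rightarrow> real \<Rightarrow> real set" where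
  "near_both s \<epsilon> \<alpha> \<beta> = {u. \<exists>m n :: int. \<bar>u - of_int m - \<alpha>\<bar> < \<epsilon> \<and> \<bar>u - s * of_int n - \<beta>\<bar> < \<epsilon>}"

lemma open_near_both: "open (near_both s \<epsilon> \<alpha> \<beta>)"
proof -
  have eq: "near_both s \<epsilon> \<alpha> \<beta> = (\<Union>m. \<Union>n. {u. \<bar>u - of_int m - \<alpha>\<bar> < \<epsilon>} \<inter> {u. \<bar>u - s * of_int n - \<beta>\<bar> < \<epsilon>})"
    by (auto simp: near_both_def)
  show ?thesis
    unfolding eq by (intro open_UN ballI open_Int open_Collect_less continuous_intros)
qed

text \<open>Moving by qs, with qs close to an integer p, preserves the residue modulo s and changes
  the one modulo 1 by the small number \<theta>, nonzero as s is irrational. About 1/|\<theta>| such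
  moves reach every \<alpha>, uniformly in r.\<close>

lemma near_both_relatively_dense:
  assumes s: "s > 0" "s \<notin> \<rat>" and \<epsilon>: "\<epsilon> > 0"
  shows "\<exists>M>0. \<forall>\<alpha> \<beta> r. \<exists>u\<ge>r. u + \<epsilon> / 2 \<le> r + M \<and> {u..u + \<epsilon> / 2} \<subseteq> near_both s \<epsilon> \<alpha> \<beta>"
proof -
  obtain N :: nat where N: "N > 0" "1 / real N < \<epsilon> / 2"
    using \<epsilon> by (metis half_gt_zero nat_approx_posE of_nat_0_less_iff zero_less_Suc)
  obtain p q :: int where q: "0 < q" "\<bar>of_int q * s - of_int p\<bar> < 1 / real N"
    using Dirichlet_approx [OF N(1), of s] by metis
  define \<theta> where "\<theta> = of_int q * s - of_int p"
  have "\<theta> \<noteq> 0"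
  proof
    assume "\<theta> = 0"
    then have "s = of_int p / of_int q" using q(1) by (simp add: \<theta>_def field_simps)
    then show False using s by (metis Rats_divide Rats_of_int)
  qed
  have \<theta>: "\<bar>\<theta>\<bar> < \<epsilon> / 2" using q(2) N(2) by (simp add: \<theta>_def)
  define \<sigma> :: int where "\<sigma> = (if \<theta> > 0 then 1 else -1)"
  have \<sigma>: "of_int \<sigma> * \<theta> = \<bar>\<theta>\<bar>" "\<sigma> * \<sigma> = 1" "\<bar>of_int \<sigma>\<bar> = (1 :: real)" using \<open>\<theta> \<noteq> 0\<close> by (auto simp: \<sigma>_def)
  define M where "M = s + s * of_int q * (1 / \<bar>\<theta>\<bar> + 1) + \<epsilon> / 2"
  have "M > 0" using s q(1) \<epsilon> by (simp add: M_def add_pos_nonneg)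
  moreover have "\<exists>u\<ge>r. u + \<epsilon> / 2 \<le> r + M \<and> {u..u + \<epsilon> / 2} \<subseteq> near_both s \<epsilon> \<alpha> \<beta>" for \<alpha> \<beta> r
  proof -
    define n0 where "n0 = \<lceil>(r - \<beta>) / s\<rceil>"
    have "(r - \<beta>) / s \<le> of_int n0" "of_int n0 < (r - \<beta>) / s + 1" unfolding n0_def by linarith+
    then have n0: "r \<le> s * of_int n0 + \<beta>" "s * of_int n0 + \<beta> < r + s" using s by (simp_all add: field_simps)
    \<comment> \<open>The sign \<sigma> makes the walk modulo 1 increase. It is stopped after j
      moves, when it has passed the integer \<open>\<lceil>x\<rceil>\<close> by less than
      |\<theta>|.\<close>
    define x where "x = of_int \<sigma> * (s * of_int n0 + \<beta> - \<alpha>)"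
    define j where "j = \<lceil>(of_int \<lceil>x\<rceil> - x) / \<bar>\<theta>\<bar>\<rceil>"
    have j1: "(of_int \<lceil>x\<rceil> - x) / \<bar>\<theta>\<bar> \<le> of_int j" "of_int j < (of_int \<lceil>x\<rceil> - x) / \<bar>\<theta>\<bar> + 1"
      unfolding j_def by linarith+
    then have j2: "of_int \<lceil>x\<rceil> - x \<le> of_int j * \<bar>\<theta>\<bar>" "of_int j * \<bar>\<theta>\<bar> < of_int \<lceil>x\<rceil> - x + \<bar>\<theta>\<bar>"
      using \<open>\<theta> \<noteq> 0\<close> by (simp_all add: field_simps)
    have cx: "of_int \<lceil>x\<rceil> - x \<ge> 0" "of_int \<lceil>x\<rceil> - x \<le> 1" by linarith+
    then have "(of_int \<lceil>x\<rceil> - x) / \<bar>\<theta>\<bar> \<ge> 0" "(of_int \<lceil>x\<rceil> - x) / \<bar>\<theta>\<bar> \<le> 1 / \<bar>\<theta>\<bar>"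
      by (auto intro: divide_right_mono)
    then have j3: "0 \<le> real_of_int j" "of_int j \<le> 1 / \<bar>\<theta>\<bar> + 1" using j1 by linarith+
    define u where "u = s * of_int (n0 + j * q) + \<beta>"
    define m where "m = \<sigma> * \<lceil>x\<rceil> + j * p"
    have "of_int \<sigma> * (u - of_int m - \<alpha>) = x + of_int j * (of_int \<sigma> * \<theta>) - of_int (\<sigma> * \<sigma>) * of_int \<lceil>x\<rceil>"
      by (simp add: u_def m_def x_def \<theta>_def algebra_simps)
    then have "of_int \<sigma> * (u - of_int m - \<alpha>) = x + of_int j * \<bar>\<theta>\<bar> - of_int \<lceil>x\<rceil>"
      by (simp add: \<sigma>)
    then have "\<bar>of_int \<sigma> * (u - of_int m - \<alpha>)\<bar> < \<epsilon> / 2" using j2 \<theta> by linarith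
    then have um: "\<bar>u - of_int m - \<alpha>\<bar> < \<epsilon> / 2" by (simp add: abs_mult \<sigma>)
    have un: "u - s * of_int (n0 + j * q) - \<beta> = 0" by (simp add: u_def)
    have "{u..u + \<epsilon> / 2} \<subseteq> near_both s \<epsilon> \<alpha> \<beta>"
    proof
      fix v assume "v \<in> {u..u + \<epsilon> / 2}"
      then have "u \<le> v" "v \<le> u + \<epsilon> / 2" by auto
      then have "\<bar>v - of_int m - \<alpha>\<bar> < \<epsilon>" "\<bar>v - s * of_int (n0 + j * q) - \<beta>\<bar> < \<epsilon>"
        using um un \<epsilon> by linarith+
      then show "v \<in> near_both s \<epsilon> \<alpha> \<beta>" unfolding near_both_def by blast
    qed
    moreover have "0 \<le> s * of_int q * of_int j" "s * of_int q * of_int j \<le> s * of_int q * (1 / \<bar>\<theta>\<bar> + 1)"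
      using s q(1) j3 by (auto intro!: mult_nonneg_nonneg mult_left_mono)
    moreover have "u = s * of_int n0 + \<beta> + s * of_int q * of_int j" by (simp add: u_def algebra_simps)
    ultimately show ?thesis using n0 unfolding M_def by (intro exI [of _ u] conjI) (assumption | linarith)+
  qed
  ultimately show ?thesis by blast
qed

subsection \<open>The torus dynamics\<close>

definition in_square :: "real \<Rightarrow> complex \<Rightarrow> bool" where
  "in_square r a \<longleftrightarrow> \<bar>Re a\<bar> < r/2 \<and> \<bar>Im a\<bar> < r/2"

definition square_lattice :: "real \<Rightarrow> complex set" where
  "square_lattice r = {r *\<^sub>R Complex (of_int m) (of_int n) |m n. True}"

text \<open>The position a is not confined to the square, so it matters only modulo the lattice and
  can be carried along before it is reduced.\<close>

definition at_cell :: "real \<Rightarrow> complex \<Rightarrow> complex \<Rightarrow> complex \<Rightarrow> bool" where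
  "at_cell r z w a \<longleftrightarrow> (\<exists>q. w = grid_center r z q + a)"

text \<open>
  A point of the plane is recorded by its positions \<open>a\<close> and \<open>b\<close> relative to the centres of its cells
  in the two grids; the relation below describes \<open>R\<^bsub>1,0\<^esub> \<circ> R\<^bsub>s,z\<^esub>\<close> in these coordinates, with \<open>A\<close> the
  position in the unit grid before the second rotation.
\<close>

definition torus_step :: "real \<Rightarrow> complex \<Rightarrow> complex \<Rightarrow> complex \<Rightarrow> complex \<Rightarrow> complex \<Rightarrow> bool" where
  "torus_step s a b A a' b' \<longleftrightarrow> in_square s b \<and> in_square 1 A \<and> A - (a - (1 + \<i>) * b) \<in> square_lattice 1 \<and>
     a' = - \<i> * A \<and> b' - (- \<i> * b - (1 + \<i>) * A) \<in> square_lattice s"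

lemma at_cell_square_lattice:
  assumes "at_cell r z w a" "a' - a \<in> square_lattice r" shows "at_cell r z w a'"
proof -
  obtain p q where 1: "w = grid_center r z (p, q) + a" using assms(1) by (auto simp: at_cell_def)
  obtain m n where "a' - a = r *\<^sub>R Complex (of_int m) (of_int n)" using assms(2) by (auto simp: square_lattice_def)
  then have "w = grid_center r z (p - m, q - n) + a'"
    unfolding 1 by (simp add: grid_center_def complex_eq_iff algebra_simps)
  then show ?thesis unfolding at_cell_def by blast
qed

lemma at_cell_diff:
  assumes "at_cell r z w a" "at_cell r z w' a" shows "w - w' \<in> square_lattice r"
proof -
  obtain p q where 1: "w = grid_center r z (p, q) + a" using assms(1) by (auto simp: at_cell_def)
  obtain p' q' where 2: "w' = grid_center r z (p', q') + a" using assms(2) by (auto simp: at_cell_def)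
  have "w - w' = r *\<^sub>R Complex (of_int (p - p')) (of_int (q - q'))"
    unfolding 1 2 by (simp add: grid_center_def complex_eq_iff algebra_simps)
  then show ?thesis unfolding square_lattice_def by blast
qed

lemma square_lattice_small:
  assumes "v \<in> square_lattice r" "r > 0" "\<bar>Re v\<bar> < r" "\<bar>Im v\<bar> < r" shows "v = 0"
proof -
  obtain m n where v: "v = r *\<^sub>R Complex (of_int m) (of_int n)" using assms(1) by (auto simp: square_lattice_def)
  have *: "k = 0" if "\<bar>r * of_int k\<bar> < r" for k :: int
  proof -
    have "r * \<bar>of_int k\<bar> < r * 1" using that assms(2) by (simp add: abs_mult)
    then have "\<bar>real_of_int k\<bar> < 1" using assms(2) by (simp only: mult_less_cancel_left_pos)
    then show ?thesis by linarith
  qed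
  show ?thesis using assms(3,4) * [of m] * [of n] by (simp add: v complex_eq_iff)
qed

lemma at_cell_unique:
  assumes "at_cell r z w a" "at_cell r z w a'" "in_square r a" "in_square r a'" "r > 0" shows "a = a'"
proof -
  obtain p q where 1: "w = grid_center r z (p, q) + a" using assms(1) by (auto simp: at_cell_def)
  obtain p' q' where 2: "w = grid_center r z (p', q') + a'" using assms(2) by (auto simp: at_cell_def)
  have "a - a' = grid_center r z (p', q') - grid_center r z (p, q)" using 1 2 by (simp add: algebra_simps)
  also have "\<dots> = r *\<^sub>R Complex (of_int (p' - p)) (of_int (q' - q))"
    by (simp add: grid_center_def complex_eq_iff algebra_simps)
  finally have "a - a' \<in> square_lattice r" unfolding square_lattice_def by blast
  moreover have "\<bar>Re (a - a')\<bar> < r" "\<bar>Im (a - a')\<bar> < r" using assms(3,4) unfolding in_square_def minus_complex.simps by linarith+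
  ultimately show ?thesis using square_lattice_small assms(5) by fastforce
qed

text \<open>Irrationality makes the passage from the plane to the torus injective: a point is
  determined by its residues in both grids.\<close>

lemma square_lattice_Int:
  assumes "v \<in> square_lattice 1" "v \<in> square_lattice s" "s \<notin> \<rat>" shows "v = 0"
proof -
  obtain m n where 1: "v = 1 *\<^sub>R Complex (of_int m) (of_int n)" using assms(1) unfolding square_lattice_def by blast
  obtain m' n' where 2: "v = s *\<^sub>R Complex (of_int m') (of_int n')" using assms(2) unfolding square_lattice_def by blast
  have *: "k = 0" if "of_int k = s * of_int l" for k l :: int
  proof (cases "l = 0")
    case False
    then have "s = of_int k / of_int l" using that by (simp add: field_simps)
    then show ?thesis using assms(3) by (metis Rats_divide Rats_of_int)
  qed (use that in simp)
  have "of_int m = s * of_int m'" "of_int n = s * of_int n'" using 1 2 by (auto simp: complex_eq_iff)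
  then have "m = 0" "n = 0" using * by blast+
  then show ?thesis using 1 by (simp add: complex_eq_iff)
qed

lemma grid_rotation_center:
  assumes "s > 0" "in_square s b"
  shows "grid_rotation s z (grid_center s z q + b) = Some (grid_center s z q - \<i> * b)"
proof -
  obtain m n where q: "q = (m, n)" by fastforce
  have "grid_center s z q + b \<in> interior (grid_square s z q)"
    using assms(2) unfolding q in_interior_grid_square by (auto simp: grid_center_def in_square_def algebra_simps)
  from grid_rotation_eq [OF assms(1) this] show ?thesis
    by (simp add: rotate_cw_def cis.ctr complex_eq_iff)
qed

text \<open>A clockwise quarter turn multiplies the position in its own grid by -i, hence moves the
  point by -(1 + i) times that position, and this displacement is added to the position in the other
  grid.\<close>

lemma torus_step_plane:
  assumes "s > 0" "torus_step s a b A a' b'" "at_cell 1 0 w a" "at_cell s z w b"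
  shows "\<exists>w'. (grid_rotation 1 0 \<circ>\<^sub>m grid_rotation s z) w = Some w' \<and> at_cell 1 0 w' a' \<and> at_cell s z w' b'"
proof -
  note st = assms(2) [unfolded torus_step_def]
  obtain q where q: "w = grid_center s z q + b" using assms(4) by (auto simp: at_cell_def)
  define u where "u = grid_center s z q - \<i> * b"
  have u: "grid_rotation s z w = Some u" using grid_rotation_center [OF assms(1)] st by (simp add: q u_def)
  have "at_cell 1 0 u (a - (1 + \<i>) * b)"
    using assms(3) unfolding at_cell_def u_def q by (auto simp: algebra_simps)
  then have "at_cell 1 0 u A" using st by (blast intro: at_cell_square_lattice)
  then obtain p where p: "u = grid_center 1 0 p + A" by (auto simp: at_cell_def)
  define w' where "w' = grid_center 1 0 p - \<i> * A"
  have w': "grid_rotation 1 0 u = Some w'" using grid_rotation_center [of 1 A 0 p] st by (simp add: p w'_def)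
  have "at_cell 1 0 w' a'" unfolding at_cell_def using st by (intro exI [of _ p]) (simp add: w'_def)
  moreover have "at_cell s z w' b'"
  proof (rule at_cell_square_lattice)
    have "w' = grid_center s z q + (- \<i> * b - (1 + \<i>) * A)"
      using p unfolding u_def w'_def by (simp add: algebra_simps)
    then show "at_cell s z w' (- \<i> * b - (1 + \<i>) * A)" unfolding at_cell_def by blast
  qed (use st in blast)
  ultimately show ?thesis using u w' by (auto simp: map_comp_def)
qed

lemma eventually_in_square:
  assumes "in_square r a" shows "\<forall>\<^sub>F d in nhds 0. in_square r (a + d)"
proof -
  have "open {d. in_square r (a + d)}"
    unfolding in_square_def by (intro open_Collect_conj open_Collect_less continuous_intros)
  then show ?thesis using assms by (auto simp: eventually_nhds)
qed

lemma in_square_stable: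
  assumes "finite S" "\<And>a. a \<in> S \<Longrightarrow> in_square r a"
  obtains e where "e > 0" "\<And>a d. a \<in> S \<Longrightarrow> norm d < e \<Longrightarrow> in_square r (a + d)"
proof -
  have "\<forall>\<^sub>F d in nhds 0. \<forall>a\<in>S. in_square r (a + d)"
    using assms by (intro eventually_ball_finite) (auto intro: eventually_in_square)
  then show ?thesis using that by (auto simp: eventually_nhds_metric dist_norm)
qed

lemma map_comp_funpow_double:
  "partial_iterate (h \<circ>\<^sub>m h) n w = partial_iterate h (2 * n) w"
  by (induction n) (auto simp: map_comp_def split: option.splits)

text \<open>
  The linear part of the torus map is an involution, so a perturbed orbit stays close to a periodic one,
  follows the same itinerary and closes up with it.
\<close>

theorem positive_density_periodic:
  fixes a b A :: "nat \<Rightarrow> complex"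
  assumes s: "s > 0" "s \<notin> \<rat>" and step: "\<And>n. torus_step s (a n) (b n) (A n) (a (Suc n)) (b (Suc n))"
    and a0: "in_square 1 (a 0)"
    and P: "P > 0" "a (2 * P) = a 0" "b (2 * P) = b 0"
    and least: "\<And>j. 0 < j \<Longrightarrow> j < P \<Longrightarrow> (a (2 * j), b (2 * j)) \<noteq> (a 0, b 0)"
    and h: "h = grid_rotation 1 0 \<circ>\<^sub>m grid_rotation s z"
  shows "\<exists>E. positive_density E \<and> (\<forall>w\<in>E. periodic_with_period (h \<circ>\<^sub>m h) P w)"
proof -
  have sqA: "in_square 1 (A n)" "in_square s (b n)" and a_Suc: "a (Suc n) = - \<i> * A n" for n
    using step by (auto simp: torus_step_def)
  have sqa: "in_square 1 (a n)" for n
  proof (cases n)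
    case (Suc m) then show ?thesis using sqA(1) [of m] by (simp add: a_Suc in_square_def)
  qed (use a0 in simp)
  obtain e1 where e1: "e1 > 0" "\<And>p d. p \<in> (A ` {..2 * P} \<union> a ` {..2 * P}) \<Longrightarrow> norm d < e1 \<Longrightarrow> in_square 1 (p + d)"
    by (rule in_square_stable [of "A ` {..2 * P} \<union> a ` {..2 * P}" 1]) (use sqA sqa in auto)
  obtain e2 where e2: "e2 > 0" "\<And>p d. p \<in> b ` {..2 * P} \<Longrightarrow> norm d < e2 \<Longrightarrow> in_square s (p + d)"
    by (rule in_square_stable [of "b ` {..2 * P}" s]) (use sqA in auto)
  \<comment> \<open>The deviations below are at most 2\<epsilon> for \<alpha> and \<beta>,
    6\<epsilon> for \<gamma> and 14\<epsilon> after a step in the second grid; 20 leaves a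
    margin.\<close>
  define \<epsilon> where "\<epsilon> = min e1 e2 / 20"
  have \<epsilon>: "\<epsilon> > 0" "20 * \<epsilon> \<le> e1" "20 * \<epsilon> \<le> e2" using e1 e2 by (auto simp: \<epsilon>_def)
  define X where "X = near_both s \<epsilon> (1/2 + Re (a 0)) (Re z + s/2 + Re (b 0))"
  define Y where "Y = near_both s \<epsilon> (1/2 + Im (a 0)) (Im z + s/2 + Im (b 0))"
  obtain M where M: "M > 0" "\<And>\<alpha> \<beta> r. \<exists>u\<ge>r. u + \<epsilon> / 2 \<le> r + M \<and> {u..u + \<epsilon> / 2} \<subseteq> near_both s \<epsilon> \<alpha> \<beta>"
    using near_both_relatively_dense [OF s \<epsilon>(1)] by blast
  have "positive_density {w. Re w \<in> X \<and> Im w \<in> Y}"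
    unfolding X_def Y_def using M \<epsilon>(1) by (intro positive_density_product [of _ "\<epsilon> / 2" M] open_near_both) auto
  moreover have "periodic_with_period (h \<circ>\<^sub>m h) P w" if w: "Re w \<in> X" "Im w \<in> Y" for w
  proof -
    obtain m n m' n' :: int where near: "\<bar>Re w - of_int m - (1/2 + Re (a 0))\<bar> < \<epsilon>"
      "\<bar>Re w - s * of_int n - (Re z + s/2 + Re (b 0))\<bar> < \<epsilon>" "\<bar>Im w - of_int m' - (1/2 + Im (a 0))\<bar> < \<epsilon>"
      "\<bar>Im w - s * of_int n' - (Im z + s/2 + Im (b 0))\<bar> < \<epsilon>"
      using w by (auto simp: X_def Y_def near_both_def)
    define \<alpha> where "\<alpha> = w - grid_center 1 0 (m, m') - a 0"
    define \<beta> where "\<beta> = w - grid_center s z (n, n') - b 0"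
    have "norm \<alpha> \<le> \<bar>Re \<alpha>\<bar> + \<bar>Im \<alpha>\<bar>" "norm \<beta> \<le> \<bar>Re \<beta>\<bar> + \<bar>Im \<beta>\<bar>" by (rule cmod_le)+
    moreover have "\<bar>Re \<alpha>\<bar> < \<epsilon>" "\<bar>Im \<alpha>\<bar> < \<epsilon>" "\<bar>Re \<beta>\<bar> < \<epsilon>" "\<bar>Im \<beta>\<bar> < \<epsilon>"
      using near by (simp_all add: \<alpha>_def \<beta>_def grid_center_def algebra_simps)
    ultimately have \<alpha>\<beta>: "norm \<alpha> < 2 * \<epsilon>" "norm \<beta> < 2 * \<epsilon>" by linarith+
    define \<gamma> where "\<gamma> = \<alpha> - (1 + \<i>) * \<beta>"
    have i2: "norm ((1 + \<i>) * v) \<le> 2 * norm v" for v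
      using norm_triangle_ineq [of v "\<i> * v"] by (simp add: norm_mult distrib_right)
    have \<gamma>: "norm \<gamma> < 6 * \<epsilon>" using norm_triangle_ineq4 [of \<alpha> "(1 + \<i>) * \<beta>"] i2 [of \<beta>] \<alpha>\<beta> by (simp add: \<gamma>_def)
    \<comment> \<open>The deviations alternate with period two because the linear part is an
      involution; at even times they equal the initial ones, so the perturbed orbit closes after 2P
      steps.\<close>
    define da where "da n = (if even n then \<alpha> else - \<i> * \<gamma>)" for n :: nat
    define db where "db n = (if even n then \<beta> else - \<i> * \<beta> - (1 + \<i>) * \<gamma>)" for n :: nat
    define dA where "dA n = (if even n then \<gamma> else \<i> * \<alpha>)" for n :: nat
    have lin: "dA n = da n - (1 + \<i>) * db n" "da (Suc n) = - \<i> * dA n"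
      "db (Suc n) = - \<i> * db n - (1 + \<i>) * dA n" for n
      by (auto simp: da_def db_def dA_def \<gamma>_def complex_eq_iff)
    have "norm (- \<i> * \<beta> - (1 + \<i>) * \<gamma>) < 14 * \<epsilon>"
      using norm_triangle_ineq4 [of "- \<i> * \<beta>" "(1 + \<i>) * \<gamma>"] i2 [of \<gamma>] \<alpha>\<beta> \<gamma> by (simp add: norm_mult)
    then have small: "norm (da n) < e1" "norm (dA n) < e1" "norm (db n) < e2" for n
      using \<alpha>\<beta> \<gamma> \<epsilon> by (auto simp: da_def db_def dA_def norm_mult)
    have pert: "torus_step s (a n + da n) (b n + db n) (A n + dA n) (a (Suc n) + da (Suc n)) (b (Suc n) + db (Suc n))"
      if "n \<le> 2 * P" for n
    proof -
      have "in_square s (b n + db n)" "in_square 1 (A n + dA n)" using that e1 e2 small by auto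
      moreover have q1: "A n + dA n - (a n + da n - (1 + \<i>) * (b n + db n)) = A n - (a n - (1 + \<i>) * b n)"
        using lin(1) [of n] by (simp add: algebra_simps)
      moreover have q2: "b (Suc n) + db (Suc n) - (- \<i> * (b n + db n) - (1 + \<i>) * (A n + dA n)) =
          b (Suc n) - (- \<i> * b n - (1 + \<i>) * A n)"
        unfolding lin(3) [of n] by (simp add: algebra_simps)
      moreover have "a (Suc n) + da (Suc n) = - \<i> * (A n + dA n)"
        using lin(2) [of n] a_Suc [of n] by (simp add: algebra_simps)
      ultimately show ?thesis using step [of n] unfolding torus_step_def q1 q2 by blast
    qed
    have w0: "at_cell 1 0 w (a 0 + da 0)" "at_cell s z w (b 0 + db 0)"
      unfolding at_cell_def da_def db_def \<alpha>_def \<beta>_def by (auto simp: algebra_simps)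
    have orbit: "\<exists>w'. partial_iterate h n w = Some w' \<and> at_cell 1 0 w' (a n + da n) \<and> at_cell s z w' (b n + db n)"
      if "n \<le> 2 * P" for n
      using that
    proof (induction n)
      case 0 then show ?case using w0 by simp
    next
      case (Suc n)
      then obtain w' where w': "partial_iterate h n w = Some w'" "at_cell 1 0 w' (a n + da n)" "at_cell s z w' (b n + db n)"
        by auto
      show ?case
        using torus_step_plane [OF s(1) pert w'(2,3)] Suc.prems w'(1) by (auto simp: h map_comp_def)
    qed
    have "partial_iterate (h \<circ>\<^sub>m h) P w = Some w"
    proof -
      obtain w' where w': "partial_iterate h (2 * P) w = Some w'" "at_cell 1 0 w' (a (2 * P) + da (2 * P))"
        "at_cell s z w' (b (2 * P) + db (2 * P))" using orbit [of "2 * P"] by auto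
      then have "at_cell 1 0 w' (a 0 + da 0)" "at_cell s z w' (b 0 + db 0)"
        using P by (simp_all add: da_def db_def)
      then have "w' - w \<in> square_lattice 1" "w' - w \<in> square_lattice s" using w0 at_cell_diff by blast+
      then have "w' = w" using square_lattice_Int s(2) by fastforce
      then show ?thesis using w'(1) by (simp add: map_comp_funpow_double)
    qed
    moreover have "partial_iterate (h \<circ>\<^sub>m h) j w \<noteq> Some w" if j: "0 < j" "j < P" for j
    proof
      assume "partial_iterate (h \<circ>\<^sub>m h) j w = Some w"
      then have "at_cell 1 0 w (a (2 * j) + da (2 * j))" "at_cell s z w (b (2 * j) + db (2 * j))"
        using orbit [of "2 * j"] j by (auto simp: map_comp_funpow_double)
      moreover have "in_square 1 (a (2 * j) + da (2 * j))" "in_square s (b (2 * j) + db (2 * j))"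
        "in_square 1 (a 0 + da 0)" "in_square s (b 0 + db 0)"
        using j e1 e2 small by auto
      ultimately have "a (2 * j) + da (2 * j) = a 0 + da 0" "b (2 * j) + db (2 * j) = b 0 + db 0"
        using w0 s(1) at_cell_unique by (meson zero_less_one)+
      then show False using least [OF j] by (simp add: da_def db_def)
    qed
    ultimately show ?thesis using P(1) unfolding periodic_with_period_def by blast
  qed
  ultimately show ?thesis by (intro exI [of _ "{w. Re w \<in> X \<and> Im w \<in> Y}"]) auto
qed

section \<open>Invariant surfaces and the passage from planar orbits to periods\<close>

text \<open>
  Two invariant surfaces of the torus: \<open>a = (-\<i>)\<^sup>n \<i> x\<close>, \<open>b = (-\<i>)\<^sup>n (1 + \<i>) y\<close>, on which \<open>R\<^bsub>1,0\<^esub> \<circ> R\<^bsub>s,z\<^esub>\<close> acts as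
  \<open>pet s\<close>, and \<open>a = (-\<i>)\<^sup>n (1 - \<i>) s y\<close>, \<open>b = - (-\<i>)\<^sup>n \<i> s x\<close>, on which it acts as \<open>pet_inv (1 / s)\<close>.
\<close>

lemma square_lattice_pow: "v \<in> square_lattice r \<Longrightarrow> (- \<i>) ^ n * v \<in> square_lattice r"
proof (induction n)
  case (Suc n)
  then obtain k l where v: "(- \<i>) ^ n * v = r *\<^sub>R Complex (of_int k) (of_int l)" by (auto simp: square_lattice_def)
  have "(- \<i>) ^ Suc n * v = - \<i> * ((- \<i>) ^ n * v)" by simp
  also have "\<dots> = r *\<^sub>R Complex (of_int l) (of_int (- k))" unfolding v by (simp add: complex_eq_iff)
  finally show ?case unfolding square_lattice_def by blast
qed simp

lemma in_square_pow: "in_square r ((- \<i>) ^ n * v) \<longleftrightarrow> in_square r v"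
proof (induction n)
  case (Suc n)
  have "in_square r ((- \<i>) ^ Suc n * v) \<longleftrightarrow> in_square r (- \<i> * ((- \<i>) ^ n * v))" by (simp only: power_Suc mult.assoc)
  also have "\<dots> \<longleftrightarrow> in_square r ((- \<i>) ^ n * v)" unfolding in_square_def by (simp only: Re_i_times Im_i_times mult_minus_left uminus_complex.simps abs_minus_cancel minus_minus conj_commute)
  finally show ?case using Suc by blast
qed simp

text \<open>Since (1 + i)^2 = 2i, the displacement of i x is -2i y, and -i b - (1 + i) A becomes (1
  - i)(y + x'). The reductions are by i k and by s m (1 - i), which lie in the two lattices.\<close>

lemma torus_step_pet:
  assumes "(x, y) \<in> generic_cell s" "s > 0" "pet s (x, y) = (x', y')"
  shows "torus_step s ((- \<i>) ^ n * (\<i> * of_real x)) ((- \<i>) ^ n * ((1 + \<i>) * of_real y)) ((- \<i>) ^ n * (\<i> * of_real x'))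
    ((- \<i>) ^ Suc n * (\<i> * of_real x')) ((- \<i>) ^ Suc n * ((1 + \<i>) * of_real y'))"
proof -
  obtain k m where *: "x' = x - 2 * y - of_int k" "y' = y + x' - s * of_int m" "(x', y') \<in> generic_cell s"
    using pet_cases [OF assms(1,2)] assms(3) by (metis prod.inject)
  have b: "\<bar>y\<bar> < s/2" "\<bar>x'\<bar> < 1/2" using assms(1) *(3) by (auto simp: generic_cell_iff)
  have 1: "\<i> * of_real x' - (\<i> * of_real x - (1 + \<i>) * ((1 + \<i>) * of_real y)) = 1 *\<^sub>R Complex (of_int 0) (of_int (- k))"
    using *(1) by (simp add: complex_eq_iff algebra_simps)
  have 2: "- \<i> * ((1 + \<i>) * of_real y') - (- \<i> * ((1 + \<i>) * of_real y) - (1 + \<i>) * (\<i> * of_real x')) =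
      s *\<^sub>R Complex (of_int (- m)) (of_int m)"
    using *(2) by (simp add: complex_eq_iff algebra_simps)
  have "(- \<i>) ^ n * (\<i> * of_real x') - ((- \<i>) ^ n * (\<i> * of_real x) - (1 + \<i>) * ((- \<i>) ^ n * ((1 + \<i>) * of_real y)))
      = (- \<i>) ^ n * (\<i> * of_real x' - (\<i> * of_real x - (1 + \<i>) * ((1 + \<i>) * of_real y)))"
    by (simp add: algebra_simps)
  moreover have "\<i> * of_real x' - (\<i> * of_real x - (1 + \<i>) * ((1 + \<i>) * of_real y)) \<in> square_lattice 1"
    unfolding 1 square_lattice_def by blast
  ultimately have l1: "(- \<i>) ^ n * (\<i> * of_real x') - ((- \<i>) ^ n * (\<i> * of_real x) - (1 + \<i>) * ((- \<i>) ^ n * ((1 + \<i>) * of_real y))) \<in> square_lattice 1"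
    by (metis square_lattice_pow)
  have "(- \<i>) ^ Suc n * ((1 + \<i>) * of_real y') - (- \<i> * ((- \<i>) ^ n * ((1 + \<i>) * of_real y)) - (1 + \<i>) * ((- \<i>) ^ n * (\<i> * of_real x')))
     = (- \<i>) ^ n * (- \<i> * ((1 + \<i>) * of_real y') - (- \<i> * ((1 + \<i>) * of_real y) - (1 + \<i>) * (\<i> * of_real x')))"
    by (simp add: algebra_simps)
  moreover have "- \<i> * ((1 + \<i>) * of_real y') - (- \<i> * ((1 + \<i>) * of_real y) - (1 + \<i>) * (\<i> * of_real x')) \<in> square_lattice s"
    unfolding 2 square_lattice_def by blast
  ultimately have l2: "(- \<i>) ^ Suc n * ((1 + \<i>) * of_real y') - (- \<i> * ((- \<i>) ^ n * ((1 + \<i>) * of_real y)) - (1 + \<i>) * ((- \<i>) ^ n * (\<i> * of_real x'))) \<in> square_lattice s"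
    by (metis square_lattice_pow)
  show ?thesis
    unfolding torus_step_def in_square_pow using b l1 l2 by (simp add: in_square_def)
qed

text \<open>The roles are exchanged: a runs along a diagonal and b along an axis. The factor s turns
  the periods 1/s and 1 of the planar map into the periods 1 and s of the two grids.\<close>

lemma torus_step_pet_inv:
  assumes "(x, y) \<in> generic_cell (1 / s)" "s > 0" "pet_inv (1 / s) (x, y) = (x', y')"
  shows "torus_step s ((- \<i>) ^ n * ((1 - \<i>) * of_real (s * y))) ((- \<i>) ^ n * (- \<i> * of_real (s * x)))
    ((- \<i>) ^ n * ((1 - \<i>) * of_real (s * y')))
    ((- \<i>) ^ Suc n * ((1 - \<i>) * of_real (s * y'))) ((- \<i>) ^ Suc n * (- \<i> * of_real (s * x')))"
proof -
  have "1 / s > 0" using assms(2) by simp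
  then obtain k m where *: "y' = y - x - 1 / s * of_int m" "x' = x + 2 * y' - of_int k" "(x', y') \<in> generic_cell (1 / s)"
    using pet_inv_cases [OF assms(1)] assms(3) by (metis prod.inject)
  have sy: "s * y' = s * y - s * x - of_int m" "s * x' = s * x + 2 * (s * y') - s * of_int k"
    unfolding *(2) using assms(2) *(1) by (simp_all add: field_simps)
  have "\<bar>x\<bar> < 1/2" "\<bar>y'\<bar> < 1 / s / 2" using assms(1) *(3) by (auto simp: generic_cell_iff)
  then have b: "\<bar>s * x\<bar> < s/2" "\<bar>s * y'\<bar> < 1/2" using assms(2) by (simp_all add: abs_mult field_simps)
  have 1: "(1 - \<i>) * of_real (s * y') - ((1 - \<i>) * of_real (s * y) - (1 + \<i>) * (- \<i> * of_real (s * x))) =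
      1 *\<^sub>R Complex (of_int (- m)) (of_int m)"
    unfolding sy(1) by (simp add: complex_eq_iff algebra_simps)
  have 2: "- \<i> * (- \<i> * of_real (s * x')) - (- \<i> * (- \<i> * of_real (s * x)) - (1 + \<i>) * ((1 - \<i>) * of_real (s * y'))) =
      s *\<^sub>R Complex (of_int k) (of_int 0)"
    unfolding sy(2) by (simp add: complex_eq_iff algebra_simps)
  have "(- \<i>) ^ n * ((1 - \<i>) * of_real (s * y')) - ((- \<i>) ^ n * ((1 - \<i>) * of_real (s * y)) - (1 + \<i>) * ((- \<i>) ^ n * (- \<i> * of_real (s * x))))
      = (- \<i>) ^ n * ((1 - \<i>) * of_real (s * y') - ((1 - \<i>) * of_real (s * y) - (1 + \<i>) * (- \<i> * of_real (s * x))))"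
    by (simp add: algebra_simps)
  moreover have "(1 - \<i>) * of_real (s * y') - ((1 - \<i>) * of_real (s * y) - (1 + \<i>) * (- \<i> * of_real (s * x))) \<in> square_lattice 1"
    unfolding 1 square_lattice_def by blast
  ultimately have l1: "(- \<i>) ^ n * ((1 - \<i>) * of_real (s * y')) - ((- \<i>) ^ n * ((1 - \<i>) * of_real (s * y)) - (1 + \<i>) * ((- \<i>) ^ n * (- \<i> * of_real (s * x)))) \<in> square_lattice 1"
    by (metis square_lattice_pow)
  have "(- \<i>) ^ Suc n * (- \<i> * of_real (s * x')) - (- \<i> * ((- \<i>) ^ n * (- \<i> * of_real (s * x))) - (1 + \<i>) * ((- \<i>) ^ n * ((1 - \<i>) * of_real (s * y'))))
     = (- \<i>) ^ n * (- \<i> * (- \<i> * of_real (s * x')) - (- \<i> * (- \<i> * of_real (s * x)) - (1 + \<i>) * ((1 - \<i>) * of_real (s * y'))))"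
    by (simp add: algebra_simps)
  moreover have "- \<i> * (- \<i> * of_real (s * x')) - (- \<i> * (- \<i> * of_real (s * x)) - (1 + \<i>) * ((1 - \<i>) * of_real (s * y'))) \<in> square_lattice s"
    unfolding 2 square_lattice_def by blast
  ultimately have l2: "(- \<i>) ^ Suc n * (- \<i> * of_real (s * x')) - (- \<i> * ((- \<i>) ^ n * (- \<i> * of_real (s * x))) - (1 + \<i>) * ((- \<i>) ^ n * ((1 - \<i>) * of_real (s * y')))) \<in> square_lattice s"
    by (metis square_lattice_pow)
  show ?thesis
    unfolding torus_step_def in_square_pow using b l1 l2 by (simp add: in_square_def)
qed

text \<open>At time 2j the factor (-i)^(2j) is the sign (-1)^j, so the torus orbit returns exactly
  when \<open>T\<close> returns up to that sign. A return after P double steps bounds the orbit up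
  to sign by 2 * 2P points, which explains the factor 4.\<close>

lemma positive_density_if_long_orbit:
  fixes \<alpha> \<beta> :: "real \<times> real \<Rightarrow> complex"
  assumes s: "s > 0" "s \<notin> \<rat>" and T: "odd_map T X" "inj_on T X" and L: "long_orbit T X (4 * N)"
    and step: "\<And>p n. p \<in> X \<Longrightarrow> torus_step s ((- \<i>) ^ n * \<alpha> p) ((- \<i>) ^ n * \<beta> p) ((- \<i>) ^ n * \<alpha> (T p))
        ((- \<i>) ^ Suc n * \<alpha> (T p)) ((- \<i>) ^ Suc n * \<beta> (T p))"
    and in_square: "\<And>p. p \<in> X \<Longrightarrow> in_square 1 (\<alpha> p)"
    and uminus: "\<And>p. \<alpha> (- p) = - \<alpha> p" "\<And>p. \<beta> (- p) = - \<beta> p"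
    and inj: "\<And>p q. \<alpha> p = \<alpha> q \<Longrightarrow> \<beta> p = \<beta> q \<Longrightarrow> p = q"
    and h: "h = grid_rotation 1 0 \<circ>\<^sub>m grid_rotation s z"
  shows "\<exists>P\<ge>N. P > 0 \<and> (\<exists>E. positive_density E \<and> (\<forall>w\<in>E. periodic_with_period (h \<circ>\<^sub>m h) P w))"
proof -
  obtain p where p: "p \<in> X" "finite (orb T p)" "4 * N \<le> card (orb T p)" using L by (auto simp: long_orbit_def)
  have pX: "(T ^^ n) p \<in> X" for n using odd_map_funpow [OF T(1) p(1)] by blast
  define a where "a n = (- \<i>) ^ n * \<alpha> ((T ^^ n) p)" for n
  define b where "b n = (- \<i>) ^ n * \<beta> ((T ^^ n) p)" for n
  define A where "A n = (- \<i>) ^ n * \<alpha> ((T ^^ Suc n) p)" for n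
  have st: "torus_step s (a n) (b n) (A n) (a (Suc n)) (b (Suc n))" for n
    using step [OF pX [of n], of n] by (simp add: a_def b_def A_def)
  have ret: "a (2 * j) = a 0 \<and> b (2 * j) = b 0 \<longleftrightarrow> (T ^^ (2 * j)) p = (if even j then p else - p)" for j
  proof -
    define q where "q = (T ^^ (2 * j)) p"
    have "((- \<i>) ^ 2) ^ j = (if even j then 1 else -1)" by simp
    then have pw: "(- \<i>) ^ (2 * j) = (if even j then 1 else -1)" by (simp only: power_mult)
    have e: "a 0 = \<alpha> p" "b 0 = \<beta> p" "a (2 * j) = (if even j then 1 else -1) * \<alpha> q" "b (2 * j) = (if even j then 1 else -1) * \<beta> q"
      unfolding a_def b_def q_def pw by simp_all
    have "a (2 * j) = a 0 \<and> b (2 * j) = b 0 \<longleftrightarrow> q = (if even j then p else - p)"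
    proof (cases "even j")
      case True
      then have "a (2 * j) = \<alpha> q" "b (2 * j) = \<beta> q" using e by simp_all
      then show ?thesis using True e inj [of q p] by auto
    next
      case False
      then have "a (2 * j) = \<alpha> (- q)" "b (2 * j) = \<beta> (- q)" using e uminus [of q] by simp_all
      then have "a (2 * j) = a 0 \<and> b (2 * j) = b 0 \<longleftrightarrow> - q = p" using e inj [of "- q" p] by auto
      moreover have "- q = p \<longleftrightarrow> q = - p" by (metis minus_minus)
      ultimately show ?thesis using False by simp
    qed
    then show ?thesis unfolding q_def .
  qed
  obtain i j where ij: "i < j" "(T ^^ j) p = (T ^^ i) p" by (rule orb_finite_repeat [OF p(2)])
  have cancel: "q = r" if "(T ^^ n) q = (T ^^ n) r" "q \<in> X" "r \<in> X" for n q r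
    using that
  proof (induction n)
    case (Suc n)
    have "(T ^^ n) q \<in> X" "(T ^^ n) r \<in> X" using odd_map_funpow [OF T(1)] Suc.prems by blast+
    then show ?case using Suc.IH Suc.prems T(2) by (metis comp_apply funpow.simps(2) inj_onD)
  qed simp
  have "(T ^^ i) ((T ^^ (j - i)) p) = (T ^^ i) p"
    using ij by (metis comp_apply funpow_add le_add_diff_inverse less_imp_le)
  then have per: "(T ^^ (j - i)) p = p" using cancel pX p(1) by blast
  define d where "d = j - i"
  have d: "d > 0" "(T ^^ d) p = p" using ij per by (auto simp: d_def)
  have "(T ^^ (k * d)) p = p" for k
    by (induction k) (simp_all add: funpow_add d)
  \<comment> \<open>Time 4d is twice the even number 2d, so the sign in \<open>ret\<close> is
    positive.\<close>
  from this [of 4] have ex: "2 * d > 0 \<and> a (2 * (2 * d)) = a 0 \<and> b (2 * (2 * d)) = b 0"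
    using ret [of "2 * d"] d(1) by simp
  define P where "P = (LEAST n. n > 0 \<and> a (2 * n) = a 0 \<and> b (2 * n) = b 0)"
  have P: "P > 0" "a (2 * P) = a 0" "b (2 * P) = b 0"
    using LeastI [where P = "\<lambda>n. n > 0 \<and> a (2 * n) = a 0 \<and> b (2 * n) = b 0", OF ex] by (auto simp: P_def)
  have least: "(a (2 * j), b (2 * j)) \<noteq> (a 0, b 0)" if "0 < j" "j < P" for j
    using not_less_Least [where P = "\<lambda>n. n > 0 \<and> a (2 * n) = a 0 \<and> b (2 * n) = b 0"] that by (auto simp: P_def)
  have "(T ^^ (2 * P)) p = (T ^^ 0) p \<or> (T ^^ (2 * P)) p = - (T ^^ 0) p"
    using ret [of P] P by auto
  then have "card (orb T p) \<le> 2 * (2 * P)"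
    using orb_finite_card(2) [OF T(1) p(1), of 0 "2 * P"] P(1) by simp
  then have "N \<le> P" using p(3) by simp
  moreover have "in_square 1 (a 0)" using in_square [OF p(1)] by (simp add: a_def)
  ultimately show ?thesis
    using positive_density_periodic [OF s st _ P least h] P(1) by blast
qed

theorem unbounded_periods:
  assumes s: "s > 0" "s \<notin> \<rat>" and h: "h = grid_rotation 1 0 \<circ>\<^sub>m grid_rotation s z"
  shows "\<exists>P\<ge>N. P > 0 \<and> (\<exists>E. positive_density E \<and> (\<forall>w\<in>E. periodic_with_period (h \<circ>\<^sub>m h) P w))"
proof -
  have "s \<noteq> 1" using s(2) by auto
  then consider "s > 1" | "s < 1" by linarith
  then show ?thesis
  proof cases
    case 1
    have "long_orbit (pet_shift s) (generic_cell s) (4 * N)"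
      using long_orbit_pet_shift_unbounded [OF 1 s(2), of "4 * N"] by (rule long_orbit_mono) simp
    then have L: "long_orbit (pet s) (generic_cell s) (4 * N)" using long_orbit_pet_iff_pet_shift [OF s(1)] by blast
    have "inj_on (pet s) (generic_cell s)" using pet_inv_pet s(1) by (metis inj_onI)
    then show ?thesis
    proof (rule positive_density_if_long_orbit [OF s odd_map_pet [OF s(1)] _ L _ _ _ _ _ h,
          where \<alpha> = "\<lambda>p. \<i> * of_real (fst p)" and \<beta> = "\<lambda>p. (1 + \<i>) * of_real (snd p)"])
      fix p :: "real \<times> real" and n assume "p \<in> generic_cell s"
      then show "torus_step s ((- \<i>) ^ n * (\<i> * of_real (fst p))) ((- \<i>) ^ n * ((1 + \<i>) * of_real (snd p)))
          ((- \<i>) ^ n * (\<i> * of_real (fst (pet s p)))) ((- \<i>) ^ Suc n * (\<i> * of_real (fst (pet s p))))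
          ((- \<i>) ^ Suc n * ((1 + \<i>) * of_real (snd (pet s p))))"
        by (intro torus_step_pet s) auto
    next
      fix p :: "real \<times> real" assume "p \<in> generic_cell s"
      then show "in_square 1 (\<i> * of_real (fst p))" by (cases p) (auto simp: in_square_def generic_cell_iff)
    qed (auto simp: prod_eq_iff complex_eq_iff)
  next
    case 2
    define t where "t = 1 / s"
    have t: "t > 1" "t \<notin> \<rat>" "t > 0"
      using 2 s Rats_divide [OF Rats_1, of "1 / s"] by (auto simp: t_def)
    have "long_orbit (pet_shift t) (generic_cell t) (4 * N)"
      using long_orbit_pet_shift_unbounded [OF t(1,2), of "4 * N"] by (rule long_orbit_mono) simp
    then have "long_orbit (pet t) (generic_cell t) (4 * N)" using long_orbit_pet_iff_pet_shift [OF t(3)] by blast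
    then have L: "long_orbit (pet_inv t) (generic_cell t) (4 * N)" by (rule long_orbit_pet_inv_if_pet [OF t(3)])
    have "inj_on (pet_inv t) (generic_cell t)" using pet_pet_inv t(3) by (metis inj_onI)
    then show ?thesis
    proof (rule positive_density_if_long_orbit [OF s odd_map_pet_inv [OF t(3)] _ L _ _ _ _ _ h,
          where \<alpha> = "\<lambda>p. (1 - \<i>) * of_real (s * snd p)" and \<beta> = "\<lambda>p. - \<i> * of_real (s * fst p)"])
      fix p :: "real \<times> real" and n assume "p \<in> generic_cell t"
      then show "torus_step s ((- \<i>) ^ n * ((1 - \<i>) * of_real (s * snd p))) ((- \<i>) ^ n * (- \<i> * of_real (s * fst p)))
          ((- \<i>) ^ n * ((1 - \<i>) * of_real (s * snd (pet_inv t p)))) ((- \<i>) ^ Suc n * ((1 - \<i>) * of_real (s * snd (pet_inv t p))))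
          ((- \<i>) ^ Suc n * (- \<i> * of_real (s * fst (pet_inv t p))))"
        unfolding t_def by (intro torus_step_pet_inv s) auto
    next
      fix p :: "real \<times> real" assume p: "p \<in> generic_cell t"
      have "\<bar>s * snd p\<bar> < 1/2" using p s(1) by (cases p) (simp add: generic_cell_iff t_def abs_mult field_simps)
      then show "in_square 1 ((1 - \<i>) * of_real (s * snd p))" by (simp add: in_square_def)
    qed (use s in \<open>auto simp: prod_eq_iff complex_eq_iff\<close>)
  qed
qed

theorem theorem1p4:
  fixes s :: real and z :: complex and g :: "letter list"
  assumes "g = ([A1] \<otimes>\<^bsub>Z4_free_Z4\<^esub> [A2]) [^]\<^bsub>Z4_free_Z4\<^esub> (2::nat)"
    and "s > 0" and "s \<notin> \<rat>"
  shows "\<exists>p :: nat \<Rightarrow> nat. (\<forall>k. p k > 0) \<and> \<not> bdd_above (range p) \<and>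
           (\<forall>k. \<exists>E. positive_density E \<and>
              (\<forall>w\<in>E. periodic_with_period (word_map s z g) (p k) w))"
proof -
  have "\<forall>k. \<exists>P\<ge>k. P > 0 \<and> (\<exists>E. positive_density E \<and> (\<forall>w\<in>E. periodic_with_period (word_map s z g) P w))"
    unfolding assms(1) word_map_A1_A2_square using unbounded_periods [OF assms(2,3) refl] by blast
  then obtain p where p: "\<And>k. p k \<ge> k" "\<And>k. p k > 0"
    "\<And>k. \<exists>E. positive_density E \<and> (\<forall>w\<in>E. periodic_with_period (word_map s z g) (p k) w)"
    by metis
  have "\<not> bdd_above (range p)"
  proof
    assume "bdd_above (range p)"
    then obtain B where "\<And>k. p k \<le> B" by (auto simp: bdd_above_def)
    then show False using p(1) [of "Suc B"] by (meson not_less_eq_eq order.trans)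
  qed
  with p show ?thesis by (intro exI [of _ p]) simp
qed

end
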